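(* Let $\mathfrak v,\mathfrak z$ be finite-dimensional real inner product spaces, $\mathfrak a=\mathbb{R}A$ a one-dimensional space, $\mathcal L$ a lattice of full rank in $\mathfrak z$, and $0<t_1<t_2$ fixed. Given a non-trivial linear map $j:\mathfrak z\to\mathfrak{so}(\mathfrak v)$ and $r>0$, there exists a constant $\lambda(j,r)>0$ such that $M(j,c,r)$ has strictly negative (sectional) curvature when $c>\lambda(j,r)$. Moreover, as $c$ approaches $\infty$, the maximum of the sectional curvature of $M(j,c,r)$ approaches $-\infty$.
   Context: Construction. Put $\mathfrak h(j)=\mathfrak v+\mathfrak z$ with bracket such that $\mathfrak z$ is central, $[\mathfrak v,\mathfrak v]\subset\mathfrak z$ and $\langle[X,Y],Z\rangle=\langle j(Z)X,Y\rangle$ for $X,Y\in\mathfrak v$, $Z\in\mathfrak z$ (where $\mathfrak{so}(\mathfrak v)$ denotes skew-symmetric endomorphisms). Put $\mathfrak g(j)=\mathfrak v+\mathfrak z+\mathfrak a$, containing $\mathfrak h(j)$ as an ideal, with $[A,X]=\frac12X$ and $[A,Z]=Z$ for $X\in\mathfrak v$, $Z\in\mathfrak z$. Put $\mathfrak r=\mathfrak v+\mathfrak a$ with $\mathfrak v$ abelian and $[A,X]=\frac12X$; thus $\mathfrak r\cong\mathfrak z\backslash\mathfrak g(j)$. Given $c>0$, put the inner products on $\mathfrak g(j)$ and $\mathfrak r$ for which $\mathfrak v,\mathfrak z,\mathfrak a$ are mutually orthogonal, carry the given inner products, and $\|A\|=1/c$. $G(j)$ and $R$ are the simply-connected Lie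 groups with Lie algebras $\mathfrak g(j),\mathfrak r$; $G(j,c)$ and $R(c)$ are these groups with the corresponding left-invariant metrics. Let $\bar G(j,c)=\exp(\mathcal L)\backslash G(j,c)$ with the induced metric. The quotient map $\pi_j:\bar G(j,c)\to R(c)$ by the torus $\exp(\mathcal L)\backslash\exp(\mathfrak z)$ is a Riemannian submersion. The group $R$ is identified with $\mathbb{R}^+\times\mathfrak v$ with multiplication $(t,X)(t',X')=(tt',X+t^{1/2}X')$, where the left-invariant field $A$ is $t\,\partial/\partial t$ and the left-invariant field $X\in\mathfrak v$ at $(t,Y)$ is $t^{1/2}D_X$, $D_X$ being the directional derivative in the direction $X$. For $r>0$ let $Q=\{(t,X)\in R: t\in[t_1,t_2],\ \|X\|=r\}$, a compact codimension-one submanifold of $R$ with boundary, and let $M(j,c,r)=\pi_j^{-1}(Q)$ with the Riemannian metric induced from $\bar G(j,c)$. *)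

theory Defs
  imports "HOL-Analysis.Analysis" "HOL-Algebra.Coset"
begin

section \<open>Smooth maps and sectional curvature in local coordinates\<close>

primrec Ck_on :: "nat \<Rightarrow> ('a::euclidean_space \<Rightarrow> 'b::euclidean_space) \<Rightarrow> 'a set \<Rightarrow> bool" where
  "Ck_on 0 f U \<longleftrightarrow> continuous_on U f"
| "Ck_on (Suc k) f U \<longleftrightarrow>
     f differentiable_on U \<and> (\<forall>v. Ck_on k (\<lambda>x. frechet_derivative f (at x) v) U)"

text \<open>As usual for manifolds with boundary, a map on a set that need not be open is smooth if
  near each point of the set it extends to a smooth map on an open set.\<close>

definition smooth_on :: "'a::euclidean_space set \<Rightarrow> ('a \<Rightarrow> 'b::euclidean_space) \<Rightarrow> bool" where
  "smooth_on D f \<longleftrightarrow>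
     (\<forall>x\<in>D. \<exists>U F. open U \<and> x \<in> U \<and> (\<forall>k. Ck_on k F U) \<and> (\<forall>y\<in>D \<inter> U. F y = f y))"

text \<open>The admissible domains of charts of a manifold with boundary.\<close>

definition half_space_open :: "'a::euclidean_space set \<Rightarrow> bool" where
  "half_space_open D \<longleftrightarrow>
     (\<exists>H. (H = UNIV \<or> (\<exists>a b. a \<noteq> 0 \<and> H = {x. a \<bullet> x \<ge> b})) \<and> openin (top_of_set H) D)"

text \<open>A Riemannian metric on a coordinate domain \<open>D\<close> is given by \<open>g x u w\<close>, for \<open>x \<in> D\<close> and
  tangent vectors \<open>u\<close>, \<open>w\<close>. All derivatives are taken within \<open>D\<close>, so that boundary points
  of \<open>D\<close> are included; derivatives within a half-space-open set are unique.\<close>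

type_synonym 'a riem_metric = "'a \<Rightarrow> 'a \<Rightarrow> 'a \<Rightarrow> real"

text \<open>The Levi-Civita connection on vector fields with constant coefficients, by the Koszul
  formula.\<close>

definition christoffel :: "'a::euclidean_space set \<Rightarrow> 'a riem_metric \<Rightarrow> 'a \<Rightarrow> 'a \<Rightarrow> 'a \<Rightarrow> 'a" where
  "christoffel D g x u v = (THE w. \<forall>y. 2 * g x w y =
       frechet_derivative (\<lambda>x. g x v y) (at x within D) u
     + frechet_derivative (\<lambda>x. g x u y) (at x within D) v
     - frechet_derivative (\<lambda>x. g x u v) (at x within D) y)"

text \<open>\<open>R(u,v)w = \<nabla>\<^sub>u \<nabla>\<^sub>v w - \<nabla>\<^sub>v \<nabla>\<^sub>u w\<close>, where \<open>u\<close>, \<open>v\<close>, \<open>w\<close> have constant coefficients.\<close>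

definition curvature_tensor :: "'a::euclidean_space set \<Rightarrow> 'a riem_metric \<Rightarrow> 'a \<Rightarrow> 'a \<Rightarrow> 'a \<Rightarrow> 'a \<Rightarrow> 'a" where
  "curvature_tensor D g x u v w =
     (let \<Gamma> = christoffel D g in
        frechet_derivative (\<lambda>x. \<Gamma> x v w) (at x within D) u + \<Gamma> x u (\<Gamma> x v w)
      - (frechet_derivative (\<lambda>x. \<Gamma> x u w) (at x within D) v + \<Gamma> x v (\<Gamma> x u w)))"

definition sectional_curvature :: "'a::euclidean_space set \<Rightarrow> 'a riem_metric \<Rightarrow> 'a \<Rightarrow> 'a \<Rightarrow> 'a \<Rightarrow> real" where
  "sectional_curvature D g x u v =
     g x (curvature_tensor D g x u v v) u / (g x u u * g x v v - (g x u v)\<^sup>2)"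


section \<open>The Lie algebra \<open>\<gg>(j)\<close>\<close>

text \<open>The spaces \<open>\<vv>\<close> and \<open>\<zz>\<close> are the types \<open>'v\<close> and \<open>'z\<close> with their inner products. The triple
  \<open>(a, X, Z)\<close> stands for the element \<open>aA + X + Z\<close> of \<open>\<gg>(j)\<close>.\<close>

definition so :: "('v::euclidean_space \<Rightarrow>\<^sub>L 'v) set" where
  "so = {T. \<forall>X Y. blinfun_apply T X \<bullet> Y = - (X \<bullet> blinfun_apply T Y)}"

definition bracket_v :: "('z::euclidean_space \<Rightarrow> 'v::euclidean_space \<Rightarrow>\<^sub>L 'v) \<Rightarrow> 'v \<Rightarrow> 'v \<Rightarrow> 'z" where
  "bracket_v j X Y = (\<Sum>b\<in>Basis. (j b X \<bullet> Y) *\<^sub>R b)"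

lemma bracket_v_inner:
  assumes "linear j"
  shows "bracket_v j X Y \<bullet> Z = j Z X \<bullet> Y"
proof -
  have "j Z X \<bullet> Y = blinfun_apply (j (\<Sum>b\<in>Basis. (Z \<bullet> b) *\<^sub>R b)) X \<bullet> Y"
    by (simp add: euclidean_representation)
  also have "\<dots> = (\<Sum>b\<in>Basis. (Z \<bullet> b) * (j b X \<bullet> Y))"
    using assms by (simp add: linear_sum linear_scale blinfun.sum_left blinfun.scaleR_left
        inner_sum_left)
  finally show ?thesis
    by (simp add: bracket_v_def inner_sum_left inner_commute[of Z] mult.commute)
qed

lemma linear_bracket_v: "linear (bracket_v j X)"
  by (rule linearI) (simp_all add: bracket_v_def inner_add_right scaleR_add_left sum.distrib
      scaleR_sum_right)

lemma bilinear_bracket_v: "bilinear (bracket_v j)"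
  unfolding bilinear_def
  by (auto intro!: linear_bracket_v linearI simp: bracket_v_def blinfun.add_right
      blinfun.scaleR_right inner_add_left scaleR_add_left sum.distrib scaleR_sum_right)

lemma bracket_v_skew:
  assumes "range j \<subseteq> so"
  shows "bracket_v j Y X = - bracket_v j X Y"
proof -
  have "j b Y \<bullet> X = - (j b X \<bullet> Y)" for b
    using assms by (auto simp: so_def inner_commute)
  then show ?thesis
    by (simp add: bracket_v_def sum_negf)
qed

fun bracket_g :: "('z::euclidean_space \<Rightarrow> 'v::euclidean_space \<Rightarrow>\<^sub>L 'v) \<Rightarrow>
    real \<times> 'v \<times> 'z \<Rightarrow> real \<times> 'v \<times> 'z \<Rightarrow> real \<times> 'v \<times> 'z" where
  "bracket_g j (a, X, Z) (a', X', Z') =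
     (0, (a / 2) *\<^sub>R X' - (a' / 2) *\<^sub>R X, a *\<^sub>R Z' - a' *\<^sub>R Z + bracket_v j X X')"

text \<open>\<open>\<vv>\<close>, \<open>\<zz>\<close>, \<open>\<aa>\<close> are mutually orthogonal and \<open>A\<close> has norm \<open>1 / c\<close>.\<close>

definition inner_g :: "real \<Rightarrow> real \<times> 'v::euclidean_space \<times> 'z::euclidean_space \<Rightarrow>
    real \<times> 'v \<times> 'z \<Rightarrow> real" where
  "inner_g c = (\<lambda>(a, X, Z) (a', X', Z'). a * a' / c\<^sup>2 + X \<bullet> X' + Z \<bullet> Z')"


section \<open>The groups \<open>R\<close> and \<open>G(j)\<close>\<close>

definition R_group :: "(real \<times> 'v::euclidean_space) monoid" where
  "R_group = \<lparr>carrier = {p. fst p > 0},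
     monoid.mult = (\<lambda>(t, X) (t', X'). (t * t', X + sqrt t *\<^sub>R X')), one = (1, 0)\<rparr>"

text \<open>The simply-connected Lie group \<open>G(j)\<close> is modelled on \<open>\<real>\<^sup>+ \<times> \<vv> \<times> \<zz>\<close> compatibly with the model
  of \<open>R\<close>. The lemmas \<open>group_G\<close>, \<open>simply_connected_G\<close> and \<open>lie_bracket_left_inv_field\<close> below show
  that this is a simply-connected group whose Lie algebra of left-invariant vector fields
  is \<open>\<gg>(j)\<close>.\<close>

definition G_group :: "('z::euclidean_space \<Rightarrow> 'v::euclidean_space \<Rightarrow>\<^sub>L 'v) \<Rightarrow>
    (real \<times> 'v \<times> 'z) monoid" where
  "G_group j = \<lparr>carrier = {p. fst p > 0},
     monoid.mult = (\<lambda>(t, X, Z) (t', X', Z').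
       (t * t', X + sqrt t *\<^sub>R X', Z + t *\<^sub>R Z' + (sqrt t / 2) *\<^sub>R bracket_v j X X')),
     one = (1, 0, 0)\<rparr>"

lemma G_carrier [simp]: "p \<in> carrier (G_group j) \<longleftrightarrow> fst p > 0"
  by (simp add: G_group_def)

lemma G_one: "\<one>\<^bsub>G_group j\<^esub> = (1, 0, 0)"
  by (simp add: G_group_def)

lemma G_mult: "(t, X, Z) \<otimes>\<^bsub>G_group j\<^esub> (t', X', Z') =
    (t * t', X + sqrt t *\<^sub>R X', Z + t *\<^sub>R Z' + (sqrt t / 2) *\<^sub>R bracket_v j X X')"
  by (simp add: G_group_def)

lemmas bracket_v_simps =
  bilinear_ladd[OF bilinear_bracket_v] bilinear_radd[OF bilinear_bracket_v]
  bilinear_lmul[OF bilinear_bracket_v] bilinear_rmul[OF bilinear_bracket_v]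
  bilinear_lsub[OF bilinear_bracket_v] bilinear_rsub[OF bilinear_bracket_v]
  bilinear_lneg[OF bilinear_bracket_v] bilinear_rneg[OF bilinear_bracket_v]
  bilinear_lzero[OF bilinear_bracket_v] bilinear_rzero[OF bilinear_bracket_v]

lemma bracket_v_self:
  assumes "range j \<subseteq> so"
  shows "bracket_v j X X = 0"
  using bracket_v_skew[OF assms, of X X] by (metis scaleR_2 add.right_inverse scaleR_eq_0_iff zero_neq_numeral)

lemma group_R: "group (R_group :: (real \<times> 'v::euclidean_space) monoid)"
proof (rule groupI)
  fix p :: "real \<times> 'v" assume "p \<in> carrier R_group"
  then show "\<exists>q\<in>carrier R_group. q \<otimes>\<^bsub>R_group\<^esub> p = \<one>\<^bsub>R_group\<^esub>"
    by (intro bexI[of _ "(1 / fst p, - (1 / sqrt (fst p)) *\<^sub>R snd p)"])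
      (auto simp: R_group_def real_sqrt_divide split: prod.splits)
qed (auto simp: R_group_def real_sqrt_mult algebra_simps)

lemma group_G:
  assumes "range j \<subseteq> so"
  shows "group (G_group j)"
proof (rule groupI)
  fix p assume p: "p \<in> carrier (G_group j)"
  obtain t X Z where pe: "p = (t, X, Z)" using prod_cases3 by blast
  then have "t > 0" using p by simp
  then show "\<exists>q\<in>carrier (G_group j). q \<otimes>\<^bsub>G_group j\<^esub> p = \<one>\<^bsub>G_group j\<^esub>"
    by (intro bexI[of _ "(1 / t, - (1 / sqrt t) *\<^sub>R X, - (1 / t) *\<^sub>R Z)"])
      (simp_all add: pe G_mult G_one real_sqrt_divide bracket_v_simps bracket_v_self[OF assms])
next
  fix x y z assume "x \<in> carrier (G_group j)" "y \<in> carrier (G_group j)" "z \<in> carrier (G_group j)"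
  then show "x \<otimes>\<^bsub>G_group j\<^esub> y \<otimes>\<^bsub>G_group j\<^esub> z = x \<otimes>\<^bsub>G_group j\<^esub> (y \<otimes>\<^bsub>G_group j\<^esub> z)"
    by (cases x; cases y; cases z)
      (simp add: G_mult bracket_v_simps real_sqrt_mult algebra_simps)
qed (auto simp: G_group_def bracket_v_simps)

lemma inv_G:
  assumes "range j \<subseteq> so" "t > 0"
  shows "inv\<^bsub>G_group j\<^esub> (t, X, Z) = (1 / t, - (1 / sqrt t) *\<^sub>R X, - (1 / t) *\<^sub>R Z)"
proof (rule group.inv_equality[OF group_G[OF assms(1)]])
  show "(1 / t, - (1 / sqrt t) *\<^sub>R X, - (1 / t) *\<^sub>R Z) \<otimes>\<^bsub>G_group j\<^esub> (t, X, Z) = \<one>\<^bsub>G_group j\<^esub>"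
    using assms(2)
    by (simp add: G_mult G_one real_sqrt_divide bracket_v_simps bracket_v_self[OF assms(1)])
qed (use assms in auto)

lemma simply_connected_G: "simply_connected (carrier (G_group j))"
proof (rule convex_imp_simply_connected)
  show "convex (carrier (G_group j))"
    by (auto simp: convex_def G_group_def intro: add_nonneg_pos add_pos_nonneg)
      (smt (verit) mult_nonneg_nonneg mult_pos_pos)
qed

lemma G_to_R_hom: "(\<lambda>(t, X, Z). (t, X)) \<in> hom (G_group j) R_group"
  by (auto simp: hom_def G_group_def R_group_def)

lemma has_derivative_bracket_v [derivative_intros]:
  assumes "(f has_derivative f') (at x within S)"
  shows "((\<lambda>x. bracket_v j X (f x)) has_derivative (\<lambda>h. bracket_v j X (f' h))) (at x within S)"
  by (rule bounded_linear.has_derivative[OF linear_conv_bounded_linear[THEN iffD1,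
        OF linear_bracket_v] assms])

lemma left_translation_has_derivative:
  "((\<lambda>q. (t, X, Z) \<otimes>\<^bsub>G_group j\<^esub> q) has_derivative
     (\<lambda>(a, Y, W). (t * a, sqrt t *\<^sub>R Y, t *\<^sub>R W + (sqrt t / 2) *\<^sub>R bracket_v j X Y))) (at p)"
proof -
  have *: "(\<lambda>q. (t, X, Z) \<otimes>\<^bsub>G_group j\<^esub> q) = (\<lambda>q. (t * fst q, X + sqrt t *\<^sub>R fst (snd q),
      Z + t *\<^sub>R snd (snd q) + (sqrt t / 2) *\<^sub>R bracket_v j X (fst (snd q))))"
    by (auto simp: G_group_def fun_eq_iff)
  show ?thesis
    unfolding * by (auto intro!: derivative_eq_intros simp: fun_eq_iff)
qed

definition left_inv_field :: "('z::euclidean_space \<Rightarrow> 'v::euclidean_space \<Rightarrow>\<^sub>L 'v) \<Rightarrow>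
    real \<times> 'v \<times> 'z \<Rightarrow> real \<times> 'v \<times> 'z \<Rightarrow> real \<times> 'v \<times> 'z" where
  "left_inv_field j U p = frechet_derivative (\<lambda>q. p \<otimes>\<^bsub>G_group j\<^esub> q) (at \<one>\<^bsub>G_group j\<^esub>) U"

lemma left_inv_field:
  "left_inv_field j (a, Y, W) (t, X, Z) =
     (t * a, sqrt t *\<^sub>R Y, t *\<^sub>R W + (sqrt t / 2) *\<^sub>R bracket_v j X Y)"
  unfolding left_inv_field_def
  by (simp add: frechet_derivative_at[OF left_translation_has_derivative, symmetric])

lemma left_inv_field_has_derivative:
  assumes "t > 0"
  shows "(left_inv_field j (a, Y, W) has_derivative
     (\<lambda>(\<tau>, V, _). (\<tau> * a, (\<tau> / (2 * sqrt t)) *\<^sub>R Y,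
        \<tau> *\<^sub>R W + (\<tau> / (4 * sqrt t)) *\<^sub>R bracket_v j X Y + (sqrt t / 2) *\<^sub>R bracket_v j V Y)))
     (at (t, X, Z))"
proof -
  have *: "left_inv_field j (a, Y, W) = (\<lambda>p. (fst p * a, sqrt (fst p) *\<^sub>R Y,
      fst p *\<^sub>R W + (sqrt (fst p) / 2) *\<^sub>R bracket_v j (fst (snd p)) Y))"
    by (auto simp: left_inv_field fun_eq_iff)
  have "linear (\<lambda>X. bracket_v j X Y)"
    using bilinear_bracket_v[of j] by (simp add: bilinear_def)
  then have bl: "bounded_linear (\<lambda>X. bracket_v j X Y)"
    by (simp add: linear_conv_bounded_linear)
  show ?thesis
    unfolding * using assms
    by (auto intro!: derivative_eq_intros bounded_linear.has_derivative[OF bl]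
        simp: fun_eq_iff field_simps)
qed

lemma lie_bracket_left_inv_field:
  fixes j :: "'z::euclidean_space \<Rightarrow> 'v::euclidean_space \<Rightarrow>\<^sub>L 'v"
  assumes "range j \<subseteq> so" "p \<in> carrier (G_group j)"
  shows "frechet_derivative (left_inv_field j V) (at p) (left_inv_field j U p)
       - frechet_derivative (left_inv_field j U) (at p) (left_inv_field j V p)
       = left_inv_field j (bracket_g j U V) p"
proof -
  obtain t X Z where p: "p = (t, X, Z)" using prod_cases3 by blast
  obtain a Y W where U: "U = (a, Y, W)" using prod_cases3 by blast
  obtain a' Y' W' where V: "V = (a', Y', W')" using prod_cases3 by blast
  have "t > 0" using assms p by simp
  then obtain s where s: "s > 0" and t: "t = s * s"
    by (metis real_sqrt_gt_zero real_sqrt_mult_self abs_of_pos)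
  have t0: "s * s > 0" and sq: "sqrt (s * s) = s"
    using s by simp_all
  note sk = bracket_v_skew[OF assms(1), of Y' Y]
  have 2: "(s * s / 2) *\<^sub>R z + ((s * s / 2) *\<^sub>R z + y) = (s * s) *\<^sub>R z + y" for z y :: 'z
    by (simp flip: scaleR_add_left add: add.assoc[symmetric])
  show ?thesis
    unfolding p U V t
      frechet_derivative_at[OF left_inv_field_has_derivative[OF t0], symmetric]
    using s by (simp add: left_inv_field bracket_v_simps sk sq 2 algebra_simps)
qed

text \<open>The Lie group exponential map, as the time-one value of the integral curve of the
  left-invariant field through the identity.\<close>

definition lie_exp :: "('z::euclidean_space \<Rightarrow> 'v::euclidean_space \<Rightarrow>\<^sub>L 'v) \<Rightarrow>
    real \<times> 'v \<times> 'z \<Rightarrow> real \<times> 'v \<times> 'z" where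
  "lie_exp j U = (THE q. \<exists>\<gamma>. \<gamma> 0 = \<one>\<^bsub>G_group j\<^esub> \<and> \<gamma> 1 = q \<and>
     (\<forall>s. \<gamma> s \<in> carrier (G_group j) \<and>
          (\<gamma> has_vector_derivative left_inv_field j U (\<gamma> s)) (at s)))"

lemma lie_exp_z:
  fixes j :: "'z::euclidean_space \<Rightarrow> 'v::euclidean_space \<Rightarrow>\<^sub>L 'v"
  shows "lie_exp j (0, 0, Z) = (1, 0, Z)"
  unfolding lie_exp_def
proof (rule the_equality)
  have "((\<lambda>s. (1, 0, s *\<^sub>R Z)) has_vector_derivative
      left_inv_field j (0, 0, Z) (1, 0, s *\<^sub>R Z)) (at s)" for s
    by (auto simp: left_inv_field bracket_v_simps has_vector_derivative_def fun_eq_iff zero_prod_def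
        intro!: derivative_eq_intros)
  then show "\<exists>\<gamma>. \<gamma> 0 = \<one>\<^bsub>G_group j\<^esub> \<and> \<gamma> 1 = (1, 0, Z) \<and>
     (\<forall>s. \<gamma> s \<in> carrier (G_group j) \<and>
          (\<gamma> has_vector_derivative left_inv_field j (0, 0, Z) (\<gamma> s)) (at s))"
    by (intro exI[of _ "\<lambda>s. (1, 0, s *\<^sub>R Z)"]) (auto simp: G_one)
next
  fix q
  assume "\<exists>\<gamma>. \<gamma> 0 = \<one>\<^bsub>G_group j\<^esub> \<and> \<gamma> 1 = q \<and>
     (\<forall>s. \<gamma> s \<in> carrier (G_group j) \<and>
          (\<gamma> has_vector_derivative left_inv_field j (0, 0, Z) (\<gamma> s)) (at s))"
  then obtain \<gamma> where 0: "\<gamma> 0 = (1, 0, 0)" and 1: "\<gamma> 1 = q"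
    and d: "\<And>s. (\<gamma> has_vector_derivative left_inv_field j (0, 0, Z) (\<gamma> s)) (at s)"
    by (auto simp: G_one)
  have e: "left_inv_field j (0, 0, Z) p = (0, 0, fst p *\<^sub>R Z)" for p
    by (cases p) (simp add: left_inv_field bracket_v_simps)
  note d = d[unfolded e]
  have "((\<lambda>s. fst (\<gamma> s)) has_vector_derivative 0) (at s)" for s
    using bounded_linear.has_vector_derivative[OF bounded_linear_fst d[of s]] by simp
  then have f1: "fst (\<gamma> s) = 1" for s
    using has_vector_derivative_zero_constant[of UNIV "\<lambda>s. fst (\<gamma> s)"] 0
    by (metis UNIV_I convex_UNIV fst_conv)
  have "((\<lambda>s. snd (\<gamma> s) - (0, s *\<^sub>R Z)) has_vector_derivative 0) (at s)" for s
  proof -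
    have a: "((\<lambda>s. snd (\<gamma> s)) has_vector_derivative (0, Z)) (at s)"
      using bounded_linear.has_vector_derivative[OF bounded_linear_snd d[of s]] f1 by simp
    have b: "((\<lambda>s. (0::'v, s *\<^sub>R Z)) has_vector_derivative (0, Z)) (at s)"
      by (auto simp: has_vector_derivative_def fun_eq_iff intro!: derivative_eq_intros)
    show ?thesis
      using has_vector_derivative_diff[OF a b, simplified] by simp
  qed
  then obtain k where k: "\<And>s. snd (\<gamma> s) - (0, s *\<^sub>R Z) = k"
    using has_vector_derivative_zero_constant[of UNIV "\<lambda>s. snd (\<gamma> s) - (0, s *\<^sub>R Z)"]
    by (metis UNIV_I convex_UNIV)
  from k[of 0] 0 have "k = 0" by (simp add: zero_prod_def)
  with k[of 1] f1[of 1] 1 show "q = (1, 0, Z)"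
    by (cases q) (simp add: zero_prod_def)
qed

text \<open>The left-invariant metric of \<open>G(j,c)\<close>.\<close>

definition G_metric :: "('z::euclidean_space \<Rightarrow> 'v::euclidean_space \<Rightarrow>\<^sub>L 'v) \<Rightarrow> real \<Rightarrow>
    (real \<times> 'v \<times> 'z) riem_metric" where
  "G_metric j c p u w =
     (let T = frechet_derivative (\<lambda>q. inv\<^bsub>G_group j\<^esub> p \<otimes>\<^bsub>G_group j\<^esub> q) (at p)
      in inner_g c (T u) (T w))"

lemma G_metric:
  assumes "range j \<subseteq> so" "t > 0"
  shows "G_metric j c (t, X, Z) (a, Y, W) (a', Y', W') =
     a * a' / (t * c)\<^sup>2 + (Y \<bullet> Y') / t
     + ((W - (1 / 2) *\<^sub>R bracket_v j X Y) \<bullet> (W' - (1 / 2) *\<^sub>R bracket_v j X Y')) / t\<^sup>2"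
proof -
  have *: "(1 / t) *\<^sub>R W + (sqrt (1 / t) / 2) *\<^sub>R bracket_v j (- (1 / sqrt t) *\<^sub>R X) Y
      = (1 / t) *\<^sub>R (W - (1 / 2) *\<^sub>R bracket_v j X Y)" for Y W
    using assms(2) by (simp add: bracket_v_simps real_sqrt_divide algebra_simps)
  have "sqrt t * sqrt t = t"
    using assms(2) by simp
  then show ?thesis
    unfolding G_metric_def inv_G[OF assms] Let_def
      frechet_derivative_at[OF left_translation_has_derivative, symmetric]
    using assms(2)
    by (simp only: * split inner_g_def inner_scaleR_left inner_scaleR_right)
      (simp add: power2_eq_square real_sqrt_divide)
qed


section \<open>The quotient \<open>exp(\<L>)\G(j,c)\<close> and the submanifold \<open>M(j,c,r)\<close>\<close>

definition full_rank_lattice :: "'a::euclidean_space set \<Rightarrow> bool" where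
  "full_rank_lattice L \<longleftrightarrow>
     (\<exists>B. independent B \<and> span B = UNIV \<and> L = {\<Sum>b\<in>B. of_int (n b) *\<^sub>R b | n :: 'a \<Rightarrow> int. True})"

definition exp_L :: "('z::euclidean_space \<Rightarrow> 'v::euclidean_space \<Rightarrow>\<^sub>L 'v) \<Rightarrow> 'z set \<Rightarrow>
    (real \<times> 'v \<times> 'z) set" where
  "exp_L j L = (\<lambda>Z. lie_exp j (0, 0, Z)) ` L"

definition Gbar :: "('z::euclidean_space \<Rightarrow> 'v::euclidean_space \<Rightarrow>\<^sub>L 'v) \<Rightarrow> 'z set \<Rightarrow>
    (real \<times> 'v \<times> 'z) set set" where
  "Gbar j L = rcosets\<^bsub>G_group j\<^esub> (exp_L j L)"

definition to_Gbar :: "('z::euclidean_space \<Rightarrow> 'v::euclidean_space \<Rightarrow>\<^sub>L 'v) \<Rightarrow> 'z set \<Rightarrow>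
    real \<times> 'v \<times> 'z \<Rightarrow> (real \<times> 'v \<times> 'z) set" where
  "to_Gbar j L p = exp_L j L #>\<^bsub>G_group j\<^esub> p"

definition Gbar_top :: "('z::euclidean_space \<Rightarrow> 'v::euclidean_space \<Rightarrow>\<^sub>L 'v) \<Rightarrow> 'z set \<Rightarrow>
    (real \<times> 'v \<times> 'z) set topology" where
  "Gbar_top j L = topology (\<lambda>V. V \<subseteq> Gbar j L \<and>
     openin (top_of_set (carrier (G_group j))) {p \<in> carrier (G_group j). to_Gbar j L p \<in> V})"

lemma openin_Gbar_top:
  "openin (Gbar_top j L) V \<longleftrightarrow> V \<subseteq> Gbar j L \<and>
     openin (top_of_set (carrier (G_group j))) {p \<in> carrier (G_group j). to_Gbar j L p \<in> V}"
proof -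
  let ?P = "\<lambda>V. {p \<in> carrier (G_group j). to_Gbar j L p \<in> V}"
  have I: "?P (S \<inter> T) = ?P S \<inter> ?P T" for S T by auto
  have U: "?P (\<Union>K) = \<Union>(?P ` K)" for K by auto
  have "istopology (\<lambda>V. V \<subseteq> Gbar j L \<and> openin (top_of_set (carrier (G_group j))) (?P V))"
    unfolding istopology_def I U
    by (intro conjI allI impI openin_Int openin_Union) (blast+)
  then show ?thesis
    by (simp add: Gbar_top_def)
qed

lemma to_Gbar_image: "to_Gbar j L ` carrier (G_group j) = Gbar j L"
  by (auto simp: Gbar_def to_Gbar_def RCOSETS_def)

lemma quotient_map_to_Gbar:
  "quotient_map (top_of_set (carrier (G_group j))) (Gbar_top j L) (to_Gbar j L)"
proof -
  have "openin (Gbar_top j L) (Gbar j L)"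
  proof -
    have "{p \<in> carrier (G_group j). to_Gbar j L p \<in> Gbar j L} = carrier (G_group j)"
      using to_Gbar_image by blast
    then show ?thesis
      unfolding openin_Gbar_top by (metis openin_subtopology_self order_refl)
  qed
  then have "topspace (Gbar_top j L) = Gbar j L"
    by (metis openin_Gbar_top openin_subset openin_topspace subset_antisym)
  then show ?thesis
    unfolding quotient_map_def topspace_euclidean_subtopology to_Gbar_image
    by (simp add: openin_Gbar_top del: G_carrier)
qed

text \<open>The quotient map \<open>\<pi>\<^sub>j\<close>, induced by \<open>G(j) \<rightarrow> R\<close>; all representatives of a coset have
  the same image in \<open>R\<close>.\<close>

definition pi_bar :: "(real \<times> 'v::euclidean_space \<times> 'z::euclidean_space) set \<Rightarrow> real \<times> 'v" where
  "pi_bar C = the_elem ((\<lambda>(t, X, Z). (t, X)) ` C)"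

lemma pi_bar_to_Gbar:
  assumes "L \<noteq> {}"
  shows "pi_bar (to_Gbar j L (t, X, Z)) = (t, X)"
proof -
  have "(\<lambda>(t, X, Z). (t, X)) ` to_Gbar j L (t, X, Z) = {(t, X)}"
    using assms by (force simp: to_Gbar_def r_coset_def exp_L_def lie_exp_z G_mult)
  then show ?thesis
    by (simp add: pi_bar_def)
qed

definition Q_sub :: "real \<Rightarrow> real \<Rightarrow> real \<Rightarrow> (real \<times> 'v::euclidean_space) set" where
  "Q_sub t1 t2 r = {(t, X) \<in> carrier R_group. t \<in> {t1..t2} \<and> norm X = r}"

definition M_sub :: "('z::euclidean_space \<Rightarrow> 'v::euclidean_space \<Rightarrow>\<^sub>L 'v) \<Rightarrow> 'z set \<Rightarrow>
    real \<Rightarrow> real \<Rightarrow> real \<Rightarrow> (real \<times> 'v \<times> 'z) set set" where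
  "M_sub j L t1 t2 r = {C \<in> Gbar j L. pi_bar C \<in> Q_sub t1 t2 r}"

text \<open>Since \<open>M(j,c,r)\<close> has dimension \<open>dim \<vv> + dim \<zz>\<close>, its charts can be modelled on \<open>'v \<times> 'z\<close>. The
  (inverse) chart \<open>x \<mapsto> to_Gbar j L (f x)\<close> is given by a smooth lift \<open>f\<close> to \<open>G(j)\<close>; since
  \<open>to_Gbar j L\<close> is a covering, such charts form an atlas of \<open>M(j,c,r)\<close>. Because the metric of \<open>Gbar\<close>
  is the one for which this covering is a local isometry, the metric of \<open>M(j,c,r)\<close> is expressed in
  the chart by the pullback of \<open>G_metric j c\<close> along \<open>f\<close>.\<close>

definition chart_M :: "('z::euclidean_space \<Rightarrow> 'v::euclidean_space \<Rightarrow>\<^sub>L 'v) \<Rightarrow> 'z set \<Rightarrow>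
    real \<Rightarrow> real \<Rightarrow> real \<Rightarrow> ('v \<times> 'z) set \<Rightarrow> ('v \<times> 'z \<Rightarrow> real \<times> 'v \<times> 'z) \<Rightarrow> bool" where
  "chart_M j L t1 t2 r D f \<longleftrightarrow>
     half_space_open D \<and> f ` D \<subseteq> carrier (G_group j) \<and> smooth_on D f \<and>
     (\<forall>x\<in>D. inj (frechet_derivative f (at x within D))) \<and>
     (let \<phi> = to_Gbar j L \<circ> f; T = subtopology (Gbar_top j L) (M_sub j L t1 t2 r)
      in embedding_map (top_of_set D) T \<phi> \<and> openin T (\<phi> ` D))"

definition pullback_metric :: "'a::euclidean_space set \<Rightarrow> ('a \<Rightarrow> 'b::euclidean_space) \<Rightarrow>
    'b riem_metric \<Rightarrow> 'a riem_metric" where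
  "pullback_metric D f g x u w =
     (let T = frechet_derivative f (at x within D) in g (f x) (T u) (T w))"

text \<open>The set of all sectional curvatures of \<open>M(j,c,r)\<close>, at all points and for all tangent planes.\<close>

definition sectional_curvatures_M :: "('z::euclidean_space \<Rightarrow> 'v::euclidean_space \<Rightarrow>\<^sub>L 'v) \<Rightarrow> 'z set \<Rightarrow>
    real \<Rightarrow> real \<Rightarrow> real \<Rightarrow> real \<Rightarrow> real set" where
  "sectional_curvatures_M j L t1 t2 c r =
     {sectional_curvature D (pullback_metric D f (G_metric j c)) x u v | D f x u v.
        chart_M j L t1 t2 r D f \<and> x \<in> D \<and> u \<noteq> v \<and> independent {u, v}}"

end

theory Submission
  imports Defs "HOL-Real_Asymp.Real_Asymp"
begin

text \<open>
  In the left-invariant orthonormal frame of \<open>G(j,c)\<close> all tangent spaces become the Euclidean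
  space \<open>\<real> \<times> \<vv> \<times> \<zz>\<close>, and the Levi-Civita connection becomes one skew bilinear map \<open>frame_conn j
  c\<close>. The preimage of \<open>M(j,c,r)\<close> in the group is a part of the hypersurface \<open>\<parallel>X\<parallel> = r\<close>, whose unit
  normal in the frame is \<open>(0, X / r, 0)\<close>. Differentiating \<open>\<parallel>X\<parallel> = r\<close> twice yields its second
  fundamental form, and this form turns out to be independent of \<open>c\<close>. The Gauss equation
  (\<open>gauss_equation\<close>) then expresses the sectional curvature in an arbitrary chart
  (\<open>sectional_curvature_chart\<close>) by a formula \<open>curv_num\<close> in \<open>c\<close>, \<open>t\<close>, \<open>n = X / r\<close> and an
  orthonormal basis \<open>a\<close>, \<open>b\<close> of the plane.

  The connection is \<open>c S + T\<close>, where \<open>S\<close> belongs to the extension of an abelian algebra by a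
  derivation with eigenvalues \<open>1/2\<close> and \<open>1\<close>. The sectional curvature of \<open>S\<close> is at most \<open>- 1/4\<close>
  (\<open>extension_curvature_bound\<close>). Since the parameters \<open>t\<close>, \<open>n\<close>, \<open>a\<close>, \<open>b\<close> range over a compact set,
  the remaining terms are bounded uniformly, and every sectional curvature is at most \<open>- c\<^sup>2 / 4 +
  C1 c + C2\<close> (\<open>curv_num_bound\<close>). Both assertions follow, once the maximum is known to exist. For
  this the set of sectional curvatures is identified with the image of the compact parameter set.
  One inclusion is the formula in charts; the other one needs a chart around every point of
  \<open>M(j,c,r)\<close>, including the boundary points (\<open>axis_chart_is_chart\<close>).

  A chart is only assumed to be smooth up to the boundary of its domain. The analytic
  prerequisites are therefore proved for derivatives within such domains: uniqueness of the
  derivative, symmetry of second derivatives, and differentiability of the Christoffel symbols,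
  which are defined as solutions of a linear system.
\<close>

section \<open>Maps of class \<open>C\<^sup>k\<close> and symmetry of second derivatives\<close>

lemma Ck_on_has_derivative:
  assumes "Ck_on (Suc k) f U" "open U" "x \<in> U"
  shows "(f has_derivative frechet_derivative f (at x)) (at x)"
  using assms by (auto simp: differentiable_on_eq_differentiable_at frechet_derivative_works)

lemma Ck_on_cong:
  assumes "Ck_on k f U" "\<And>x. x \<in> U \<Longrightarrow> f x = g x" "open U"
  shows "Ck_on k g U"
  using assms
proof (induction k arbitrary: f g)
  case 0
  then show ?case using continuous_on_cong by force
next
  case (Suc k)
  have d: "(g has_derivative frechet_derivative f (at x)) (at x)" if "x \<in> U" for x
    using Ck_on_has_derivative[OF Suc.prems(1,3) that] Suc.prems(3) that Suc.prems(2)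
    by (rule has_derivative_transform_within_open)
  have eq: "frechet_derivative f (at x) v = frechet_derivative g (at x) v" if "x \<in> U" for x v
    using frechet_derivative_at[OF d[OF that]] by simp
  have "Ck_on k (\<lambda>x. frechet_derivative g (at x) v) U" for v
  proof (rule Suc.IH[OF _ _ Suc.prems(3)])
    show "Ck_on k (\<lambda>x. frechet_derivative f (at x) v) U" using Suc.prems(1) by simp
  qed (rule eq)
  moreover have "g differentiable_on U"
    using d \<open>open U\<close> by (auto simp: differentiable_on_eq_differentiable_at differentiable_def)
  ultimately show ?case by simp
qed

text \<open>This replaces the canonical derivative by any explicit formula for it, which is what makes
  the following closure properties provable by induction on the order.\<close>

lemma Ck_on_SucI:
  assumes "open U" "\<And>x. x \<in> U \<Longrightarrow> (f has_derivative f' x) (at x)" "\<And>v. Ck_on k (\<lambda>x. f' x v) U"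
  shows "Ck_on (Suc k) f U"
proof -
  have "f' x = frechet_derivative f (at x)" if "x \<in> U" for x
    using assms(2)[OF that] by (rule frechet_derivative_at)
  then have "Ck_on k (\<lambda>x. frechet_derivative f (at x) v) U" for v
    by (intro Ck_on_cong[OF assms(3) _ assms(1)]) simp
  moreover have "f differentiable_on U"
    using assms(1,2) by (auto simp: differentiable_on_eq_differentiable_at differentiable_def)
  ultimately show ?thesis by simp
qed

lemma Ck_on_subset:
  assumes "Ck_on k f U" "V \<subseteq> U" "open U" "open V"
  shows "Ck_on k f V"
  using assms
proof (induction k arbitrary: f)
  case 0
  then show ?case by (auto intro: continuous_on_subset)
next
  case (Suc k)
  then show ?case by (auto intro: differentiable_on_subset)
qed

lemma Ck_on_SucD:
  assumes "Ck_on (Suc k) f U"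
  shows "Ck_on k f U"
  using assms
proof (induction k arbitrary: f)
  case 0
  then show ?case by (auto intro: differentiable_imp_continuous_on)
next
  case (Suc k)
  have "Ck_on k (\<lambda>x. frechet_derivative f (at x) v) U" for v
    using Suc.prems Suc.IH Ck_on.simps(2) by blast
  then show ?case using Suc.prems by simp
qed

lemma Ck_on_const: "open U \<Longrightarrow> Ck_on k (\<lambda>x. c) U"
proof (induction k arbitrary: c)
  case (Suc k)
  show ?case by (rule Ck_on_SucI[where f' = "\<lambda>x v. 0"]) (use Suc in auto)
qed simp

lemma Ck_on_ident: "open U \<Longrightarrow> Ck_on k (\<lambda>x. x) U"
proof (cases k)
  case (Suc n)
  assume U: "open U"
  show ?thesis unfolding Suc
    by (rule Ck_on_SucI[OF U has_derivative_ident Ck_on_const[OF U]])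
qed simp

lemma Ck_on_add:
  assumes "Ck_on k f U" "Ck_on k g U" "open U"
  shows "Ck_on k (\<lambda>x. f x + g x) U"
  using assms
proof (induction k arbitrary: f g)
  case (Suc k)
  show ?case
  proof (rule Ck_on_SucI)
    show "((\<lambda>x. f x + g x) has_derivative (\<lambda>v. frechet_derivative f (at x) v
        + frechet_derivative g (at x) v)) (at x)"
      if "x \<in> U" for x
      using Suc.prems that by (intro has_derivative_add Ck_on_has_derivative)
  qed (use Suc in auto)
qed (auto intro: continuous_intros)

lemma Ck_on_bounded_linear:
  assumes "Ck_on k f U" "bounded_linear h" "open U"
  shows "Ck_on k (\<lambda>x. h (f x)) U"
  using assms
proof (induction k arbitrary: f)
  case 0
  then show ?case by (auto intro: linear_continuous_on_compose bounded_linear.continuous_on)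
next
  case (Suc k)
  show ?case
    by (rule Ck_on_SucI[OF _ bounded_linear.has_derivative[OF Suc.prems(2) Ck_on_has_derivative]])
      (use Suc in auto)
qed

lemma Ck_on_bilinear:
  assumes "Ck_on k f U" "Ck_on k g U" "bounded_bilinear h" "open U"
  shows "Ck_on k (\<lambda>x. h (f x) (g x)) U"
  using assms
proof (induction k arbitrary: f g)
  case 0
  then show ?case by (auto intro: bounded_bilinear.continuous_on)
next
  case (Suc k)
  have "Ck_on k f U" "Ck_on k g U" using Suc.prems Ck_on_SucD by blast+
  moreover have "Ck_on k (\<lambda>x. frechet_derivative f (at x) v) U"
      "Ck_on k (\<lambda>x. frechet_derivative g (at x) v) U" for v
    using Suc.prems by auto
  ultimately show ?case
    by (intro Ck_on_SucI[OF _ bounded_bilinear.FDERIV[OF Suc.prems(3) Ck_on_has_derivative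
        Ck_on_has_derivative]])
      (use Suc in \<open>auto intro!: Ck_on_add\<close>)
qed

text \<open>The exponent has to be arbitrary: differentiation lowers it by one. Reciprocals and square
  roots of smooth positive functions are covered.\<close>

lemma Ck_on_powr:
  fixes f :: "'a::euclidean_space \<Rightarrow> real"
  assumes "\<And>k. Ck_on k f U" "\<And>x. x \<in> U \<Longrightarrow> f x > 0" "open U"
  shows "Ck_on k (\<lambda>x. f x powr a) U"
proof (induction k arbitrary: a)
  case 0
  have "continuous_on U f" using assms(1)[of 0] by simp
  then show ?case using assms(2) by (auto intro!: continuous_on_powr) (metis less_irrefl)
next
  case (Suc k)
  let ?f = "\<lambda>x. frechet_derivative f (at x)"
  show ?case
  proof (rule Ck_on_SucI)
    fix x assume x: "x \<in> U"
    have "((\<lambda>t. t powr a) has_derivative (*) (a * f x powr (a - 1))) (at (f x))"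
      using has_real_derivative_powr[OF assms(2)[OF x], of a] by (simp add: has_field_derivative_def)
    from has_derivative_compose[OF Ck_on_has_derivative[OF assms(1) assms(3) x] this]
    show "((\<lambda>x. f x powr a) has_derivative (\<lambda>v. (a * f x powr (a - 1)) * ?f x v)) (at x)" .
  next
    fix v
    have "Ck_on k (\<lambda>x. ?f x v) U" using assms(1)[of "Suc k"] by simp
    then show "Ck_on k (\<lambda>x. (a * f x powr (a - 1)) * ?f x v) U"
      by (intro Ck_on_bilinear[OF _ _ bounded_bilinear_mult] Ck_on_const Suc assms(3))
  qed (rule assms)
qed

text \<open>Both mixed derivatives are limits of the same second difference quotient, which the mean
  value theorem, applied once in each direction, evaluates as a mixed derivative at a nearby
  point.\<close>

lemma second_difference_mean_value:
  fixes f :: "'a::euclidean_space \<Rightarrow> real"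
  assumes "Ck_on 2 f U" "open U" "h > 0"
    and box: "\<And>s t. s \<in> {0..h} \<Longrightarrow> t \<in> {0..h} \<Longrightarrow> x + s *\<^sub>R u + t *\<^sub>R v \<in> U"
  shows "\<exists>s\<in>{0..h}. \<exists>t\<in>{0..h}.
    f (x + h *\<^sub>R u + h *\<^sub>R v) - f (x + h *\<^sub>R u) - f (x + h *\<^sub>R v) + f x
    = h\<^sup>2 * frechet_derivative (\<lambda>y. frechet_derivative f (at y) u) (at (x + s *\<^sub>R u + t *\<^sub>R v)) v"
proof -
  let ?fu = "\<lambda>y. frechet_derivative f (at y) u"
  have C: "Ck_on (Suc 1) f U" "Ck_on (Suc 0) ?fu U"
    using assms(1) by (auto simp: numeral_2_eq_2)
  have D1: "((\<lambda>s. f (x + s *\<^sub>R u + t *\<^sub>R v)) has_real_derivative ?fu (x + s *\<^sub>R u + t *\<^sub>R v)) (at s)"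
    if "s \<in> {0..h}" "t \<in> {0..h}" for s t
  proof -
    have "((\<lambda>s. x + s *\<^sub>R u + t *\<^sub>R v) has_derivative (\<lambda>a. a *\<^sub>R u)) (at s)"
      by (auto intro!: derivative_eq_intros)
    from has_derivative_compose[OF this Ck_on_has_derivative[OF C(1) assms(2) box[OF that]]]
    show ?thesis
      using has_derivative_linear[OF Ck_on_has_derivative[OF C(1) assms(2) box[OF that]]]
      by (simp add: has_field_derivative_def linear_scale mult_commute_abs)
  qed
  have D2: "((\<lambda>t. ?fu (x + s *\<^sub>R u + t *\<^sub>R v)) has_real_derivative
      frechet_derivative ?fu (at (x + s *\<^sub>R u + t *\<^sub>R v)) v) (at t)"
    if "s \<in> {0..h}" "t \<in> {0..h}" for s t
  proof -
    have "((\<lambda>t. x + s *\<^sub>R u + t *\<^sub>R v) has_derivative (\<lambda>a. a *\<^sub>R v)) (at t)"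
      by (auto intro!: derivative_eq_intros)
    from has_derivative_compose[OF this Ck_on_has_derivative[OF C(2) assms(2) box[OF that]]]
    show ?thesis
      using has_derivative_linear[OF Ck_on_has_derivative[OF C(2) assms(2) box[OF that]]]
      by (simp add: has_field_derivative_def linear_scale mult_commute_abs)
  qed
  have "\<exists>s>0. s < h \<and> (f (x + h *\<^sub>R u + h *\<^sub>R v) - f (x + h *\<^sub>R u + 0 *\<^sub>R v))
      - (f (x + 0 *\<^sub>R u + h *\<^sub>R v) - f (x + 0 *\<^sub>R u + 0 *\<^sub>R v))
      = (h - 0) * (?fu (x + s *\<^sub>R u + h *\<^sub>R v) - ?fu (x + s *\<^sub>R u + 0 *\<^sub>R v))"
    by (rule MVT2[where f = "\<lambda>s. f (x + s *\<^sub>R u + h *\<^sub>R v) - f (x + s *\<^sub>R u + 0 *\<^sub>R v)"])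
      (use assms(3) in \<open>auto intro!: DERIV_diff D1 simp del: scaleR_zero_left\<close>)
  then obtain s where s: "0 < s" "s < h" and
    1: "f (x + h *\<^sub>R u + h *\<^sub>R v) - f (x + h *\<^sub>R u) - f (x + h *\<^sub>R v) + f x
      = h * (?fu (x + s *\<^sub>R u + h *\<^sub>R v) - ?fu (x + s *\<^sub>R u + 0 *\<^sub>R v))" by (auto simp: algebra_simps)
  have "\<exists>t>0. t < h \<and> ?fu (x + s *\<^sub>R u + h *\<^sub>R v) - ?fu (x + s *\<^sub>R u + 0 *\<^sub>R v)
      = (h - 0) * frechet_derivative ?fu (at (x + s *\<^sub>R u + t *\<^sub>R v)) v"
    by (rule MVT2) (use assms(3) s in \<open>auto intro!: D2\<close>)
  then obtain t where t: "0 < t" "t < h" and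
    2: "?fu (x + s *\<^sub>R u + h *\<^sub>R v) - ?fu (x + s *\<^sub>R u + 0 *\<^sub>R v)
      = h * frechet_derivative ?fu (at (x + s *\<^sub>R u + t *\<^sub>R v)) v" by auto
  show ?thesis
    using s t 1[unfolded 2] by (intro bexI[where x = s, OF bexI[where x
        = t]]) (simp_all add: power2_eq_square)
qed

lemma second_derivative_symmetric_real:
  fixes f :: "'a::euclidean_space \<Rightarrow> real"
  assumes "Ck_on 2 f U" "open U" "x \<in> U"
  shows "frechet_derivative (\<lambda>y. frechet_derivative f (at y) u) (at x) v
       = frechet_derivative (\<lambda>y. frechet_derivative f (at y) v) (at x) u" (is "?A u v x = ?A v u x")
proof -
  have cont: "continuous (at x) (?A u v)" for u v
    using assms by (auto simp: numeral_2_eq_2 continuous_on_eq_continuous_at)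
  have "dist (?A u v x) (?A v u x) < e" if "e > 0" for e
  proof -
    obtain d1 where d1: "d1 > 0" "\<And>y. dist y x < d1 \<Longrightarrow> dist (?A u v y) (?A u v x) < e / 2"
      using cont[of u v] \<open>e > 0\<close> unfolding continuous_at_eps_delta dist_norm
      by (drule_tac x = "e / 2" in spec) auto
    obtain d2 where d2: "d2 > 0" "\<And>y. dist y x < d2 \<Longrightarrow> dist (?A v u y) (?A v u x) < e / 2"
      using cont[of v u] \<open>e > 0\<close> unfolding continuous_at_eps_delta dist_norm
      by (drule_tac x = "e / 2" in spec) auto
    obtain d3 where d3: "d3 > 0" "ball x d3 \<subseteq> U"
      using assms openE by blast
    define d where "d = min d1 (min d2 d3)"
    have "d > 0" using d1 d2 d3 by (simp add: d_def)
    define h where "h = d / (norm u + norm v + 1)"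
    have n1: "norm u + norm v + 1 > 0" by (simp add: add_nonneg_pos)
    then have "h > 0" using \<open>d > 0\<close> by (simp add: h_def)
    have near: "dist (x + s *\<^sub>R a + t *\<^sub>R b) x < d"
      if "s \<in> {0..h}" "t \<in> {0..h}" "norm a + norm b = norm u + norm v" for s t a b
    proof -
      have "dist (x + s *\<^sub>R a + t *\<^sub>R b) x = norm (s *\<^sub>R a + t *\<^sub>R b)"
        by (simp add: dist_norm)
      also have "\<dots> \<le> s * norm a + t * norm b"
        using that norm_triangle_ineq[of "s *\<^sub>R a" "t *\<^sub>R b"] by simp
      also have "\<dots> \<le> h * norm a + h * norm b"
        using that by (intro add_mono mult_right_mono) auto
      also have "\<dots> < h * (norm u + norm v + 1)"
        using \<open>h > 0\<close> that(3) by (simp flip: distrib_left)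
      finally show ?thesis using n1 by (simp add: h_def)
    qed
    have inU: "x + s *\<^sub>R a + t *\<^sub>R b \<in> U"
      if "s \<in> {0..h}" "t \<in> {0..h}" "norm a + norm b = norm u + norm v" for s t a b
      using near[OF that] d3 by (auto simp: d_def dist_commute)
    have "\<exists>s\<in>{0..h}. \<exists>t\<in>{0..h}.
        f (x + h *\<^sub>R u + h *\<^sub>R v) - f (x + h *\<^sub>R u) - f (x + h *\<^sub>R v) + f x
        = h\<^sup>2 * ?A u v (x + s *\<^sub>R u + t *\<^sub>R v)"
      by (rule second_difference_mean_value[OF assms(1,2) \<open>h > 0\<close>]) (rule inU, auto)
    then obtain s t where st: "s \<in> {0..h}" "t \<in> {0..h}" and
      1: "f (x + h *\<^sub>R u + h *\<^sub>R v) - f (x + h *\<^sub>R u) - f (x + h *\<^sub>R v) + f x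
        = h\<^sup>2 * ?A u v (x + s *\<^sub>R u + t *\<^sub>R v)"
      by blast
    have "\<exists>s\<in>{0..h}. \<exists>t\<in>{0..h}.
        f (x + h *\<^sub>R v + h *\<^sub>R u) - f (x + h *\<^sub>R v) - f (x + h *\<^sub>R u) + f x
        = h\<^sup>2 * ?A v u (x + s *\<^sub>R v + t *\<^sub>R u)"
      by (rule second_difference_mean_value[OF assms(1,2) \<open>h > 0\<close>]) (rule inU, auto)
    then obtain s' t' where st': "s' \<in> {0..h}" "t' \<in> {0..h}" and
      2: "f (x + h *\<^sub>R v + h *\<^sub>R u) - f (x + h *\<^sub>R v) - f (x + h *\<^sub>R u) + f x
        = h\<^sup>2 * ?A v u (x + s' *\<^sub>R v + t' *\<^sub>R u)"
      by blast
    have "x + h *\<^sub>R v + h *\<^sub>R u = x + h *\<^sub>R u + h *\<^sub>R v" by simp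
    note 2[unfolded this]
    with 1 have "h\<^sup>2 * ?A u v (x + s *\<^sub>R u + t *\<^sub>R v) = h\<^sup>2 * ?A v u (x + s' *\<^sub>R v + t' *\<^sub>R u)"
      by linarith
    then have eq: "?A u v (x + s *\<^sub>R u + t *\<^sub>R v) = ?A v u (x + s' *\<^sub>R v + t' *\<^sub>R u)"
      using \<open>h > 0\<close> by simp
    have "dist (?A u v (x + s *\<^sub>R u + t *\<^sub>R v)) (?A u v x) < e / 2"
      using near[OF st] by (intro d1) (simp add: d_def)
    moreover have "dist (?A v u (x + s' *\<^sub>R v + t' *\<^sub>R u)) (?A v u x) < e / 2"
      using near[OF st', of v u] by (intro d2) (simp add: d_def)
    ultimately show ?thesis
      unfolding eq by (rule dist_triangle_half_r)
  qed
  from this[of "dist (?A u v x) (?A v u x)"] show ?thesis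
    by (cases "?A u v x = ?A v u x") simp_all
qed

lemma second_derivative_symmetric:
  fixes f :: "'a::euclidean_space \<Rightarrow> 'b::euclidean_space"
  assumes "Ck_on 2 f U" "open U" "x \<in> U"
  shows "frechet_derivative (\<lambda>y. frechet_derivative f (at y) u) (at x) v
       = frechet_derivative (\<lambda>y. frechet_derivative f (at y) v) (at x) u"
proof (rule euclidean_eqI)
  fix b :: 'b assume "b \<in> Basis"
  let ?g = "\<lambda>y. f y \<bullet> b"
  have C: "Ck_on (Suc 1) f U" "Ck_on (Suc 0) (\<lambda>y. frechet_derivative f (at y) w) U" for w
    using assms(1) by (auto simp: numeral_2_eq_2)
  have g: "Ck_on 2 ?g U"
    by (rule Ck_on_bounded_linear[OF assms(1) bounded_linear_inner_left assms(2)])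
  have 1: "frechet_derivative f (at y) w \<bullet> b = frechet_derivative ?g (at y) w" if "y \<in> U" for y w
    using frechet_derivative_at[OF has_derivative_inner_left[OF Ck_on_has_derivative[OF C(1) assms(2) that]],
        of b]
    by metis
  have 2: "frechet_derivative (\<lambda>y. frechet_derivative f (at y) w) (at x) z \<bullet> b
      = frechet_derivative (\<lambda>y. frechet_derivative ?g (at y) w) (at x) z" for w z
  proof -
    have "((\<lambda>y. frechet_derivative f (at y) w \<bullet> b) has_derivative
        (\<lambda>z. frechet_derivative (\<lambda>y. frechet_derivative f (at y) w) (at x) z \<bullet> b)) (at x)"
      by (rule has_derivative_inner_left[OF Ck_on_has_derivative[OF C(2) assms(2,3)]])
    from has_derivative_transform_within_open[OF this assms(2,3) 1] show ?thesis
      using frechet_derivative_at by metis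
  qed
  show "frechet_derivative (\<lambda>y. frechet_derivative f (at y) u) (at x) v \<bullet> b
     = frechet_derivative (\<lambda>y. frechet_derivative f (at y) v) (at x) u \<bullet> b"
    unfolding 2 by (rule second_derivative_symmetric_real[OF g assms(2,3)])
qed


section \<open>Smooth maps on chart domains\<close>

text \<open>Differentiation of the values on \<open>D\<close> alone, one-sided at boundary points; it is an operator
  on functions, so that it can be iterated.\<close>

definition dir_deriv :: "'a::euclidean_space set \<Rightarrow> 'a \<Rightarrow> ('a \<Rightarrow> 'b::euclidean_space) \<Rightarrow> 'a \<Rightarrow> 'b" where
  "dir_deriv D v f x = frechet_derivative f (at x within D) v"

text \<open>Derivatives within a half-space-open set are unique because along every line through a point
  of the set there are arbitrarily close further points of the set.\<close>

lemma half_space_open_accessible: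
  assumes "half_space_open D" "x \<in> D" "i \<noteq> 0" "e > 0"
  shows "\<exists>d. 0 < \<bar>d\<bar> \<and> \<bar>d\<bar> < e \<and> x + d *\<^sub>R i \<in> D"
proof -
  obtain H where H: "H = UNIV \<or> (\<exists>a b. a \<noteq> 0 \<and> H = {x. a \<bullet> x \<ge> b})" "openin (top_of_set H) D"
    using assms(1) by (auto simp: half_space_open_def)
  obtain r where r: "r > 0" "\<And>y. y \<in> H \<Longrightarrow> dist y x < r \<Longrightarrow> y \<in> D"
    using H(2) assms(2) unfolding openin_euclidean_subtopology_iff by blast
  define d where "d = min (e / 2) (r / (2 * norm i))"
  have d: "0 < d" "d < e" "d * norm i < r"
  proof -
    show "0 < d" "d < e" using assms(3,4) r(1) by (auto simp: d_def)
    have "d * norm i \<le> r / (2 * norm i) * norm i"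
      by (rule mult_right_mono) (auto simp: d_def)
    also have "\<dots> < r" using assms(3) r(1) by simp
    finally show "d * norm i < r" .
  qed
  have xH: "x \<in> H" using H(2) assms(2) openin_imp_subset by blast
  \<comment> \<open>At a boundary point one of the two opposite directions points into the half-space.\<close>
  have "x + d *\<^sub>R i \<in> H \<or> x + (- d) *\<^sub>R i \<in> H"
  proof (cases "H = UNIV")
    case False
    then obtain a b where ab: "H = {x. a \<bullet> x \<ge> b}" using H(1) by blast
    have "0 \<le> d * (a \<bullet> i) \<or> 0 \<le> - d * (a \<bullet> i)" by (simp add: linear)
    then show ?thesis using xH unfolding ab by (auto simp: inner_add_right inner_diff_right)
  qed simp
  then have "x + d *\<^sub>R i \<in> D \<or> x + (- d) *\<^sub>R i \<in> D"
    using r(2)[of "x + d *\<^sub>R i"] r(2)[of "x + (- d) *\<^sub>R i"] d by (auto simp: dist_norm)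
  then show ?thesis
  proof
    assume "x + d *\<^sub>R i \<in> D"
    then show ?thesis using d by (intro exI[of _ d]) auto
  next
    assume "x + (- d) *\<^sub>R i \<in> D"
    then show ?thesis using d by (intro exI[of _ "- d"]) auto
  qed
qed

lemma half_space_open_derivative:
  assumes "half_space_open D" "x \<in> D" "(f has_derivative f') (at x within D)"
  shows "frechet_derivative f (at x within D) = f'"
proof -
  have "(f has_derivative frechet_derivative f (at x within D)) (at x within D)"
    using assms(3) frechet_derivative_works differentiable_def by blast
  from this assms(3) show ?thesis
  proof (rule frechet_derivative_unique_within)
    fix i :: 'a and e :: real
    assume "i \<in> Basis" "e > 0"
    then show "\<exists>d. 0 < \<bar>d\<bar> \<and> \<bar>d\<bar> < e \<and> x + d *\<^sub>R i \<in> D"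
      by (intro half_space_open_accessible[OF assms(1,2)]) auto
  qed
qed

lemma dir_deriv_eq:
  assumes "half_space_open D" "x \<in> D" "(f has_derivative f') (at x within D)"
  shows "dir_deriv D v f x = f' v"
  by (simp add: dir_deriv_def half_space_open_derivative[OF assms])

lemma smooth_onE:
  assumes "smooth_on D f" "x \<in> D"
  obtains U F where "open U" "x \<in> U" "\<forall>k. Ck_on k F U" "\<forall>y. y \<in> D \<longrightarrow> y \<in> U \<longrightarrow> F y = f y"
  using assms unfolding smooth_on_def by (metis IntI)

lemma smooth_onI:
  assumes "\<And>x. x \<in> D \<Longrightarrow>
    \<exists>U F. open U \<and> x \<in> U \<and> (\<forall>k. Ck_on k F U) \<and> (\<forall>y. y \<in> D \<longrightarrow> y \<in> U \<longrightarrow> F y = f y)"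
  shows "smooth_on D f"
  unfolding smooth_on_def using assms by (metis IntD1 IntD2)

text \<open>All facts on smooth maps of chart domains are obtained from the smooth extensions to open
  sets: by uniqueness, the derivative within the domain is that of the extension, even at the
  boundary.\<close>

lemma extension_has_derivative:
  assumes "open U" "x \<in> U" "x \<in> D" "Ck_on (Suc k) F U" "\<And>y. y \<in> D \<Longrightarrow> y \<in> U \<Longrightarrow> F y = f y"
  shows "(f has_derivative frechet_derivative F (at x)) (at x within D)"
proof -
  have "(F has_derivative frechet_derivative F (at x)) (at x within D)"
    using Ck_on_has_derivative[OF assms(4,1,2)] by (rule has_derivative_at_withinI)
  moreover obtain e where "e > 0" "ball x e \<subseteq> U" using assms openE by blast
  ultimately show ?thesis
    using assms(3,5) by (elim has_derivative_transform_within) (auto simp: dist_commute subset_eq)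
qed

lemma smooth_on_differentiable:
  assumes "smooth_on D f" "x \<in> D"
  shows "f differentiable (at x within D)"
proof -
  from assms obtain U F where U: "open U" "x \<in> U" "\<forall>k. Ck_on k F U"
    "\<forall>y. y \<in> D \<longrightarrow> y \<in> U \<longrightarrow> F y = f y" by (rule smooth_onE)
  note U = U(1,2) U(3,4)[rule_format]
  show ?thesis
    using extension_has_derivative[OF U(1,2) assms(2) U(3,4)] by (rule differentiableI)
qed

lemma smooth_on_has_derivative:
  assumes "smooth_on D f" "x \<in> D"
  shows "(f has_derivative (\<lambda>v. dir_deriv D v f x)) (at x within D)"
  using smooth_on_differentiable[OF assms] by (simp add: dir_deriv_def frechet_derivative_works)

lemma dir_deriv_extension:
  assumes "half_space_open D" "open U" "x \<in> U" "x \<in> D" "Ck_on (Suc k) F U"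
    "\<And>y. y \<in> D \<Longrightarrow> y \<in> U \<Longrightarrow> F y = f y"
  shows "dir_deriv D v f x = frechet_derivative F (at x) v"
  by (rule dir_deriv_eq[OF assms(1,4) extension_has_derivative[OF assms(2-6)]])

lemma smooth_on_dir_deriv:
  assumes "half_space_open D" "smooth_on D f"
  shows "smooth_on D (dir_deriv D v f)"
proof (rule smooth_onI)
  fix x assume "x \<in> D"
  with assms(2) obtain U F where U: "open U" "x \<in> U" "\<forall>k. Ck_on k F U"
    "\<forall>y. y \<in> D \<longrightarrow> y \<in> U \<longrightarrow> F y = f y" by (rule smooth_onE)
  note U = U(1,2) U(3,4)[rule_format]
  have "Ck_on k (\<lambda>x. frechet_derivative F (at x) v) U" for k
    using U(3)[of "Suc k"] by simp
  moreover have "frechet_derivative F (at y) v = dir_deriv D v f y" if "y \<in> D" "y \<in> U" for y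
    using dir_deriv_extension[OF assms(1) U(1) that(2,1) U(3,4)] by simp
  ultimately show "\<exists>U F. open U \<and> x \<in> U \<and> (\<forall>k. Ck_on k F U) \<and>
      (\<forall>y. y \<in> D \<longrightarrow> y \<in> U \<longrightarrow> F y = dir_deriv D v f y)"
    using U(1,2) by blast
qed

lemma dir_deriv_commute:
  assumes "half_space_open D" "smooth_on D f" "x \<in> D"
  shows "dir_deriv D u (dir_deriv D v f) x = dir_deriv D v (dir_deriv D u f) x"
proof -
  from assms(2,3) obtain U F where U: "open U" "x \<in> U" "\<forall>k. Ck_on k F U"
    "\<forall>y. y \<in> D \<longrightarrow> y \<in> U \<longrightarrow> F y = f y" by (rule smooth_onE)
  note U = U(1,2) U(3,4)[rule_format]
  have e: "frechet_derivative F (at y) v = dir_deriv D v f y" if "y \<in> D" "y \<in> U" for y v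
    using dir_deriv_extension[OF assms(1) U(1) that(2,1) U(3,4)] by simp
  have "Ck_on (Suc 0) (\<lambda>x. frechet_derivative F (at x) v) U" for v
    using U(3)[of "Suc (Suc 0)"] by simp
  from dir_deriv_extension[OF assms(1) U(1,2) assms(3) this e]
  show ?thesis
    using second_derivative_symmetric[OF U(3) U(1,2)] by simp
qed

lemma linear_dir_deriv:
  assumes "smooth_on D f" "x \<in> D"
  shows "linear (\<lambda>v. dir_deriv D v f x)"
  using smooth_on_has_derivative[OF assms] by (rule has_derivative_linear)

lemma smooth_on_const: "smooth_on D (\<lambda>x. c)"
  by (rule smooth_onI) (use Ck_on_const[OF open_UNIV] in blast)

lemma smooth_on_bounded_linear:
  assumes "bounded_linear h" "smooth_on D f"
  shows "smooth_on D (\<lambda>x. h (f x))"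
proof (rule smooth_onI)
  fix x assume "x \<in> D"
  with assms(2) obtain U F where U: "open U" "x \<in> U" "\<forall>k. Ck_on k F U"
    "\<forall>y. y \<in> D \<longrightarrow> y \<in> U \<longrightarrow> F y = f y" by (rule smooth_onE)
  note U = U(1,2) U(3,4)[rule_format]
  then show "\<exists>U F. open U \<and> x \<in> U \<and> (\<forall>k. Ck_on k F U) \<and> (\<forall>y. y \<in> D \<longrightarrow> y \<in> U \<longrightarrow> F y = h (f y))"
    using Ck_on_bounded_linear[OF U(3) assms(1) U(1)]
    by (intro exI[of _ U] exI[of _ "\<lambda>x. h (F x)"]) auto
qed

lemma smooth_on_combine:
  fixes f :: "'a::euclidean_space \<Rightarrow> 'b::euclidean_space" and g :: "'a \<Rightarrow> 'c::euclidean_space"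
    and h :: "'b \<Rightarrow> 'c \<Rightarrow> 'd::euclidean_space"
  assumes "smooth_on D f" "smooth_on D g"
    and h: "\<And>k (F :: 'a \<Rightarrow> 'b) G U. Ck_on k F U \<Longrightarrow> Ck_on k G U \<Longrightarrow> open U \<Longrightarrow> Ck_on k (\<lambda>x. h (F x) (G x)) U"
  shows "smooth_on D (\<lambda>x. h (f x) (g x))"
proof (rule smooth_onI)
  fix x assume x: "x \<in> D"
  with assms(1) obtain U F where U: "open U" "x \<in> U" "\<forall>k. Ck_on k F U"
    "\<forall>y. y \<in> D \<longrightarrow> y \<in> U \<longrightarrow> F y = f y" by (rule smooth_onE)
  note U = U(1,2) U(3,4)[rule_format]
  from assms(2) x obtain V G where V: "open V" "x \<in> V" "\<forall>k. Ck_on k G V"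
    "\<forall>y. y \<in> D \<longrightarrow> y \<in> V \<longrightarrow> G y = g y" by (rule smooth_onE)
  note V = V(1,2) V(3,4)[rule_format]
  have "Ck_on k F (U \<inter> V)" "Ck_on k G (U \<inter> V)" for k
    using U V by (auto intro: Ck_on_subset)
  then have "Ck_on k (\<lambda>x. h (F x) (G x)) (U \<inter> V)" for k
    by (intro h open_Int U(1) V(1))
  then show "\<exists>U F. open U \<and> x \<in> U \<and> (\<forall>k. Ck_on k F U) \<and>
      (\<forall>y. y \<in> D \<longrightarrow> y \<in> U \<longrightarrow> F y = h (f y) (g y))"
    using U V by (intro exI[of _ "U \<inter> V"] exI[of _ "\<lambda>x. h (F x) (G x)"]) auto
qed

lemma smooth_on_add: "smooth_on D f \<Longrightarrow> smooth_on D g \<Longrightarrow> smooth_on D (\<lambda>x. f x + g x)"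
  by (rule smooth_on_combine[where h = "(+)"]) (auto intro: Ck_on_add)

lemma smooth_on_bilinear:
  "bounded_bilinear h \<Longrightarrow> smooth_on D f \<Longrightarrow> smooth_on D g \<Longrightarrow> smooth_on D (\<lambda>x. h (f x) (g x))"
  by (rule smooth_on_combine) (auto intro: Ck_on_bilinear)

lemma smooth_on_powr:
  fixes f :: "'a::euclidean_space \<Rightarrow> real"
  assumes "smooth_on D f" "\<And>x. x \<in> D \<Longrightarrow> f x > 0"
  shows "smooth_on D (\<lambda>x. f x powr a)"
proof (rule smooth_onI)
  fix x assume x: "x \<in> D"
  with assms(1) obtain U F where U: "open U" "x \<in> U" "\<forall>k. Ck_on k F U"
    "\<forall>y. y \<in> D \<longrightarrow> y \<in> U \<longrightarrow> F y = f y" by (rule smooth_onE)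
  note U = U(1,2) U(3,4)[rule_format]
  define V where "V = {y \<in> U. F y \<in> {0<..}}"
  have "continuous_on U F" using U(3)[of 0] by simp
  then have V: "open V"
    unfolding V_def using continuous_open_preimage[OF _ U(1) open_greaterThan, of F 0]
    by (simp add: vimage_def Int_def)
  have C: "Ck_on k F V" for k
    using Ck_on_subset[OF U(3) _ U(1) V] by (auto simp: V_def)
  have "Ck_on k (\<lambda>x. F x powr a) V" for k
    by (rule Ck_on_powr[OF C _ V]) (simp add: V_def)
  moreover have "x \<in> V" using x U assms(2) by (simp add: V_def)
  ultimately show "\<exists>U F. open U \<and> x \<in> U \<and> (\<forall>k. Ck_on k F U) \<and>
      (\<forall>y. y \<in> D \<longrightarrow> y \<in> U \<longrightarrow> F y = f y powr a)"
    using U V by (intro exI[of _ V] exI[of _ "\<lambda>x. F x powr a"]) (auto simp: V_def)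
qed

lemma smooth_on_ident: "smooth_on D (\<lambda>x. x)"
  by (rule smooth_onI) (use Ck_on_ident[OF open_UNIV] in blast)

section \<open>Differentiability of solutions of linear systems\<close>

text \<open>A factor that vanishes at the point makes continuity of the other factor sufficient for
  differentiability of the product.\<close>

lemma has_derivative_continuous_scaleR:
  fixes m :: "'a::euclidean_space \<Rightarrow> real" and q :: "'a \<Rightarrow> 'b::real_normed_vector"
  assumes "continuous (at x within D) m" "(q has_derivative q') (at x within D)" "q x = 0"
  shows "((\<lambda>y. m y *\<^sub>R q y) has_derivative (\<lambda>h. m x *\<^sub>R q' h)) (at x within D)"
  unfolding has_derivative_within_alt2
proof (intro conjI allI impI)
  show "bounded_linear (\<lambda>h. m x *\<^sub>R q' h)"
    using assms(2) by (intro bounded_linear_intros has_derivative_bounded_linear)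
  fix e :: real assume "e > 0"
  \<comment> \<open>Near \<open>x\<close> the factor \<open>q y\<close> is at most \<open>(K + 1) * norm (y - x)\<close>; \<open>e1\<close> controls the variation of
    \<open>m\<close> and \<open>e2\<close> the remainder of \<open>q\<close>, each contributing \<open>e / 2\<close>.\<close>
  obtain K where K: "K > 0" "\<And>h. norm (q' h) \<le> norm h * K"
    using has_derivative_bounded_linear[OF assms(2)] bounded_linear.pos_bounded by blast
  define e1 where "e1 = e / (2 * (K + 1))"
  have "e1 > 0" using \<open>e > 0\<close> K by (simp add: e1_def)
  define e2 where "e2 = min 1 (e / (2 * (\<bar>m x\<bar> + 1)))"
  have e2: "e2 > 0" "e2 \<le> 1" "\<bar>m x\<bar> * e2 \<le> e / 2"
  proof -
    show "e2 > 0" "e2 \<le> 1" using \<open>e > 0\<close> by (auto simp: e2_def)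
    have "\<bar>m x\<bar> * e2 \<le> (\<bar>m x\<bar> + 1) * (e / (2 * (\<bar>m x\<bar> + 1)))"
      using \<open>e > 0\<close> by (intro mult_mono) (auto simp: e2_def)
    also have "\<dots> = e / 2"
    proof -
      have "\<bar>m x\<bar> + 1 \<noteq> 0" by linarith
      then show ?thesis by (simp add: field_simps)
    qed
    finally show "\<bar>m x\<bar> * e2 \<le> e / 2" .
  qed
  have 1: "\<forall>\<^sub>F y in at x within D. norm (q y - q x - q' (y - x)) \<le> e2 * norm (y - x)"
    using assms(2) e2(1) unfolding has_derivative_within_alt2 by blast
  have 2: "\<forall>\<^sub>F y in at x within D. dist (m y) (m x) < e1"
    using assms(1) \<open>e1 > 0\<close> unfolding continuous_within tendsto_iff by blast
  from 1 2 show "\<forall>\<^sub>F y in at x within D.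
      norm (m y *\<^sub>R q y - m x *\<^sub>R q x - m x *\<^sub>R q' (y - x)) \<le> e * norm (y - x)"
  proof eventually_elim
    case (elim y)
    let ?r = "q y - q x - q' (y - x)"
    have "norm (q y) = norm (?r + q' (y - x))" using assms(3) by simp
    also have "\<dots> \<le> norm ?r + norm (q' (y - x))" by (rule norm_triangle_ineq)
    also have "\<dots> \<le> e2 * norm (y - x) + norm (y - x) * K"
      using elim(1) K(2) by (intro add_mono)
    also have "\<dots> \<le> 1 * norm (y - x) + norm (y - x) * K"
      using e2 K(1) by (intro add_mono mult_right_mono) auto
    finally have q: "norm (q y) \<le> (K + 1) * norm (y - x)" by (simp add: algebra_simps)
    have "m y *\<^sub>R q y - m x *\<^sub>R q x - m x *\<^sub>R q' (y - x) = (m y - m x) *\<^sub>R q y + m x *\<^sub>R ?r"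
      using assms(3) by (simp add: algebra_simps)
    also have "norm \<dots> \<le> \<bar>m y - m x\<bar> * norm (q y) + \<bar>m x\<bar> * norm ?r"
      using norm_triangle_ineq[of "(m y - m x) *\<^sub>R q y" "m x *\<^sub>R ?r"] by simp
    also have "\<dots> \<le> e1 * ((K + 1) * norm (y - x)) + \<bar>m x\<bar> * (e2 * norm (y - x))"
      using elim q \<open>e1 > 0\<close> K by (intro add_mono mult_mono) (auto simp: dist_real_def)
    also have "e1 * ((K + 1) * norm (y - x)) = e / 2 * norm (y - x)"
      using K by (simp add: e1_def field_simps)
    also have "e / 2 * norm (y - x) + \<bar>m x\<bar> * (e2 * norm (y - x)) \<le> e / 2 * norm (y - x) + e / 2 * norm (y
        - x)"
      using mult_right_mono[OF e2(3), of "norm (y - x)"] by (simp add: mult.assoc)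
    finally show ?case by (simp add: algebra_simps)
  qed
qed

text \<open>The solution \<open>w\<close> of a linear system with invertible matrix depends differentiably on a
  parameter. With a left inverse of the matrix at \<open>x\<close> the system becomes \<open>w y = p y - (\<Sum>e. (w y \<bullet>
  e) q e y)\<close> with differentiable \<open>p\<close> and \<open>q\<close> and \<open>q e x = 0\<close>. As \<open>q\<close> is small near \<open>x\<close>, this
  bounds \<open>w\<close> and then gives its continuity at \<open>x\<close>; differentiability follows because the
  coefficients \<open>q e\<close> vanish at \<open>x\<close>.\<close>

lemma linear_system_solution_differentiable:
  fixes w :: "'a::euclidean_space \<Rightarrow> 'c::euclidean_space" and b :: "'a \<Rightarrow> 'd::euclidean_space"
  assumes sys: "\<And>y. y \<in> D \<Longrightarrow> (\<Sum>e\<in>Basis. (w y \<bullet> e) *\<^sub>R G e y) = b y"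
    and G: "\<And>e. e \<in> Basis \<Longrightarrow> G e differentiable (at x within D)"
    and b: "b differentiable (at x within D)"
    and x: "x \<in> D" and inj: "inj (\<lambda>c. \<Sum>e\<in>Basis. (c \<bullet> e) *\<^sub>R G e x)"
  shows "w differentiable (at x within D)"
proof -
  let ?T = "\<lambda>c. \<Sum>e\<in>Basis. (c \<bullet> e) *\<^sub>R G e x"
  have "linear ?T"
    by (rule linearI) (simp_all add: inner_add_left scaleR_add_left sum.distrib scaleR_sum_right)
  from linear_injective_left_inverse[OF this inj] obtain H
    where H: "linear H" "\<And>c. H (?T c) = c" by (auto simp: fun_eq_iff)
  have bl: "bounded_linear H" using H(1) by (simp add: linear_conv_bounded_linear)
  define p where "p y = H (b y)" for y
  define q where "q e y = H (G e y - G e x)" for e y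
  have w: "w y = p y - (\<Sum>e\<in>Basis. (w y \<bullet> e) *\<^sub>R q e y)" if "y \<in> D" for y
  proof -
    have "?T (w y) = b y - (\<Sum>e\<in>Basis. (w y \<bullet> e) *\<^sub>R (G e y - G e x))"
      unfolding sys[OF that, symmetric] by (simp add: scaleR_diff_right sum_subtractf)
    from arg_cong[OF this, of H] show ?thesis
      unfolding H(2) by (simp add: p_def q_def linear_diff[OF H(1)] linear_sum[OF H(1)] linear_scale[OF H(1)])
  qed
  obtain b' where b': "(b has_derivative b') (at x within D)"
    using b by (auto simp: differentiable_def)
  have p: "(p has_derivative (\<lambda>h. H (b' h))) (at x within D)"
    unfolding p_def by (rule bounded_linear.has_derivative[OF bl b'])
  obtain G' where G': "\<And>e. e \<in> Basis \<Longrightarrow> (G e has_derivative G' e) (at x within D)"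
    using G unfolding differentiable_def by metis
  have q: "(q e has_derivative (\<lambda>h. H (G' e h))) (at x within D)" if "e \<in> Basis" for e
    unfolding q_def using bounded_linear.has_derivative[OF bl has_derivative_diff[OF G'[OF that]
        has_derivative_const]]
    by simp
  have q0: "q e x = 0" for e by (simp add: q_def linear_0[OF H(1)])
  let ?s = "\<lambda>y. \<Sum>e\<in>Basis. norm (q e y)"
  have s: "(?s \<longlongrightarrow> 0) (at x within D)"
  proof -
    have "((\<lambda>y. q e y) \<longlongrightarrow> 0) (at x within D)" if "e \<in> Basis" for e
      using has_derivative_continuous[OF q[OF that]] q0 by (simp add: continuous_within)
    then have "(?s \<longlongrightarrow> (\<Sum>e\<in>(Basis :: 'c set). 0)) (at x within D)"
      by (intro tendsto_sum tendsto_norm_zero)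
    then show ?thesis by simp
  qed
  have pc: "(p \<longlongrightarrow> p x) (at x within D)"
    using has_derivative_continuous[OF p] by (simp add: continuous_within)
  have diff: "norm (w y - p y) \<le> norm (w y) * ?s y" if "y \<in> D" for y
  proof -
    have "norm (w y - p y) = norm (\<Sum>e\<in>Basis. (w y \<bullet> e) *\<^sub>R q e y)"
      using w[OF that] by (metis norm_minus_commute diff_diff_eq2 add_diff_cancel_left')
    also have "\<dots> \<le> (\<Sum>e\<in>Basis. norm (w y) * norm (q e y))"
      by (rule sum_norm_le) (auto intro: mult_right_mono Basis_le_norm)
    finally show ?thesis by (simp add: sum_distrib_left)
  qed
  have ev: "\<forall>\<^sub>F y in at x within D. norm (w y - p y) \<le> 2 * norm (p y) * ?s y"
  proof -
    have "\<forall>\<^sub>F y in at x within D. ?s y < 1 / 2"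
      using s by (rule order_tendstoD) simp
    moreover have "\<forall>\<^sub>F y in at x within D. y \<in> D"
      by (simp add: eventually_at_filter)
    ultimately show ?thesis
    proof eventually_elim
      case (elim y)
      have s0: "?s y \<ge> 0" by (simp add: sum_nonneg)
      have "norm (w y) \<le> norm (p y) + norm (w y - p y)" by (rule norm_triangle_sub)
      also have "norm (w y - p y) \<le> norm (w y) * (1 / 2)"
        using diff[OF elim(2)] mult_left_mono[OF less_imp_le[OF elim(1)], of "norm (w y)"] by simp
      finally have "norm (w y) \<le> 2 * norm (p y)" by simp
      with diff[OF elim(2)] mult_right_mono[OF this s0] show ?case by linarith
    qed
  qed
  have "((\<lambda>y. 2 * norm (p y) * ?s y) \<longlongrightarrow> 2 * norm (p x) * 0) (at x within D)"
    by (intro tendsto_mult tendsto_norm tendsto_const pc s)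
  then have "((\<lambda>y. 2 * norm (p y) * ?s y) \<longlongrightarrow> 0) (at x within D)"
    by (simp only: mult_zero_right)
  from Lim_null_comparison[OF ev this] have wp: "((\<lambda>y. w y - p y) \<longlongrightarrow> 0) (at x within D)" .
  have wx: "w x = p x"
    by (subst w[OF x]) (simp add: q0)
  have "(w \<longlongrightarrow> w x) (at x within D)"
    using tendsto_add[OF wp pc] unfolding wx by simp
  then have wc: "continuous (at x within D) (\<lambda>y. w y \<bullet> e)" for e
    unfolding continuous_within by (intro tendsto_intros)
  have "((\<lambda>y. p y - (\<Sum>e\<in>Basis. (w y \<bullet> e) *\<^sub>R q e y)) has_derivative
      (\<lambda>h. H (b' h) - (\<Sum>e\<in>Basis. (w x \<bullet> e) *\<^sub>R H (G' e h)))) (at x within D)"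
    by (intro has_derivative_diff p has_derivative_sum has_derivative_continuous_scaleR wc q q0)
  then have "(w has_derivative (\<lambda>h. H (b' h) - (\<Sum>e\<in>Basis. (w x \<bullet> e) *\<^sub>R H (G' e h)))) (at x within D)"
    by (rule has_derivative_transform[OF x, rotated]) (rule w)
  then show ?thesis by (rule differentiableI)
qed


section \<open>The Gauss equation in a moving frame\<close>

text \<open>An isometric immersion seen in a moving frame. The map \<open>\<omega> x\<close> sends a tangent vector of \<open>D\<close>
  to its coordinates in an orthonormal frame of the ambient space, here identified with the
  Euclidean space \<open>'b\<close>. In this frame the ambient Levi-Civita connection is differentiation plus a
  bilinear map \<open>\<Lambda>\<close> that is the same at all points, as it is for left-invariant frames of a Lie
  group. Skewness says that the connection is metric, \<open>torsion_free\<close> that it is symmetric along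
  \<open>D\<close>.\<close>

locale adapted_coframe =
  fixes D :: "'a::euclidean_space set" and \<omega> :: "'a \<Rightarrow> 'a \<Rightarrow> 'b::euclidean_space"
    and \<Lambda> :: "'b \<Rightarrow> 'b \<Rightarrow> 'b" and g :: "'a riem_metric"
  assumes domain: "half_space_open D"
    and smooth: "\<And>v. smooth_on D (\<lambda>x. \<omega> x v)"
    and lin: "\<And>x. x \<in> D \<Longrightarrow> linear (\<omega> x)"
    and inj: "\<And>x. x \<in> D \<Longrightarrow> inj (\<omega> x)"
    and bil: "bounded_bilinear \<Lambda>"
    and skew: "\<And>a b c. \<Lambda> a b \<bullet> c = - (b \<bullet> \<Lambda> a c)"
    and torsion_free: "\<And>x u v. x \<in> D \<Longrightarrow>
      dir_deriv D u (\<lambda>x. \<omega> x v) x + \<Lambda> (\<omega> x u) (\<omega> x v) =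
      dir_deriv D v (\<lambda>x. \<omega> x u) x + \<Lambda> (\<omega> x v) (\<omega> x u)"
    and metric: "\<And>x u v. x \<in> D \<Longrightarrow> g x u v = \<omega> x u \<bullet> \<omega> x v"
begin

text \<open>The ambient covariant derivative, along \<open>u\<close>, of the tangent field with constant coefficients
  \<open>v\<close>.\<close>

definition cov :: "'a \<Rightarrow> 'a \<Rightarrow> 'a \<Rightarrow> 'b" where
  "cov u v x = dir_deriv D u (\<lambda>x. \<omega> x v) x + \<Lambda> (\<omega> x u) (\<omega> x v)"

text \<open>The second fundamental form, as the part of the ambient derivative that is not accounted for
  by the connection of the pulled back metric.\<close>

definition II :: "'a \<Rightarrow> 'a \<Rightarrow> 'a \<Rightarrow> 'b" where
  "II u v x = cov u v x - \<omega> x (christoffel D g x u v)"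

lemma cov_sym: "x \<in> D \<Longrightarrow> cov u v x = cov v u x"
  by (simp add: cov_def torsion_free)

lemma smooth_cov: "smooth_on D (cov u v)"
  unfolding cov_def
  by (intro smooth_on_add smooth_on_bilinear[OF bil] smooth smooth_on_dir_deriv[OF domain])

lemma inner_cov:
  assumes "x \<in> D"
  shows "((\<lambda>x. \<omega> x v \<bullet> \<omega> x y) has_derivative (\<lambda>u. cov u v x \<bullet> \<omega> x y + \<omega> x v \<bullet> cov u y x)) (at x within D)"
  using has_derivative_inner[OF smooth_on_has_derivative[OF smooth assms] smooth_on_has_derivative[OF smooth
      assms], of v y]
  by (rule has_derivative_eq_rhs) (simp add: cov_def inner_add_left inner_add_right skew fun_eq_iff)

lemma metric_derivative:
  assumes "x \<in> D"
  shows "frechet_derivative (\<lambda>x. g x v y) (at x within D) u = cov u v x \<bullet> \<omega> x y + \<omega> x v \<bullet> cov u y x"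
proof -
  have "((\<lambda>x. g x v y) has_derivative (\<lambda>u. cov u v x \<bullet> \<omega> x y + \<omega> x v \<bullet> cov u y x)) (at x within D)"
    by (rule has_derivative_transform[OF assms metric inner_cov[OF assms]])
  from half_space_open_derivative[OF domain assms this] show ?thesis by simp
qed

text \<open>A tangent vector in the kernel of the Gram matrix is orthogonal to all tangent vectors,
  hence to itself.\<close>

lemma gram_linear_inj:
  assumes "x \<in> D"
  shows "linear (\<lambda>w. \<Sum>i\<in>Basis. (\<omega> x w \<bullet> \<omega> x i) *\<^sub>R i)" "inj (\<lambda>w. \<Sum>i\<in>Basis. (\<omega> x w \<bullet> \<omega> x i) *\<^sub>R i)"
proof -
  let ?T = "\<lambda>w. \<Sum>i\<in>Basis. (\<omega> x w \<bullet> \<omega> x i) *\<^sub>R i"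
  note l = lin[OF assms]
  show lT: "linear ?T"
    by (rule linearI) (simp_all add: linear_add[OF l] linear_scale[OF l] inner_add_left
        scaleR_add_left sum.distrib scaleR_sum_right)
  show "inj ?T"
  proof (rule linear_injective_0[OF lT, THEN iffD2], intro allI impI)
    fix w assume w0: "?T w = 0"
    have "\<omega> x w \<bullet> \<omega> x i = 0" if "i \<in> Basis" for i
      using arg_cong[OF w0, of "\<lambda>z. z \<bullet> i"] that by (simp add: inner_sum_left_Basis)
    then have "\<omega> x w \<bullet> \<omega> x (\<Sum>i\<in>Basis. (w \<bullet> i) *\<^sub>R i) = 0"
      by (simp add: linear_sum[OF l] linear_scale[OF l] inner_sum_right)
    then have "\<omega> x w = \<omega> x 0" by (simp add: euclidean_representation linear_0[OF l])
    then show "w = 0" using inj[OF assms] by (simp add: inj_eq)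
  qed
qed

text \<open>Orthogonal projection onto the tangent space; uniqueness is what the definite description in
  the Christoffel symbols needs.\<close>

lemma tangential_part:
  assumes "x \<in> D"
  shows "\<exists>!w. \<forall>y. \<omega> x w \<bullet> \<omega> x y = s \<bullet> \<omega> x y"
proof -
  note l = lin[OF assms]
  note T = gram_linear_inj[OF assms]
  obtain w where w: "(\<Sum>i\<in>Basis. (\<omega> x w \<bullet> \<omega> x i) *\<^sub>R i) = (\<Sum>i\<in>Basis. (s \<bullet> \<omega> x i) *\<^sub>R i)"
    using linear_injective_imp_surjective[OF T] by (auto simp: surj_def) metis
  have b: "\<omega> x w \<bullet> \<omega> x i = s \<bullet> \<omega> x i" if "i \<in> Basis" for i
    using arg_cong[OF w, of "\<lambda>z. z \<bullet> i"] that by (simp add: inner_sum_left_Basis)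
  have "\<omega> x w \<bullet> \<omega> x (\<Sum>i\<in>Basis. (y \<bullet> i) *\<^sub>R i) = s \<bullet> \<omega> x (\<Sum>i\<in>Basis. (y \<bullet> i) *\<^sub>R i)" for y
    by (simp add: linear_sum[OF l] linear_scale[OF l] inner_sum_right b)
  then have ex: "\<forall>y. \<omega> x w \<bullet> \<omega> x y = s \<bullet> \<omega> x y" by (simp add: euclidean_representation)
  have "z = w" if "\<forall>y. \<omega> x z \<bullet> \<omega> x y = s \<bullet> \<omega> x y" for z
  proof -
    have "(\<omega> x z - \<omega> x w) \<bullet> \<omega> x (z - w) = 0" using that ex by (simp add: inner_diff_left)
    then have "\<omega> x z = \<omega> x w" by (simp add: linear_diff[OF l])
    then show ?thesis using inj[OF assms] by (simp add: inj_eq)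
  qed
  with ex show ?thesis by blast
qed

text \<open>Skewness turns each derivative of the metric in the Koszul formula into two covariant
  derivatives, and by symmetry of \<open>cov\<close> four of the six terms cancel: the Levi-Civita connection
  of the pulled back metric is the tangential part of the ambient one.\<close>

lemma christoffel_inner:
  assumes "x \<in> D"
  shows "\<omega> x (christoffel D g x u v) \<bullet> \<omega> x y = cov u v x \<bullet> \<omega> x y"
proof -
  have "christoffel D g x u v = (THE w. \<forall>y. \<omega> x w \<bullet> \<omega> x y = cov u v x \<bullet> \<omega> x y)"
  proof -
    have "2 * g x w y =
       frechet_derivative (\<lambda>x. g x v y) (at x within D) u
     + frechet_derivative (\<lambda>x. g x u y) (at x within D) v
     - frechet_derivative (\<lambda>x. g x u v) (at x within D) y
     \<longleftrightarrow> \<omega> x w \<bullet> \<omega> x y = cov u v x \<bullet> \<omega> x y" for w y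
      unfolding metric_derivative[OF assms] metric[OF assms] cov_sym[OF assms, of v u]
        cov_sym[OF assms, of y u] cov_sym[OF assms, of y v]
      by (simp add: inner_commute)
    then show ?thesis unfolding christoffel_def by simp
  qed
  moreover have "\<forall>y. \<omega> x (THE w. \<forall>y. \<omega> x w \<bullet> \<omega> x y = cov u v x \<bullet> \<omega> x y) \<bullet> \<omega> x y = cov u v x \<bullet> \<omega> x y"
    by (rule theI'[OF tangential_part[OF assms]])
  ultimately show ?thesis by simp
qed

lemma II_normal: "x \<in> D \<Longrightarrow> II u v x \<bullet> \<omega> x y = 0"
  by (simp add: II_def inner_diff_left christoffel_inner)

text \<open>The Christoffel symbols solve the linear system given by the Gram matrix.\<close>

lemma christoffel_differentiable:
  assumes "x \<in> D"
  shows "(\<lambda>y. christoffel D g y u v) differentiable (at x within D)"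
proof (rule linear_system_solution_differentiable[where D = D and x = x
      and G = "\<lambda>e y. \<Sum>i\<in>Basis. (\<omega> y e \<bullet> \<omega> y i) *\<^sub>R i" and b = "\<lambda>y. \<Sum>i\<in>Basis. (cov u v y \<bullet> \<omega> y i) *\<^sub>R i"])
  have sum: "(\<Sum>e\<in>Basis. (c \<bullet> e) *\<^sub>R (\<Sum>i\<in>Basis. (\<omega> y e \<bullet> \<omega> y i) *\<^sub>R i)) = (\<Sum>i\<in>Basis. (\<omega> y c \<bullet> \<omega> y i) *\<^sub>R i)"
    if "y \<in> D" for y and c :: 'a
  proof -
    note l = gram_linear_inj(1)[OF that]
    have "(\<Sum>e\<in>Basis. (c \<bullet> e) *\<^sub>R (\<Sum>i\<in>Basis. (\<omega> y e \<bullet> \<omega> y i) *\<^sub>R i))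
      = (\<lambda>w. \<Sum>i\<in>Basis. (\<omega> y w \<bullet> \<omega> y i) *\<^sub>R i) (\<Sum>e\<in>Basis. (c \<bullet> e) *\<^sub>R e)"
      unfolding linear_sum[OF l] linear_scale[OF l] ..
    then show ?thesis by (simp add: euclidean_representation)
  qed
  show "(\<Sum>e\<in>Basis. (christoffel D g y u v \<bullet> e) *\<^sub>R (\<Sum>i\<in>Basis. (\<omega> y e \<bullet> \<omega> y i) *\<^sub>R i))
      = (\<Sum>i\<in>Basis. (cov u v y \<bullet> \<omega> y i) *\<^sub>R i)" if "y \<in> D" for y
    unfolding sum[OF that] christoffel_inner[OF that] ..
  show "inj (\<lambda>c. \<Sum>e\<in>Basis. (c \<bullet> e) *\<^sub>R (\<Sum>i\<in>Basis. (\<omega> x e \<bullet> \<omega> x i) *\<^sub>R i))"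
    unfolding sum[OF assms] by (rule gram_linear_inj(2)[OF assms])
  have d: "(\<lambda>y. (f y \<bullet> \<omega> y i) *\<^sub>R i) differentiable (at x within D)" if "smooth_on D f" for f i
    using smooth_on_differentiable[OF that assms] smooth_on_differentiable[OF smooth assms]
    by (intro differentiable_scaleR differentiable_inner) auto
  show "(\<lambda>y. \<Sum>i\<in>Basis. (\<omega> y e \<bullet> \<omega> y i) *\<^sub>R i) differentiable (at x within D)" for e
    by (rule differentiable_sum) (auto intro: d smooth)
  show "(\<lambda>y. \<Sum>i\<in>Basis. (cov u v y \<bullet> \<omega> y i) *\<^sub>R i) differentiable (at x within D)"
    by (rule differentiable_sum) (auto intro: d smooth_cov)
qed (rule assms)

text \<open>The product rule, obtained by expanding the vector field in the standard basis.\<close>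

lemma coframe_field_derivative:
  assumes x: "x \<in> D" and z: "(z has_derivative z') (at x within D)"
  shows "((\<lambda>y. \<omega> y (z y)) has_derivative (\<lambda>h. dir_deriv D h (\<lambda>y. \<omega> y (z x)) x + \<omega> x (z' h))) (at x within D)"
proof -
  have rep: "\<omega> y c = (\<Sum>e\<in>Basis. (c \<bullet> e) *\<^sub>R \<omega> y e)" if "y \<in> D" for y c
  proof -
    note l = lin[OF that]
    have "\<omega> y (\<Sum>e\<in>Basis. (c \<bullet> e) *\<^sub>R e) = (\<Sum>e\<in>Basis. (c \<bullet> e) *\<^sub>R \<omega> y e)"
      by (simp add: linear_sum[OF l] linear_scale[OF l])
    then show ?thesis by (simp add: euclidean_representation)
  qed
  note d = smooth_on_has_derivative[OF smooth x]
  have c: "dir_deriv D h (\<lambda>y. \<omega> y c) x = (\<Sum>e\<in>Basis. (c \<bullet> e) *\<^sub>R dir_deriv D h (\<lambda>y. \<omega> y e) x)" for h c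
  proof -
    have "((\<lambda>y. \<Sum>e\<in>Basis. (c \<bullet> e) *\<^sub>R \<omega> y e) has_derivative
        (\<lambda>h. \<Sum>e\<in>Basis. (c \<bullet> e) *\<^sub>R dir_deriv D h (\<lambda>y. \<omega> y e) x)) (at x within D)"
      by (intro has_derivative_sum has_derivative_scaleR_right d)
    then have "((\<lambda>y. \<omega> y c) has_derivative
        (\<lambda>h. \<Sum>e\<in>Basis. (c \<bullet> e) *\<^sub>R dir_deriv D h (\<lambda>y. \<omega> y e) x)) (at x within D)"
      by (rule has_derivative_transform[OF x, rotated]) (rule rep)
    then show ?thesis by (rule dir_deriv_eq[OF domain x])
  qed
  have "((\<lambda>y. \<Sum>e\<in>Basis. (z y \<bullet> e) *\<^sub>R \<omega> y e) has_derivative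
      (\<lambda>h. \<Sum>e\<in>Basis. (z x \<bullet> e) *\<^sub>R dir_deriv D h (\<lambda>y. \<omega> y e) x + (z' h \<bullet> e) *\<^sub>R \<omega> x e)) (at x within D)"
    by (intro has_derivative_sum has_derivative_scaleR has_derivative_inner_left z d)
  then have "((\<lambda>y. \<omega> y (z y)) has_derivative
      (\<lambda>h. \<Sum>e\<in>Basis. (z x \<bullet> e) *\<^sub>R dir_deriv D h (\<lambda>y. \<omega> y e) x + (z' h \<bullet> e) *\<^sub>R \<omega> x e)) (at x within D)"
    by (rule has_derivative_transform[OF x, rotated]) (rule rep)
  then show ?thesis
    by (rule has_derivative_eq_rhs) (simp add: fun_eq_iff sum.distrib c[of _ "z x"] rep[OF x, of "z' _"])
qed

text \<open>The two sides of \<open>christoffel_inner\<close> are differentiated along \<open>u\<close>. This avoids a derivative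
  of the second fundamental form, which enters only through \<open>II v w x \<bullet> \<omega> x y = 0\<close>.\<close>

lemma second_covariant_derivative:
  assumes x: "x \<in> D"
  shows "\<omega> x (frechet_derivative (\<lambda>x. christoffel D g x v w) (at x within D) u
         + christoffel D g x u (christoffel D g x v w)) \<bullet> \<omega> x y
    = (dir_deriv D u (cov v w) x + \<Lambda> (\<omega> x u) (cov v w x)) \<bullet> \<omega> x y + II v w x \<bullet> II u y x"
proof -
  let ?\<Gamma> = "\<lambda>x. christoffel D g x v w"
  let ?\<Gamma>' = "frechet_derivative ?\<Gamma> (at x within D)"
  note l = lin[OF x]
  have \<Gamma>: "(?\<Gamma> has_derivative ?\<Gamma>') (at x within D)"
    using christoffel_differentiable[OF x] by (simp add: frechet_derivative_works)
  have "((\<lambda>x. \<omega> x (?\<Gamma> x) \<bullet> \<omega> x y) has_derivative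
      (\<lambda>h. \<omega> x (?\<Gamma> x) \<bullet> dir_deriv D h (\<lambda>x. \<omega> x y) x
         + (dir_deriv D h (\<lambda>y. \<omega> y (?\<Gamma> x)) x + \<omega> x (?\<Gamma>' h)) \<bullet> \<omega> x y)) (at x within D)"
    by (rule has_derivative_inner[OF coframe_field_derivative[OF x \<Gamma>] smooth_on_has_derivative[OF smooth x]])
  then have 1: "((\<lambda>x. cov v w x \<bullet> \<omega> x y) has_derivative
      (\<lambda>h. \<omega> x (?\<Gamma> x) \<bullet> dir_deriv D h (\<lambda>x. \<omega> x y) x
         + (dir_deriv D h (\<lambda>y. \<omega> y (?\<Gamma> x)) x + \<omega> x (?\<Gamma>' h)) \<bullet> \<omega> x y)) (at x within D)"
    by (rule has_derivative_transform[OF x, rotated]) (simp add: christoffel_inner)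
  have 2: "((\<lambda>x. cov v w x \<bullet> \<omega> x y) has_derivative
      (\<lambda>h. cov v w x \<bullet> dir_deriv D h (\<lambda>x. \<omega> x y) x + dir_deriv D h (cov v w) x \<bullet> \<omega> x y)) (at x within D)"
    by (rule has_derivative_inner[OF smooth_on_has_derivative[OF smooth_cov x] smooth_on_has_derivative[OF
        smooth x]])
  have 3: "\<omega> x (?\<Gamma> x) \<bullet> dir_deriv D u (\<lambda>x. \<omega> x y) x
        + (dir_deriv D u (\<lambda>y. \<omega> y (?\<Gamma> x)) x + \<omega> x (?\<Gamma>' u)) \<bullet> \<omega> x y
      = cov v w x \<bullet> dir_deriv D u (\<lambda>x. \<omega> x y) x + dir_deriv D u (cov v w) x \<bullet> \<omega> x y"
    using dir_deriv_eq[OF domain x 1, of u] dir_deriv_eq[OF domain x 2, of u] by simp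
  have dd: "dir_deriv D u (\<lambda>y. \<omega> y z) x = cov u z x - \<Lambda> (\<omega> x u) (\<omega> x z)" for z
    by (simp add: cov_def)
  have "II v w x \<bullet> II u y x = II v w x \<bullet> cov u y x"
    by (simp add: II_def[of u y] inner_diff_right II_normal[OF x])
  then have 4: "II v w x \<bullet> II u y x = cov v w x \<bullet> cov u y x - \<omega> x (?\<Gamma> x) \<bullet> cov u y x"
    by (simp add: II_def[of v w] inner_diff_left)
  have 5: "\<omega> x (christoffel D g x u (?\<Gamma> x)) \<bullet> \<omega> x y = cov u (?\<Gamma> x) x \<bullet> \<omega> x y"
    by (rule christoffel_inner[OF x])
  show ?thesis
    using 3 unfolding dd 4 linear_add[OF l] inner_add_left 5
    by (simp add: inner_diff_left inner_diff_right inner_add_left skew)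
qed

text \<open>The Gauss equation. Antisymmetrizing the ambient second covariant derivative leaves no
  derivatives: the second derivatives of the coframe commute, and its first derivatives cancel or
  are replaced, the torsion being zero, by the bracket \<open>\<Lambda> a b - \<Lambda> b a\<close> of the frame.\<close>

lemma gauss_equation:
  fixes u v w y :: 'a
  assumes x: "x \<in> D"
  defines "a \<equiv> \<omega> x u" and "b \<equiv> \<omega> x v" and "c \<equiv> \<omega> x w"
  shows "g x (curvature_tensor D g x u v w) y
    = (\<Lambda> a (\<Lambda> b c) - \<Lambda> b (\<Lambda> a c) - \<Lambda> (\<Lambda> a b - \<Lambda> b a) c) \<bullet> \<omega> x y
      + II v w x \<bullet> II u y x - II u w x \<bullet> II v y x"
proof -
  interpret L: bounded_bilinear \<Lambda> by (rule bil)
  note l = lin[OF x]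
  let ?d = "\<lambda>u z. dir_deriv D u (\<lambda>x. \<omega> x z) x"
  have dcov: "dir_deriv D u (cov v w) x = dir_deriv D u (dir_deriv D v (\<lambda>x. \<omega> x w)) x
      + \<Lambda> (?d u v) (\<omega> x w) + \<Lambda> (\<omega> x v) (?d u w)" for u v
  proof -
    have "(cov v w has_derivative (\<lambda>u. dir_deriv D u (dir_deriv D v (\<lambda>x. \<omega> x w)) x
        + (\<Lambda> (\<omega> x v) (?d u w) + \<Lambda> (?d u v) (\<omega> x w)))) (at x within D)"
      unfolding cov_def[abs_def]
      by (intro has_derivative_add smooth_on_has_derivative[OF _ x] smooth_on_dir_deriv domain smooth
          L.FDERIV)
    from dir_deriv_eq[OF domain x this, of u] show ?thesis by simp
  qed
  have t: "?d v u = ?d u v + \<Lambda> a b - \<Lambda> b a"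
    using torsion_free[OF x, of u v] by (simp add: a_def b_def algebra_simps)
  have "dir_deriv D u (cov v w) x + \<Lambda> a (cov v w x) - (dir_deriv D v (cov u w) x + \<Lambda> b (cov u w x))
      = \<Lambda> a (\<Lambda> b c) - \<Lambda> b (\<Lambda> a c) - \<Lambda> (\<Lambda> a b - \<Lambda> b a) c"
    unfolding dcov dir_deriv_commute[OF domain smooth x, of v u]
    by (simp add: cov_def t L.add_left L.add_right L.diff_left flip: a_def b_def c_def)
  note this[symmetric]
  moreover have "g x (curvature_tensor D g x u v w) y
    = (dir_deriv D u (cov v w) x + \<Lambda> a (cov v w x)) \<bullet> \<omega> x y + II v w x \<bullet> II u y x
    - ((dir_deriv D v (cov u w) x + \<Lambda> b (cov u w x)) \<bullet> \<omega> x y + II u w x \<bullet> II v y x)"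
    unfolding metric[OF x] curvature_tensor_def Let_def linear_diff[OF l] inner_diff_left
      second_covariant_derivative[OF x] a_def b_def ..
  ultimately show ?thesis
    by (simp add: inner_diff_left)
qed

end


section \<open>Curvature in the charts of the hypersurface\<close>

text \<open>The Levi-Civita connection of \<open>G(j,c)\<close> in the left-invariant orthonormal frame, where a
  triple \<open>(a, X, Z)\<close> stands for \<open>a c A + X + Z\<close>, so that the inner product is the standard one. It
  is the skew bilinear map with \<open>\<Lambda> x y - \<Lambda> y x = [x, y]\<close>.\<close>

definition frame_conn :: "('z::euclidean_space \<Rightarrow> 'v::euclidean_space \<Rightarrow>\<^sub>L 'v) \<Rightarrow> real \<Rightarrow>
    real \<times> 'v \<times> 'z \<Rightarrow> real \<times> 'v \<times> 'z \<Rightarrow> real \<times> 'v \<times> 'z" where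
  "frame_conn j c = (\<lambda>(a, X, Z) (b, Y, W).
     (c * (X \<bullet> Y / 2 + Z \<bullet> W),
      - (c * b / 2) *\<^sub>R X - (1 / 2) *\<^sub>R (j Z Y + j W X),
      - (c * b) *\<^sub>R Z + (1 / 2) *\<^sub>R bracket_v j X Y))"

lemma bounded_bilinear_frame_conn:
  assumes "linear j"
  shows "bounded_bilinear (frame_conn j c)"
  unfolding bilinear_conv_bounded_bilinear[symmetric] bilinear_def
  by (auto intro!: linearI simp: frame_conn_def bracket_v_simps linear_add[OF assms]
      linear_scale[OF assms] blinfun.bilinear_simps inner_add_left inner_add_right algebra_simps
      add_divide_distrib scaleR_add_right[symmetric] simp del: scaleR_add_right)

lemma frame_conn_skew:
  assumes "linear j" "range j \<subseteq> so"
  shows "frame_conn j c x y \<bullet> z = - (y \<bullet> frame_conn j c x z)"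
proof -
  obtain a X Z where x: "x = (a, X, Z)" using prod_cases3 by blast
  obtain b Y W where y: "y = (b, Y, W)" using prod_cases3 by blast
  obtain d V U where z: "z = (d, V, U)" using prod_cases3 by blast
  have sk: "j Q V \<bullet> Y = - (j Q Y \<bullet> V)" for Q V Y
    using assms(2) by (auto simp: so_def inner_commute)
  show ?thesis
    by (simp add: x y z frame_conn_def bracket_v_inner[OF assms(1)] inner_add_left inner_add_right
        inner_diff_left inner_diff_right inner_commute[of Y] inner_commute[of W] sk[of Z V Y] sk[of U X Y]
            sk[of W X V] field_simps)
qed

lemma smooth_on_Pair:
  assumes "smooth_on D f" "smooth_on D g"
  shows "smooth_on D (\<lambda>x. (f x, g x))"
proof -
  have "smooth_on D (\<lambda>x. (f x, 0) + (0, g x))"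
    by (intro smooth_on_add smooth_on_bounded_linear[of "\<lambda>y. (y, 0)"]
        smooth_on_bounded_linear[of "\<lambda>y. (0, y)"] bounded_linear_Pair bounded_linear_ident
        bounded_linear_zero assms)
  then show ?thesis by simp
qed

text \<open>The second fundamental form of \<open>M(j,c,r)\<close> at a point over \<open>(t, r n)\<close> with respect to the
  unit normal \<open>n\<close>.\<close>

definition second_form :: "('z::euclidean_space \<Rightarrow> 'v::euclidean_space \<Rightarrow>\<^sub>L 'v) \<Rightarrow> real \<Rightarrow> real \<Rightarrow> 'v \<Rightarrow>
    real \<times> 'v \<times> 'z \<Rightarrow> real \<times> 'v \<times> 'z \<Rightarrow> real" where
  "second_form j r t n = (\<lambda>(a, X, Z) (b, Y, W).
     - (sqrt t / r * (X \<bullet> Y) + n \<bullet> (j Z Y + j W X) / 2))"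

text \<open>The value \<open>\<langle>R(a,b)b, a\<rangle>\<close> of the curvature of a connection that is given by \<open>\<Lambda>\<close> in a
  left-invariant frame.\<close>

definition conn_curv :: "('b::real_inner \<Rightarrow> 'b \<Rightarrow> 'b) \<Rightarrow> 'b \<Rightarrow> 'b \<Rightarrow> real" where
  "conn_curv \<Lambda> a b = (\<Lambda> a (\<Lambda> b b) - \<Lambda> b (\<Lambda> a b) - \<Lambda> (\<Lambda> a b - \<Lambda> b a) b) \<bullet> a"

text \<open>The numerator in the definition of the sectional curvature of \<open>M(j,c,r)\<close>, as the Gauss
  equation gives it. For an orthonormal pair it is the sectional curvature itself.\<close>

definition curv_num :: "('z::euclidean_space \<Rightarrow> 'v::euclidean_space \<Rightarrow>\<^sub>L 'v) \<Rightarrow> real \<Rightarrow> real \<Rightarrow> real \<Rightarrow> 'v \<Rightarrow>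
    real \<times> 'v \<times> 'z \<Rightarrow> real \<times> 'v \<times> 'z \<Rightarrow> real" where
  "curv_num j r c t n a b = conn_curv (frame_conn j c) a b
     + second_form j r t n a a * second_form j r t n b b - (second_form j r t n a b)\<^sup>2"

text \<open>The properties of the charts of \<open>M(j,c,r)\<close> that matter for the curvature: they are
  immersions into the hypersurface of \<open>G(j)\<close> that lies over the sphere of radius \<open>r\<close> in \<open>\<vv>\<close>.\<close>

locale cylinder_chart =
  fixes j :: "'z::euclidean_space \<Rightarrow> 'v::euclidean_space \<Rightarrow>\<^sub>L 'v" and c r :: real
    and D :: "('v \<times> 'z) set" and f :: "'v \<times> 'z \<Rightarrow> real \<times> 'v \<times> 'z"
  assumes j: "linear j" "range j \<subseteq> so" and c: "c > 0" and r: "r > 0"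
    and domain: "half_space_open D" and smooth_f: "smooth_on D f"
    and pos: "\<And>x. x \<in> D \<Longrightarrow> fst (f x) > 0"
    and radius: "\<And>x. x \<in> D \<Longrightarrow> norm (fst (snd (f x))) = r"
    and immersion: "\<And>x. x \<in> D \<Longrightarrow> inj (frechet_derivative f (at x within D))"
begin

text \<open>Powers of \<open>s\<close>, the factor of the left-invariant coframe on \<open>\<vv>\<close>, suffice to express the whole
  coframe.\<close>

definition s where "s x = fst (f x) powr (- 1 / 2)"
definition X where "X x = fst (snd (f x))"
definition d\<tau> where "d\<tau> v x = fst (dir_deriv D v f x)"
definition dX where "dX v x = fst (snd (dir_deriv D v f x))"
definition dZ where "dZ v x = snd (snd (dir_deriv D v f x))"

text \<open>The pullback along \<open>f\<close> of the left-invariant orthonormal coframe of \<open>G(j,c)\<close>.\<close>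

definition coframe :: "'v \<times> 'z \<Rightarrow> 'v \<times> 'z \<Rightarrow> real \<times> 'v \<times> 'z" where
  "coframe x v = ((s x)\<^sup>2 * d\<tau> v x / c, s x *\<^sub>R dX v x,
     (s x)\<^sup>2 *\<^sub>R (dZ v x - (1 / 2) *\<^sub>R bracket_v j (X x) (dX v x)))"

lemma s_pos: "x \<in> D \<Longrightarrow> s x > 0"
  using pos[of x] by (simp add: s_def)

lemma s_square:
  assumes "x \<in> D"
  shows "(s x)\<^sup>2 = 1 / fst (f x)"
proof -
  have "(s x)\<^sup>2 = fst (f x) powr (- 1 / 2 + - 1 / 2)"
    unfolding s_def power2_eq_square powr_add ..
  then show ?thesis using pos[OF assms] by (simp add: powr_minus_divide)
qed

lemma smooth_df: "smooth_on D (dir_deriv D v f)"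
  by (rule smooth_on_dir_deriv[OF domain smooth_f])

lemma smooth_components:
  "smooth_on D s" "smooth_on D X" "smooth_on D (d\<tau> v)" "smooth_on D (dX v)" "smooth_on D (dZ v)"
proof -
  show "smooth_on D s" unfolding s_def
    by (intro smooth_on_powr smooth_on_bounded_linear[OF bounded_linear_fst] smooth_f pos)
  show "smooth_on D X" unfolding X_def
    by (intro smooth_on_bounded_linear[OF bounded_linear_fst] smooth_on_bounded_linear[OF bounded_linear_snd]
        smooth_f)
  show "smooth_on D (d\<tau> v)" "smooth_on D (dX v)" "smooth_on D (dZ v)"
    unfolding d\<tau>_def dX_def dZ_def
    by (intro smooth_on_bounded_linear[OF bounded_linear_fst] smooth_on_bounded_linear[OF bounded_linear_snd]
        smooth_df)+
qed

lemma bounded_bilinear_bracket_v: "bounded_bilinear (bracket_v j)"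
  using bilinear_bracket_v by (simp add: bilinear_conv_bounded_bilinear)

lemma smooth_coframe: "smooth_on D (\<lambda>x. coframe x v)"
proof -
  note sm = smooth_components smooth_on_const
    smooth_on_bilinear[OF bounded_bilinear_mult] smooth_on_bilinear[OF bounded_bilinear_scaleR]
    smooth_on_bilinear[OF bounded_bilinear_bracket_v]
  have "smooth_on D (\<lambda>x. (s x * s x * d\<tau> v x * (1 / c), s x *\<^sub>R dX v x,
     (s x * s x) *\<^sub>R (dZ v x + (- 1 / 2) *\<^sub>R bracket_v j (X x) (dX v x))))"
    by (intro smooth_on_Pair smooth_on_add sm)
  then show ?thesis by (simp add: coframe_def[abs_def] power2_eq_square)
qed

lemma linear_coframe: "x \<in> D \<Longrightarrow> linear (coframe x)"
proof -
  assume x: "x \<in> D"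
  note l = linear_dir_deriv[OF smooth_f x]
  show ?thesis
    by (rule linearI) (simp_all add: coframe_def d\<tau>_def dX_def dZ_def linear_add[OF l] linear_scale[OF l]
        bracket_v_simps algebra_simps add_divide_distrib)
qed

lemma inj_coframe:
  assumes x: "x \<in> D"
  shows "inj (coframe x)"
proof (rule linear_injective_0[OF linear_coframe[OF x], THEN iffD2], intro allI impI)
  fix v assume 0: "coframe x v = 0"
  have "dX v x = 0" using 0 s_pos[OF x] by (simp add: coframe_def zero_prod_def)
  then have "dir_deriv D v f x = 0"
    using 0 s_pos[OF x] c
    by (simp add: coframe_def zero_prod_def bracket_v_simps prod_eq_iff) (simp add: d\<tau>_def dX_def dZ_def)
  then have "frechet_derivative f (at x within D) v = frechet_derivative f (at x within D) 0"
    using linear_0[OF linear_dir_deriv[OF smooth_f x]] by (simp add: dir_deriv_def)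
  then show "v = 0" using immersion[OF x] by (simp add: inj_eq)
qed

lemma metric_coframe:
  assumes x: "x \<in> D"
  shows "pullback_metric D f (G_metric j c) x u v = coframe x u \<bullet> coframe x v"
proof -
  have f: "f x = (fst (f x), X x, snd (snd (f x)))" by (simp add: X_def)
  have df: "frechet_derivative f (at x within D) v = (d\<tau> v x, dX v x, dZ v x)" for v
    by (simp add: d\<tau>_def dX_def dZ_def dir_deriv_def)
  have t: "fst (f x) > 0" by (rule pos[OF x])
  have s4: "(s x)\<^sup>2 * (s x)\<^sup>2 = 1 / (fst (f x))\<^sup>2" by (simp add: s_square[OF x]) (simp add: power2_eq_square)
  have s2: "s x * s x = 1 / fst (f x)" using s_square[OF x] by (simp add: power2_eq_square)
  have "pullback_metric D f (G_metric j c) x u v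
    = d\<tau> u x * d\<tau> v x / (fst (f x) * c)\<^sup>2 + (dX u x \<bullet> dX v x) / fst (f x)
     + ((dZ u x - (1 / 2) *\<^sub>R bracket_v j (X x) (dX u x)) \<bullet> (dZ v x - (1 / 2) *\<^sub>R bracket_v j (X x) (dX v
         x))) / (fst (f x))\<^sup>2"
    unfolding pullback_metric_def Let_def df by (subst f) (rule G_metric[OF j(2) t])
  also have "\<dots> = ((s x)\<^sup>2 * (s x)\<^sup>2) * (d\<tau> u x * d\<tau> v x) / c\<^sup>2 + (s x * s x) * (dX u x \<bullet> dX v x)
     + ((s x)\<^sup>2 * (s x)\<^sup>2) * ((dZ u x - (1 / 2) *\<^sub>R bracket_v j (X x) (dX u x)) \<bullet> (dZ v x - (1 / 2) *\<^sub>R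
         bracket_v j (X x) (dX v x)))"
    unfolding s4 s2 by (simp add: power_mult_distrib)
  also have "\<dots> = coframe x u \<bullet> coframe x v"
    by (simp add: coframe_def power2_eq_square)
  finally show ?thesis .
qed

lemma f_derivative:
  assumes x: "x \<in> D"
  shows "(X has_derivative (\<lambda>u. dX u x)) (at x within D)"
    "(s has_derivative (\<lambda>u. - (1 / 2) * (s x) ^ 3 * d\<tau> u x)) (at x within D)"
proof -
  note f' = smooth_on_has_derivative[OF smooth_f x]
  show "(X has_derivative (\<lambda>u. dX u x)) (at x within D)"
    unfolding X_def[abs_def] dX_def by (intro has_derivative_fst has_derivative_snd f')
  have 1: "((\<lambda>t. t powr (- 1 / 2)) has_derivative (*) ((- 1 / 2) * fst (f x) powr (- 1 / 2
      - 1))) (at (fst (f x)))"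
    using has_real_derivative_powr[OF pos[OF x], of "- 1 / 2"] by (simp add: has_field_derivative_def)
  have 2: "fst (f x) powr (- 1 / 2 - 1) = (s x) ^ 3"
    using pos[OF x] by (simp add: s_def powr_powr flip: powr_numeral)
  show "(s has_derivative (\<lambda>u. - (1 / 2) * (s x) ^ 3 * d\<tau> u x)) (at x within D)"
    using has_derivative_compose[OF has_derivative_fst[OF f'] 1]
    unfolding 2 by (simp add: s_def[abs_def] d\<tau>_def)
qed

definition ddf where "ddf u v x = dir_deriv D u (dir_deriv D v f) x"

lemma ddf_sym: "x \<in> D \<Longrightarrow> ddf u v x = ddf v u x"
  unfolding ddf_def by (rule dir_deriv_commute[OF domain smooth_f])

lemma coframe_derivative:
  assumes x: "x \<in> D"
  shows "dir_deriv D u (\<lambda>x. coframe x v) x =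
    ((s x)\<^sup>2 * fst (ddf u v x) / c - ((s x) ^ 4) * d\<tau> u x * d\<tau> v x / c,
     s x *\<^sub>R fst (snd (ddf u v x)) - ((1 / 2) * (s x) ^ 3 * d\<tau> u x) *\<^sub>R dX v x,
     (s x)\<^sup>2 *\<^sub>R (snd (snd (ddf u v x)) - (1 / 2) *\<^sub>R (bracket_v j (X x) (fst (snd (ddf u v x)))
         + bracket_v j (dX u x) (dX v x)))
     - ((s x) ^ 4 * d\<tau> u x) *\<^sub>R (dZ v x - (1 / 2) *\<^sub>R bracket_v j (X x) (dX v x)))"
proof -
  note f'' = smooth_on_has_derivative[OF smooth_df x, of v]
  have d: "(d\<tau> v has_derivative (\<lambda>u. fst (ddf u v x))) (at x within D)"
    "(dX v has_derivative (\<lambda>u. fst (snd (ddf u v x)))) (at x within D)"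
    "(dZ v has_derivative (\<lambda>u. snd (snd (ddf u v x)))) (at x within D)"
    unfolding d\<tau>_def[abs_def] dX_def[abs_def] dZ_def[abs_def] ddf_def
    by (intro has_derivative_fst has_derivative_snd f'')+
  note s' = f_derivative(2)[OF x]
  have s2: "((\<lambda>x. (s x)\<^sup>2) has_derivative (\<lambda>u. - ((s x) ^ 4) * d\<tau> u x)) (at x within D)"
    by (rule has_derivative_eq_rhs[OF has_derivative_power[OF s']]) (simp add: fun_eq_iff power4_eq_xxxx
        power3_eq_cube)
  have b: "((\<lambda>x. bracket_v j (X x) (dX v x)) has_derivative
      (\<lambda>u. bracket_v j (X x) (fst (snd (ddf u v x))) + bracket_v j (dX u x) (dX v x))) (at x within D)"
    by (rule bounded_bilinear.FDERIV[OF bounded_bilinear_bracket_v f_derivative(1)[OF x] d(2)])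
  have c': "((\<lambda>x. (inverse c * ((s x)\<^sup>2 * d\<tau> v x), s x *\<^sub>R dX v x,
     (s x)\<^sup>2 *\<^sub>R (dZ v x - (1 / 2) *\<^sub>R bracket_v j (X x) (dX v x)))) has_derivative (\<lambda>u.
     (inverse c * ((s x)\<^sup>2 * fst (ddf u v x) + - ((s x) ^ 4) * d\<tau> u x * d\<tau> v x),
     s x *\<^sub>R fst (snd (ddf u v x)) + (- (1 / 2) * (s x) ^ 3 * d\<tau> u x) *\<^sub>R dX v x,
     (s x)\<^sup>2 *\<^sub>R (snd (snd (ddf u v x)) - (1 / 2) *\<^sub>R (bracket_v j (X x) (fst (snd (ddf u v x)))
         + bracket_v j (dX u x) (dX v x)))
     + (- ((s x) ^ 4) * d\<tau> u x) *\<^sub>R (dZ v x - (1 / 2) *\<^sub>R bracket_v j (X x) (dX v x))))) (at x within D)"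
    by (intro has_derivative_Pair has_derivative_mult_right has_derivative_mult has_derivative_scaleR
        has_derivative_diff has_derivative_scaleR_right s2 s' d b)
  have co: "coframe x v = (inverse c * ((s x)\<^sup>2 * d\<tau> v x), s x *\<^sub>R dX v x,
     (s x)\<^sup>2 *\<^sub>R (dZ v x - (1 / 2) *\<^sub>R bracket_v j (X x) (dX v x)))" for x
    by (simp add: coframe_def mult.commute[of "inverse c"] divide_inverse[of _ c])
  have first: "inverse c * (m * p + - (q) * y * z) = m * p / c - q * y * z / c" for m p q y z
    using c by (simp add: field_simps)
  have second: "m *\<^sub>R p + (- (1 / 2) * q * y) *\<^sub>R z = m *\<^sub>R p - ((1 / 2) * q * y) *\<^sub>R z" for m q y and p z ::
      'v
    by simp
  have third: "p + (- q * y) *\<^sub>R z = p - (q * y) *\<^sub>R z" for q y and p z :: 'z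
    by simp
  show ?thesis
    using dir_deriv_eq[OF domain x c', of u] unfolding co[symmetric] first second third .
qed

text \<open>The Maurer-Cartan equation. In each component, what remains after inserting the derivative
  of the coframe is visibly symmetric in \<open>u\<close> and \<open>v\<close>; the two brackets of the derivatives of \<open>X\<close>
  cancel.\<close>

lemma torsion_coframe:
  assumes x: "x \<in> D"
  shows "dir_deriv D u (\<lambda>x. coframe x v) x + frame_conn j c (coframe x u) (coframe x v) =
    dir_deriv D v (\<lambda>x. coframe x u) x + frame_conn j c (coframe x v) (coframe x u)"
proof -
  define su where "su = s x"
  define \<zeta> where "\<zeta> v = dZ v x - (1 / 2) *\<^sub>R bracket_v j (X x) (dX v x)" for v
  have co: "coframe x v = (su\<^sup>2 * d\<tau> v x / c, su *\<^sub>R dX v x, su\<^sup>2 *\<^sub>R \<zeta> v)" for v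
    by (simp add: coframe_def su_def \<zeta>_def)
  have bil: "bracket_v j (su *\<^sub>R dX u x) (su *\<^sub>R dX v x) = su\<^sup>2 *\<^sub>R bracket_v j (dX u x) (dX v x)" for u v
    by (simp add: bracket_v_simps power2_eq_square)
  have torsion: "dir_deriv D u (\<lambda>x. coframe x v) x + frame_conn j c (coframe x u) (coframe x v) =
    (su\<^sup>2 * fst (ddf u v x) / c - su ^ 4 * (d\<tau> u x * d\<tau> v x) / c
       + c * (su\<^sup>2 * (dX u x \<bullet> dX v x) / 2 + su ^ 4 * (\<zeta> u \<bullet> \<zeta> v)),
     su *\<^sub>R fst (snd (ddf u v x)) - (su ^ 3 / 2) *\<^sub>R (d\<tau> u x *\<^sub>R dX v x + d\<tau> v x *\<^sub>R dX u x)
       - (1 / 2) *\<^sub>R (j (su\<^sup>2 *\<^sub>R \<zeta> u) (su *\<^sub>R dX v x) + j (su\<^sup>2 *\<^sub>R \<zeta> v) (su *\<^sub>R dX u x)),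
     su\<^sup>2 *\<^sub>R (snd (snd (ddf u v x)) - (1 / 2) *\<^sub>R bracket_v j (X x) (fst (snd (ddf u v x))))
       - su ^ 4 *\<^sub>R (d\<tau> u x *\<^sub>R \<zeta> v + d\<tau> v x *\<^sub>R \<zeta> u))" (is "?l u v = ?r u v") for u v
  proof -
    have 1: "fst (?l u v) = fst (?r u v)"
      unfolding coframe_derivative[OF x] co
      by (simp add: su_def[symmetric] frame_conn_def power2_eq_square power4_eq_xxxx mult.assoc)
    have 2: "fst (snd (?l u v)) = fst (snd (?r u v))"
      unfolding coframe_derivative[OF x] co
      using c by (simp add: su_def[symmetric] frame_conn_def power2_eq_square power3_eq_cube scaleR_add_right)
    have 3: "snd (snd (?l u v)) = snd (snd (?r u v))"
      unfolding coframe_derivative[OF x] co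
      using c by (simp add: su_def[symmetric] \<zeta>_def[symmetric] frame_conn_def bil)
        (simp add: power2_eq_square power4_eq_xxxx algebra_simps)
    show ?thesis using 1 2 3 by (simp only: prod_eq_iff)
  qed
  show ?thesis
    unfolding torsion ddf_sym[OF x, of v u]
    by (simp add: inner_commute add.commute mult.commute)
qed

sublocale adapted_coframe D coframe "frame_conn j c" "pullback_metric D f (G_metric j c)"
proof (rule adapted_coframe.intro)
  show "half_space_open D" by (rule domain)
  show "smooth_on D (\<lambda>x. coframe x v)" for v by (rule smooth_coframe)
  show "bounded_bilinear (frame_conn j c)" by (rule bounded_bilinear_frame_conn[OF j(1)])
  show "frame_conn j c a b \<bullet> d = - (b \<bullet> frame_conn j c a d)" for a b d
    by (rule frame_conn_skew[OF j])
  fix x assume x: "x \<in> D"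
  show "linear (coframe x)" "inj (coframe x)"
    by (rule linear_coframe[OF x] inj_coframe[OF x])+
  show "pullback_metric D f (G_metric j c) x u v = coframe x u \<bullet> coframe x v" for u v
    by (rule metric_coframe[OF x])
  show "dir_deriv D u (\<lambda>x. coframe x v) x + frame_conn j c (coframe x u) (coframe x v) =
    dir_deriv D v (\<lambda>x. coframe x u) x + frame_conn j c (coframe x v) (coframe x u)" for u v
    by (rule torsion_coframe[OF x])
qed

text \<open>The equation \<open>X \<bullet> X = r\<^sup>2\<close>, differentiated once and twice.\<close>

lemma tangent:
  assumes x: "x \<in> D"
  shows "X x \<bullet> dX v x = 0" "X x \<bullet> fst (snd (ddf u v x)) = - (dX u x \<bullet> dX v x)"
proof -
  have 0: "X y \<bullet> dX v y = 0" if y: "y \<in> D" for y v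
  proof -
    have 1: "((\<lambda>y. X y \<bullet> X y) has_derivative (\<lambda>v. X y \<bullet> dX v y + dX v y \<bullet> X y)) (at y within D)"
      by (rule has_derivative_inner[OF f_derivative(1)[OF y] f_derivative(1)[OF y]])
    have "X z \<bullet> X z = r\<^sup>2" if "z \<in> D" for z
      using radius[OF that] by (simp add: X_def flip: power2_norm_eq_inner)
    then have 2: "((\<lambda>y. X y \<bullet> X y) has_derivative (\<lambda>v. 0)) (at y within D)"
      by (intro has_derivative_transform[OF y _ has_derivative_const[of "r\<^sup>2"]])
    show ?thesis
      using dir_deriv_eq[OF domain y 1, of v] dir_deriv_eq[OF domain y 2, of v] by (simp add: inner_commute)
  qed
  show "X x \<bullet> dX v x = 0" by (rule 0[OF x])
  have d: "(dX v has_derivative (\<lambda>u. fst (snd (ddf u v x)))) (at x within D)"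
    unfolding dX_def[abs_def] ddf_def
    by (intro has_derivative_fst has_derivative_snd smooth_on_has_derivative[OF smooth_df x])
  have 1: "((\<lambda>y. X y \<bullet> dX v y) has_derivative (\<lambda>u. X x \<bullet> fst (snd (ddf u v x))
      + dX u x \<bullet> dX v x)) (at x within D)"
    by (rule has_derivative_inner[OF f_derivative(1)[OF x] d])
  have 2: "((\<lambda>y. X y \<bullet> dX v y) has_derivative (\<lambda>u. 0)) (at x within D)"
    by (rule has_derivative_transform[OF x _ has_derivative_const[of 0]]) (rule 0)
  show "X x \<bullet> fst (snd (ddf u v x)) = - (dX u x \<bullet> dX v x)"
    using dir_deriv_eq[OF domain x 1, of u] dir_deriv_eq[OF domain x 2, of u] by simp
qed

definition normal where "normal x = (0 :: real, (1 / r) *\<^sub>R X x, 0 :: 'z)"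

text \<open>A dimension count: the tangent spaces are orthogonal to the normal and have codimension
  one.\<close>

lemma range_coframe:
  assumes x: "x \<in> D"
  shows "range (coframe x) = {p. normal x \<bullet> p = 0}"
proof (rule subspace_dim_equal)
  show "subspace (range (coframe x))"
    by (rule linear_subspace_image[OF linear_coframe[OF x] subspace_UNIV])
  show "subspace {p. normal x \<bullet> p = 0}" by (rule subspace_hyperplane)
  show "range (coframe x) \<subseteq> {p. normal x \<bullet> p = 0}"
    using tangent(1)[OF x] by (auto simp: normal_def coframe_def)
  have n0: "normal x \<noteq> 0" using radius[OF x] r by (auto simp: normal_def X_def zero_prod_def)
  have "dim (range (coframe x)) = DIM('v \<times> 'z)"
    by (simp add: dim_image_eq[OF linear_coframe[OF x] inj_on_subset[OF inj_coframe[OF x]]])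
  then show "dim {p. normal x \<bullet> p = 0} \<le> dim (range (coframe x))"
    by (simp add: dim_hyperplane[OF n0])
qed

lemma II_eq:
  assumes x: "x \<in> D"
  shows "II u v x = (cov u v x \<bullet> normal x) *\<^sub>R normal x"
proof -
  have nn: "normal x \<bullet> normal x = 1"
    using radius[OF x] r by (simp add: normal_def X_def power2_norm_eq_inner[symmetric] power2_eq_square)
  have t: "normal x \<bullet> coframe x w = 0" for w using range_coframe[OF x] by blast
  have e: "II u v x \<bullet> normal x = cov u v x \<bullet> normal x"
    using t by (simp add: II_def inner_diff_left inner_diff_right inner_commute)
  let ?p = "II u v x - (II u v x \<bullet> normal x) *\<^sub>R normal x"
  have "normal x \<bullet> ?p = 0" by (simp add: inner_diff_right nn inner_commute)
  then obtain w where w: "?p = coframe x w" using range_coframe[OF x] by blast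
  have "?p \<bullet> ?p = ?p \<bullet> coframe x w" by (simp only: w)
  also have "\<dots> = 0" using II_normal[OF x] t by (simp add: inner_diff_left)
  finally show ?thesis by (simp add: e)
qed

text \<open>Since \<open>n \<bullet> dX = 0\<close>, only the second derivative of \<open>X\<close> contributes through the derivative of
  the coframe, and that one is known from the equation of the sphere; the rest comes from the
  connection.\<close>

lemma II_second_form:
  assumes x: "x \<in> D"
  shows "cov u v x \<bullet> normal x = second_form j r (fst (f x)) ((1 / r) *\<^sub>R X x) (coframe x u) (coframe x v)"
proof -
  have sq: "sqrt (fst (f x)) = 1 / s x"
    using s_square[OF x] s_pos[OF x] by (metis real_sqrt_divide real_sqrt_one real_sqrt_abs abs_of_pos
        inverse_eq_divide inverse_inverse_eq)
  note t = tangent(1)[OF x, of u] tangent(1)[OF x, of v] tangent(2)[OF x, of u v]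
  show ?thesis
    unfolding cov_def coframe_derivative[OF x]
    using s_pos[OF x] t r
    by (simp add: normal_def second_form_def frame_conn_def coframe_def sq inner_commute[of _ "X x"]
       inner_add_right inner_diff_right power3_eq_cube field_simps)
qed

lemma sectional_curvature_chart:
  fixes u v :: "'v \<times> 'z"
  assumes x: "x \<in> D"
  defines "a \<equiv> coframe x u" and "b \<equiv> coframe x v"
  shows "sectional_curvature D (pullback_metric D f (G_metric j c)) x u v
    = curv_num j r c (fst (f x)) ((1 / r) *\<^sub>R X x) a b / ((a \<bullet> a) * (b \<bullet> b) - (a \<bullet> b)\<^sup>2)"
proof -
  have nn: "normal x \<bullet> normal x = 1"
    using radius[OF x] r by (simp add: normal_def X_def power2_norm_eq_inner[symmetric] power2_eq_square)
  have "pullback_metric D f (G_metric j c) x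
      (curvature_tensor D (pullback_metric D f (G_metric j c)) x u v v) u
    = curv_num j r c (fst (f x)) ((1 / r) *\<^sub>R X x) a b"
    unfolding gauss_equation[OF x] II_eq[OF x] II_second_form[OF x, symmetric] curv_num_def conn_curv_def
        a_def b_def
    by (simp add: nn cov_sym[OF x, of v u] power2_eq_square mult.commute)
  then show ?thesis
    unfolding sectional_curvature_def metric_coframe[OF x, of u u] metric_coframe[OF x, of v v]
        metric_coframe[OF x, of u v]
    by (simp add: a_def b_def)
qed

end


section \<open>Estimating the curvature\<close>

locale skew_connection =
  fixes \<Lambda> :: "'b::euclidean_space \<Rightarrow> 'b \<Rightarrow> 'b"
  assumes bilinear: "bounded_bilinear \<Lambda>"
    and skew: "\<And>a b c. \<Lambda> a b \<bullet> c = - (b \<bullet> \<Lambda> a c)"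
begin

lemma conn_curv_skew_form:
  "conn_curv \<Lambda> a b = \<Lambda> a b \<bullet> \<Lambda> b a - \<Lambda> a a \<bullet> \<Lambda> b b - \<Lambda> (\<Lambda> a b - \<Lambda> b a) b \<bullet> a"
  by (simp add: conn_curv_def inner_diff_left skew[of a "\<Lambda> b b" a] skew[of b "\<Lambda> a b" a]
      inner_commute[of "\<Lambda> b b"])

lemma conn_curv_scale:
  "conn_curv \<Lambda> (p *\<^sub>R a) (q *\<^sub>R b) = (p * q)\<^sup>2 * conn_curv \<Lambda> a b"
proof -
  interpret L: bounded_bilinear \<Lambda> by (rule bilinear)
  show ?thesis
    by (simp add: conn_curv_def L.scaleR_left L.scaleR_right L.diff_left inner_diff_left
        power2_eq_square algebra_simps)
qed

text \<open>Together with the scaling behaviour, this shows that the curvature of a plane may be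
  computed from any basis of it.\<close>

lemma conn_curv_shear:
  "conn_curv \<Lambda> a (b + l *\<^sub>R a) = conn_curv \<Lambda> a b"
proof -
  interpret L: bounded_bilinear \<Lambda> by (rule bilinear)
  have 0: "\<Lambda> x a \<bullet> a = 0" "a \<bullet> \<Lambda> x a = 0" for x
    using skew[of x a a] by (simp_all add: inner_commute)
  have w: "\<Lambda> a (b + l *\<^sub>R a) - \<Lambda> (b + l *\<^sub>R a) a = \<Lambda> a b - \<Lambda> b a"
    by (simp add: L.add_left L.add_right L.scaleR_left L.scaleR_right)
  show ?thesis
    unfolding conn_curv_skew_form w
    by (simp add: L.add_left L.add_right L.scaleR_left L.scaleR_right inner_add_left inner_add_right 0
        inner_commute distrib_left)
qed

end

lemma skew_connection_frame_conn:
  assumes "linear j" "range j \<subseteq> so"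
  shows "skew_connection (frame_conn j c)"
  by (rule skew_connection.intro[OF bounded_bilinear_frame_conn[OF assms(1)] frame_conn_skew[OF assms]])

lemma second_form_bilinear:
  assumes "linear j"
  shows "second_form j r t n (a + b) d = second_form j r t n a d + second_form j r t n b d"
    "second_form j r t n (p *\<^sub>R a) d = p * second_form j r t n a d"
    "second_form j r t n a d = second_form j r t n d a"
  by (simp_all add: second_form_def case_prod_unfold linear_add[OF assms] linear_scale[OF assms]
      blinfun.bilinear_simps inner_add_left inner_add_right inner_commute algebra_simps add_divide_distrib)

text \<open>Gram-Schmidt orthonormalization leaves the sectional curvature unchanged.\<close>

lemma curv_num_normalize:
  fixes j :: "'z::euclidean_space \<Rightarrow> 'v::euclidean_space \<Rightarrow>\<^sub>L 'v"
  assumes j: "linear j" "range j \<subseteq> so" and D: "(a \<bullet> a) * (b \<bullet> b) - (a \<bullet> b)\<^sup>2 > 0"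
  obtains p q l where "(p *\<^sub>R a) \<bullet> (p *\<^sub>R a) = 1"
    "(q *\<^sub>R (b + l *\<^sub>R a)) \<bullet> (q *\<^sub>R (b + l *\<^sub>R a)) = 1" "(p *\<^sub>R a) \<bullet> (q *\<^sub>R (b + l *\<^sub>R a)) = 0"
    "\<And>r c t n. curv_num j r c t n a b / ((a \<bullet> a) * (b \<bullet> b) - (a \<bullet> b)\<^sup>2)
       = curv_num j r c t n (p *\<^sub>R a) (q *\<^sub>R (b + l *\<^sub>R a))"
proof -
  let ?d = "(a \<bullet> a) * (b \<bullet> b) - (a \<bullet> b)\<^sup>2"
  have a0: "a \<bullet> a > 0" using D by (cases "a = 0") auto
  define l where "l = - (a \<bullet> b) / (a \<bullet> a)"
  define b1 where "b1 = b + l *\<^sub>R a"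
  have ab1: "a \<bullet> b1 = 0" using a0 by (simp add: b1_def l_def inner_diff_right)
  have b1b1: "(a \<bullet> a) * (b1 \<bullet> b1) = ?d"
    using a0 by (simp add: b1_def l_def inner_diff_right inner_diff_left inner_commute power2_eq_square
        field_simps)
  have b0: "b1 \<bullet> b1 > 0" using b1b1 D a0 by (metis zero_less_mult_pos)
  define p where "p = 1 / norm a"
  define q where "q = 1 / norm b1"
  have p2: "p\<^sup>2 = 1 / (a \<bullet> a)" and q2: "q\<^sup>2 = 1 / (b1 \<bullet> b1)"
    by (simp_all add: p_def q_def power_divide power2_norm_eq_inner)
  have 1: "(p *\<^sub>R a) \<bullet> (p *\<^sub>R a) = 1" using a0 by (simp add: mult.assoc[symmetric] p2[unfolded
      power2_eq_square])
  have 2: "(q *\<^sub>R b1) \<bullet> (q *\<^sub>R b1) = 1" using b0 by (simp add: mult.assoc[symmetric] q2[unfolded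
      power2_eq_square])
  have 3: "(p *\<^sub>R a) \<bullet> (q *\<^sub>R b1) = 0" using ab1 by simp
  have pq: "(p * q)\<^sup>2 = 1 / ?d"
    unfolding power_mult_distrib p2 q2 b1b1[symmetric] by simp
  have 4: "curv_num j r c t n a b / ?d = curv_num j r c t n (p *\<^sub>R a) (q *\<^sub>R b1)" for r c t n
  proof -
    interpret skew_connection "frame_conn j c" by (rule skew_connection_frame_conn[OF j])
    note sf = second_form_bilinear[OF j(1), of r t n]
    have sf': "second_form j r t n d (q *\<^sub>R b1) = q * second_form j r t n d b1"
      "second_form j r t n d (p *\<^sub>R a) = p * second_form j r t n d a"
      "second_form j r t n d (b + l *\<^sub>R a) = second_form j r t n d b + l * second_form j r t n d a" for d
      using sf by (metis (no_types))+
    have "curv_num j r c t n (p *\<^sub>R a) (q *\<^sub>R b1) = (p * q)\<^sup>2 * curv_num j r c t n a b1"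
      unfolding curv_num_def conn_curv_scale sf(2) sf' by (simp add: power2_eq_square algebra_simps)
    also have "curv_num j r c t n a b1 = curv_num j r c t n a b"
      unfolding curv_num_def b1_def conn_curv_shear sf(1,2) sf'(3)
      using sf(3)[of b a] by (simp add: power2_eq_square algebra_simps)
    finally show ?thesis by (simp add: pq)
  qed
  show ?thesis by (rule that[of p q l]) (use 1 2 3 4 b1_def in auto)
qed

text \<open>The part of the connection that grows with \<open>c\<close>. It is the connection of the extension by \<open>A\<close>
  of the abelian Lie algebra \<open>\<vv> + \<zz>\<close>, in which \<open>A\<close> acts with eigenvalues \<open>1/2\<close> and \<open>1\<close>.\<close>

definition extension_conn :: "real \<times> 'v::euclidean_space \<times> 'z::euclidean_space \<Rightarrow> real \<times> 'v \<times> 'z \<Rightarrow> real \<times> 'v \<times>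
    'z" where
  "extension_conn = frame_conn (\<lambda>Z. 0) 1"

lemma frame_conn_split: "frame_conn j c a b = c *\<^sub>R extension_conn a b + frame_conn j 0 a b"
  by (cases a; cases b) (simp add: extension_conn_def frame_conn_def bracket_v_def)

lemma skew_connection_extension_conn: "skew_connection extension_conn"
  unfolding extension_conn_def
  by (rule skew_connection_frame_conn) (auto simp: so_def linear_iff)

text \<open>With \<open>D = diag(1/2, 1)\<close> acting on \<open>\<vv> + \<zz>\<close>, the curvature is \<open>- \<parallel>D (a y' - b x')\<parallel>\<^sup>2 -
  \<parallel>D\<^sup>1\<^sup>/\<^sup>2 x' \<and> D\<^sup>1\<^sup>/\<^sup>2 y'\<parallel>\<^sup>2\<close> for \<open>x = (a, x')\<close> and \<open>y = (b, y')\<close>. As \<open>D\<close> is at least \<open>1/2\<close>, each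
  term is at least a quarter of the corresponding term of \<open>\<parallel>x \<and> y\<parallel>\<^sup>2\<close>.\<close>

lemma extension_curvature_bound:
  fixes x y :: "real \<times> 'v::euclidean_space \<times> 'z::euclidean_space"
  shows "conn_curv extension_conn x y \<le> - ((x \<bullet> x) * (y \<bullet> y) - (x \<bullet> y)\<^sup>2) / 4"
proof -
  interpret skew_connection "extension_conn :: real \<times> 'v \<times> 'z \<Rightarrow> _"
    by (rule skew_connection_extension_conn)
  obtain a X Z where x: "x = (a, X, Z)" using prod_cases3 by blast
  obtain b Y W where y: "y = (b, Y, W)" using prod_cases3 by blast
  have "(X \<bullet> Y) * (Z \<bullet> W) \<le> (norm X * norm Y) * (norm Z * norm W)"
    using mult_mono[OF Cauchy_Schwarz_ineq2[of X Y] Cauchy_Schwarz_ineq2[of Z W]]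
    by (simp flip: abs_mult)
  moreover have "0 \<le> (norm X * norm W - norm Z * norm Y)\<^sup>2" by simp
  ultimately have 1: "2 * ((X \<bullet> Y) * (Z \<bullet> W)) \<le> (X \<bullet> X) * (W \<bullet> W) + (Z \<bullet> Z) * (Y \<bullet> Y)"
    unfolding power2_diff power_mult_distrib power2_norm_eq_inner by (simp add: algebra_simps)
  have 2: "(Z \<bullet> W)\<^sup>2 \<le> (Z \<bullet> Z) * (W \<bullet> W)" by (rule Cauchy_Schwarz_ineq)
  have e: "extension_conn (a, X, Z) (b, Y, W) = ((X \<bullet> Y) / 2 + Z \<bullet> W, - (b / 2) *\<^sub>R X, - b *\<^sub>R Z)" for a X Z
      b Y W
    by (simp add: extension_conn_def frame_conn_def bracket_v_def)
  have "conn_curv extension_conn x y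
      = ((X \<bullet> Y) / 2 + Z \<bullet> W)\<^sup>2 - ((X \<bullet> X) / 2 + Z \<bullet> Z) * ((Y \<bullet> Y) / 2 + W \<bullet> W)
        - (a\<^sup>2 * (Y \<bullet> Y) + b\<^sup>2 * (X \<bullet> X) - 2 * a * b * (X \<bullet> Y)) / 4
        - (a\<^sup>2 * (W \<bullet> W) + b\<^sup>2 * (Z \<bullet> Z) - 2 * a * b * (Z \<bullet> W))"
    unfolding conn_curv_skew_form x y e
    by (simp add: e inner_add_left inner_add_right inner_diff_left inner_diff_right inner_commute
        power2_eq_square algebra_simps add_divide_distrib diff_divide_distrib)
  moreover have "(x \<bullet> x) * (y \<bullet> y) - (x \<bullet> y)\<^sup>2
    = (a\<^sup>2 + X \<bullet> X + Z \<bullet> Z) * (b\<^sup>2 + Y \<bullet> Y + W \<bullet> W) - (a * b + X \<bullet> Y + Z \<bullet> W)\<^sup>2"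
    by (simp add: x y power2_eq_square add.assoc)
  moreover have "0 \<le> (a\<^sup>2 * (W \<bullet> W) + b\<^sup>2 * (Z \<bullet> Z) - 2 * a * b * (Z \<bullet> W))"
  proof -
    have "0 \<le> (a *\<^sub>R W - b *\<^sub>R Z) \<bullet> (a *\<^sub>R W - b *\<^sub>R Z)" by simp
    then show ?thesis by (simp add: inner_diff_left inner_diff_right inner_commute power2_eq_square
        algebra_simps)
  qed
  ultimately show ?thesis using 1 2
    by (simp add: power2_eq_square field_simps)
qed

text \<open>The position \<open>t\<close> and unit normal \<open>n\<close> of a point of \<open>M(j,c,r)\<close>, and an orthonormal basis of a
  plane in its tangent space. The metric does not depend on the coordinate in \<open>\<zz>\<close>; leaving it out
  makes this set compact.\<close>

definition orthonormal_pairs :: "real \<Rightarrow> real \<Rightarrow>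
    (real \<times> 'v::euclidean_space \<times> (real \<times> 'v \<times> 'z::euclidean_space) \<times> (real \<times> 'v \<times> 'z)) set" where
  "orthonormal_pairs t1 t2 = {(t, n, a, b). t1 \<le> t \<and> t \<le> t2 \<and> norm n = 1 \<and> a \<bullet> a = 1 \<and> b \<bullet> b = 1 \<and> a \<bullet> b = 0
     \<and> n \<bullet> fst (snd a) = 0 \<and> n \<bullet> fst (snd b) = 0}"

lemma compact_orthonormal_pairs:
  "compact (orthonormal_pairs t1 t2 :: (real \<times> 'v::euclidean_space \<times> (real \<times> 'v \<times> 'z::euclidean_space) \<times>
      (real \<times> 'v \<times> 'z)) set)"
proof -
  let ?K = "orthonormal_pairs t1 t2 :: (real \<times> 'v \<times> (real \<times> 'v \<times> 'z) \<times> (real \<times> 'v \<times> 'z)) set"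
  have "?K \<subseteq> {t1..t2} \<times> cball 0 1 \<times> cball 0 1 \<times> cball 0 1"
    by (auto simp: orthonormal_pairs_def norm_eq_sqrt_inner)
  moreover have "bounded ({t1..t2} \<times> (cball 0 1 :: 'v set) \<times> (cball 0 1 :: (real \<times> 'v \<times> 'z) set) \<times> (cball 0 1
      :: (real \<times> 'v \<times> 'z) set))"
    by (intro bounded_Times) auto
  ultimately have "bounded ?K" using bounded_subset by blast
  moreover have "closed ?K"
    unfolding orthonormal_pairs_def case_prod_unfold
    by (intro closed_Collect_conj closed_Collect_le closed_Collect_eq continuous_intros)
  ultimately show ?thesis by (simp add: compact_eq_bounded_closed)
qed

lemma orthonormal_pairs_nonempty:
  assumes "t1 \<le> t2"
  shows "orthonormal_pairs t1 t2 \<noteq> ({} :: (real \<times> 'v::euclidean_space \<times> (real \<times> 'v \<times> 'z::euclidean_space) \<times>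
      (real \<times> 'v \<times> 'z)) set)"
proof -
  obtain n :: 'v where n: "n \<in> Basis" using nonempty_Basis by blast
  obtain z :: 'z where z: "z \<in> Basis" using nonempty_Basis by blast
  have "(t1, n, (1, 0, 0), (0, 0, z)) \<in> orthonormal_pairs t1 t2"
    using assms n z by (simp add: orthonormal_pairs_def)
  then show ?thesis by blast
qed

lemma continuous_on_curv_terms:
  fixes j :: "'z::euclidean_space \<Rightarrow> 'v::euclidean_space \<Rightarrow>\<^sub>L 'v"
  assumes "linear j"
  shows "continuous_on S (\<lambda>(t, n, a, b). conn_curv (frame_conn j c) a b)"
    "continuous_on S (\<lambda>(t, n, a, b). second_form j r t n a a * second_form j r t n b b
        - (second_form j r t n a b)\<^sup>2)"
proof -
  note cL = bounded_bilinear.continuous_on[OF bounded_bilinear_frame_conn[OF assms]]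
  have cj: "continuous_on S (\<lambda>x. j (f x))" if "continuous_on S f" for S :: "'d::topological_space set" and f
    using assms that by (auto simp: linear_conv_bounded_linear intro: bounded_linear.continuous_on)
  show "continuous_on S (\<lambda>(t, n, a, b). conn_curv (frame_conn j c) a b)"
    unfolding conn_curv_def case_prod_unfold by (intro continuous_intros cL)
  show "continuous_on S (\<lambda>(t, n, a, b). second_form j r t n a a * second_form j r t n b b
      - (second_form j r t n a b)\<^sup>2)"
    unfolding second_form_def case_prod_unfold
    by (cases "r = 0") (auto intro!: continuous_intros cj)
qed

text \<open>As the connection is affine in \<open>c\<close>, the curvature is a quadratic polynomial in \<open>c\<close>. Its
  leading coefficient is the curvature of the abelian extension; the other coefficients are
  continuous on the compact set of orthonormal pairs.\<close>

lemma curv_num_bound: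
  fixes j :: "'z::euclidean_space \<Rightarrow> 'v::euclidean_space \<Rightarrow>\<^sub>L 'v"
  assumes j: "linear j"
  obtains C1 C2 where "\<And>c t n a b. c > 0 \<Longrightarrow> (t, n, a, b) \<in> orthonormal_pairs t1 t2 \<Longrightarrow>
    curv_num j r c t n a b \<le> - c\<^sup>2 / 4 + C1 * c + C2"
proof -
  let ?K = "orthonormal_pairs t1 t2 :: (real \<times> 'v \<times> (real \<times> 'v \<times> 'z) \<times> (real \<times> 'v \<times> 'z)) set"
  let ?S = "extension_conn :: real \<times> 'v \<times> 'z \<Rightarrow> _" and ?T = "frame_conn j 0"
  have bS: "bounded_bilinear ?S" using skew_connection_extension_conn by (rule skew_connection.bilinear)
  have bT: "bounded_bilinear ?T" by (rule bounded_bilinear_frame_conn[OF j])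
  interpret S: bounded_bilinear ?S by (rule bS)
  interpret T: bounded_bilinear ?T by (rule bT)
  define mix where "mix a b = (?S a (?T b b) + ?T a (?S b b) - ?S b (?T a b) - ?T b (?S a b)
     - ?S (?T a b - ?T b a) b - ?T (?S a b - ?S b a) b) \<bullet> a" for a b
  have split: "conn_curv (frame_conn j c) a b = c\<^sup>2 * conn_curv ?S a b + c * mix a b + conn_curv ?T a b" for
      c a b
    unfolding conn_curv_def mix_def frame_conn_split[of j c]
    by (simp add: S.add_left S.add_right S.diff_left S.diff_right S.scaleR_left S.scaleR_right
        T.add_left T.add_right T.diff_left T.diff_right T.scaleR_left T.scaleR_right
        inner_add_left inner_diff_left power2_eq_square algebra_simps)
  have bdd: "\<exists>C. \<forall>x\<in>?K. g x \<le> C" if "continuous_on ?K g" for g :: "_ \<Rightarrow> real"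
    using compact_imp_bounded[OF compact_continuous_image[OF that compact_orthonormal_pairs]]
    unfolding bounded_iff by (auto simp: abs_le_iff)
  have "continuous_on ?K (\<lambda>(t, n, a, b). mix a b)"
    unfolding mix_def case_prod_unfold
    by (intro continuous_intros bounded_bilinear.continuous_on[OF bS] bounded_bilinear.continuous_on[OF bT])
  then obtain C1 where C1: "\<forall>x\<in>?K. (\<lambda>(t, n, a, b). mix a b) x \<le> C1"
    using bdd by blast
  have "continuous_on ?K (\<lambda>x. (\<lambda>(t, n, a, b). conn_curv ?T a b) x
      + (\<lambda>(t, n, a, b). second_form j r t n a a * second_form j r t n b b - (second_form j r t n a b)\<^sup>2) x)"
    by (intro continuous_on_add continuous_on_curv_terms[OF j])
  then obtain C2 where C2: "\<forall>x\<in>?K. (\<lambda>(t, n, a, b). conn_curv ?T a b) x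
      + (\<lambda>(t, n, a, b). second_form j r t n a a * second_form j r t n b b - (second_form j r t n a b)\<^sup>2) x \<le>
          C2"
    using bdd by blast
  show ?thesis
  proof (rule that[of C1 C2])
    fix c t :: real and n :: 'v and a b :: "real \<times> 'v \<times> 'z"
    assume c: "c > 0" and K: "(t, n, a, b) \<in> ?K"
    have "conn_curv ?S a b \<le> - 1 / 4"
      using extension_curvature_bound[of a b] K by (simp add: orthonormal_pairs_def)
    then have "c\<^sup>2 * conn_curv ?S a b \<le> c\<^sup>2 * (- 1 / 4)" by (rule mult_left_mono) simp
    moreover have "c * mix a b \<le> c * C1" using mult_left_mono[OF bspec[OF C1 K], of c] c by simp
    ultimately show "curv_num j r c t n a b \<le> - c\<^sup>2 / 4 + C1 * c + C2"
      using bspec[OF C2 K] unfolding curv_num_def split[of c] by (simp add: mult.commute)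
  qed
qed


section \<open>The lattice quotient and its charts\<close>

lemma lattice_subgroup:
  assumes "full_rank_lattice L"
  shows "0 \<in> L" "k \<in> L \<Longrightarrow> l \<in> L \<Longrightarrow> k + l \<in> L" "l \<in> L \<Longrightarrow> - l \<in> L"
proof -
  obtain B where L: "L = {\<Sum>b\<in>B. of_int (n b) *\<^sub>R b | n. True}"
    using assms by (auto simp: full_rank_lattice_def)
  show "0 \<in> L" unfolding L by (auto intro!: exI[of _ "\<lambda>_. 0"])
  show "k + l \<in> L" if kl: "k \<in> L" "l \<in> L"
  proof -
    obtain m n where "k = (\<Sum>b\<in>B. of_int (m b) *\<^sub>R b)" "l = (\<Sum>b\<in>B. of_int (n b) *\<^sub>R b)"
      using kl unfolding L by blast
    then have "k + l = (\<Sum>b\<in>B. of_int (m b + n b) *\<^sub>R b)"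
      by (simp add: scaleR_add_left sum.distrib)
    then show ?thesis unfolding L by (intro CollectI exI[of _ "\<lambda>b. m b + n b"]) simp
  qed
  show "- l \<in> L" if l: "l \<in> L"
  proof -
    obtain n where "l = (\<Sum>b\<in>B. of_int (n b) *\<^sub>R b)"
      using l unfolding L by blast
    then have "- l = (\<Sum>b\<in>B. of_int (- n b) *\<^sub>R b)"
      by (simp add: sum_negf)
    then show ?thesis unfolding L by (intro CollectI exI[of _ "\<lambda>b. - n b"]) simp
  qed
qed

text \<open>A nonzero lattice vector has a nonzero integer coordinate, and coordinates are bounded
  linear functionals.\<close>

lemma lattice_discrete:
  assumes "full_rank_lattice L"
  obtains \<delta> where "\<delta> > 0" "\<And>l. l \<in> L \<Longrightarrow> norm l < \<delta> \<Longrightarrow> l = 0"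
proof -
  obtain B where B: "independent B" and L: "L = {\<Sum>b\<in>B. of_int (n b) *\<^sub>R b | n. True}"
    using assms by (auto simp: full_rank_lattice_def)
  have fin: "finite B" by (rule independent_imp_finite[OF B])
  have "\<exists>K>0. \<forall>n. n b \<noteq> 0 \<longrightarrow> K \<le> norm (\<Sum>b\<in>B. of_int (n b) *\<^sub>R b)" if b: "b \<in> B" for b
  proof -
    obtain g :: "'a \<Rightarrow> real" where g: "linear g" "\<And>b'. b' \<in> B \<Longrightarrow> g b' = (if b' = b then 1 else 0)"
      using linear_independent_extend[OF B, of "\<lambda>b'. if b' = b then 1 else 0"] by blast
    obtain K where K: "K > 0" "\<And>z. norm (g z) \<le> K * norm z"
      using linear_bounded_pos[OF g(1)] by blast
    have "1 / K \<le> norm (\<Sum>b\<in>B. of_int (n b) *\<^sub>R b)" if "n b \<noteq> 0" for n :: "'a \<Rightarrow> int"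
    proof -
      have "g (\<Sum>b\<in>B. of_int (n b) *\<^sub>R b) = (\<Sum>b'\<in>B. of_int (n b') * (if b' = b then 1 else 0))"
        by (simp add: linear_sum[OF g(1)] linear_scale[OF g(1)] g(2) cong: sum.cong)
      also have "\<dots> = (\<Sum>b'\<in>B. if b' = b then of_int (n b') else 0)"
        by (rule sum.cong) auto
      also have "\<dots> = of_int (n b)" using b fin by simp
      finally have "\<bar>of_int (n b)\<bar> \<le> K * norm (\<Sum>b\<in>B. of_int (n b) *\<^sub>R b)"
        using K(2)[of "\<Sum>b\<in>B. of_int (n b) *\<^sub>R b"] by simp
      moreover have "1 \<le> \<bar>of_int (n b) :: real\<bar>" using that by linarith
      ultimately show ?thesis using K(1) by (simp add: divide_le_eq mult.commute)
    qed
    then show ?thesis using K(1) by (intro exI[of _ "1 / K"]) auto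
  qed
  then obtain K where K: "\<And>b. b \<in> B \<Longrightarrow> K b > 0"
    "\<And>b n. b \<in> B \<Longrightarrow> n b \<noteq> 0 \<Longrightarrow> K b \<le> norm (\<Sum>b\<in>B. of_int (n b) *\<^sub>R b)" by metis
  define \<delta> where "\<delta> = Min (insert 1 (K ` B))"
  show ?thesis
  proof (rule that[of \<delta>])
    show "\<delta> > 0" using fin K(1) by (simp add: \<delta>_def)
    fix l assume l: "l \<in> L" "norm l < \<delta>"
    then obtain n where n: "l = (\<Sum>b\<in>B. of_int (n b) *\<^sub>R b)" unfolding L by blast
    have "n b = 0" if "b \<in> B" for b
    proof (rule ccontr)
      assume "n b \<noteq> 0"
      then have "K b \<le> norm l" using K(2)[OF that] n by simp
      moreover have "\<delta> \<le> K b" using fin that by (simp add: \<delta>_def)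
      ultimately show False using l(2) by simp
    qed
    then show "l = 0" by (simp add: n)
  qed
qed

lemma to_Gbar_eq: "to_Gbar j L (t, X, Z) = (\<lambda>l. (t, X, l + Z)) ` L"
  by (auto simp: to_Gbar_def r_coset_def exp_L_def lie_exp_z G_mult bracket_v_simps)

lemma to_Gbar_shift:
  assumes "full_rank_lattice L" "l \<in> L"
  shows "to_Gbar j L (t, X, l + Z) = to_Gbar j L (t, X, Z)"
proof -
  note L = lattice_subgroup[OF assms(1)]
  show ?thesis
    unfolding to_Gbar_eq
  proof (intro equalityI subsetI)
    fix p assume "p \<in> (\<lambda>k. (t, X, k + (l + Z))) ` L"
    then obtain k where k: "k \<in> L" "p = (t, X, k + (l + Z))" by blast
    then show "p \<in> (\<lambda>k. (t, X, k + Z)) ` L"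
      using L(2)[OF k(1) assms(2)] by (auto simp: image_iff add.assoc intro!: bexI[of _ "k + l"])
  next
    fix p assume "p \<in> (\<lambda>k. (t, X, k + Z)) ` L"
    then obtain k where k: "k \<in> L" "p = (t, X, k + Z)" by blast
    then show "p \<in> (\<lambda>k. (t, X, k + (l + Z))) ` L"
      using L(2)[OF k(1) L(3)[OF assms(2)]] by (auto simp: image_iff intro!: bexI[of _ "k + - l"])
  qed
qed

lemma to_Gbar_eqD:
  assumes "full_rank_lattice L" "to_Gbar j L (t, X, Z) = to_Gbar j L (t', X', Z')"
  shows "t' = t" "X' = X" "\<exists>l\<in>L. Z' = l + Z"
proof -
  have "(t', X', 0 + Z') \<in> to_Gbar j L (t', X', Z')"
    unfolding to_Gbar_eq using lattice_subgroup(1)[OF assms(1)] by blast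
  then have "(t', X', Z') \<in> to_Gbar j L (t, X, Z)"
    using assms(2) by simp
  then have "(t', X', Z') \<in> (\<lambda>l. (t, X, l + Z)) ` L"
    unfolding to_Gbar_eq .
  then show "t' = t" "X' = X" "\<exists>l\<in>L. Z' = l + Z" by auto
qed

text \<open>The saturation of an open set is the union of its translates by lattice vectors.\<close>

lemma openin_to_Gbar_image:
  fixes j :: "'z::euclidean_space \<Rightarrow> 'v::euclidean_space \<Rightarrow>\<^sub>L 'v"
  assumes L: "full_rank_lattice L" and V: "open V" "V \<subseteq> carrier (G_group j)"
  shows "openin (Gbar_top j L) (to_Gbar j L ` V)"
  unfolding openin_Gbar_top
proof
  show "to_Gbar j L ` V \<subseteq> Gbar j L" using V(2) to_Gbar_image by blast
  let ?s = "\<lambda>l (p :: real \<times> 'v \<times> 'z). (fst p, fst (snd p), l + snd (snd p))"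
  have "{p \<in> carrier (G_group j). to_Gbar j L p \<in> to_Gbar j L ` V} = carrier (G_group j) \<inter> (\<Union>l\<in>L. ?s l -` V)"
  proof (intro equalityI subsetI)
    fix p assume p: "p \<in> {p \<in> carrier (G_group j). to_Gbar j L p \<in> to_Gbar j L ` V}"
    obtain t X Z where pe: "p = (t, X, Z)" using prod_cases3 by blast
    from p obtain q where q: "q \<in> V" "to_Gbar j L p = to_Gbar j L q" by blast
    obtain t' X' Z' where qe: "q = (t', X', Z')" using prod_cases3 by blast
    from to_Gbar_eqD[OF L q(2)[unfolded pe qe]] obtain l where "l \<in> L" "q = ?s l p"
      by (auto simp: pe qe)
    with q p show "p \<in> carrier (G_group j) \<inter> (\<Union>l\<in>L. ?s l -` V)" by blast
  next
    fix p assume p: "p \<in> carrier (G_group j) \<inter> (\<Union>l\<in>L. ?s l -` V)"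
    then obtain l where l: "l \<in> L" "?s l p \<in> V" by blast
    have "to_Gbar j L p = to_Gbar j L (?s l p)"
      using to_Gbar_shift[OF L l(1), of j "fst p" "fst (snd p)" "snd (snd p)"] by simp
    with p l(2) show "p \<in> {p \<in> carrier (G_group j). to_Gbar j L p \<in> to_Gbar j L ` V}" by blast
  qed
  moreover have "open (\<Union>l\<in>L. ?s l -` V)"
    by (intro open_UN ballI open_vimage[OF V(1)] continuous_intros)
  ultimately show "openin (top_of_set (carrier (G_group j)))
      {p \<in> carrier (G_group j). to_Gbar j L p \<in> to_Gbar j L ` V}"
    by (simp only: openin_open_Int)
qed

lemma to_Gbar_in_M:
  assumes "full_rank_lattice L" "0 < t"
  shows "to_Gbar j L (t, X, Z) \<in> M_sub j L t1 t2 r \<longleftrightarrow> t1 \<le> t \<and> t \<le> t2 \<and> norm X = r"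
proof -
  have "L \<noteq> {}" using lattice_subgroup(1)[OF assms(1)] by blast
  moreover have "to_Gbar j L (t, X, Z) \<in> Gbar j L"
    using to_Gbar_image[of j L] assms(2) by fastforce
  ultimately show ?thesis
    using assms(2) by (simp add: M_sub_def pi_bar_to_Gbar Q_sub_def R_group_def)
qed

lemma chart_M_cylinder_chart:
  assumes L: "full_rank_lattice L" and j: "linear j" "range j \<subseteq> so" and c: "c > 0" and r: "r > 0"
    and chart: "chart_M j L t1 t2 r D f"
  shows "cylinder_chart j c r D f" and "x \<in> D \<Longrightarrow> t1 \<le> fst (f x) \<and> fst (f x) \<le> t2"
proof -
  let ?T = "subtopology (Gbar_top j L) (M_sub j L t1 t2 r)"
  have D: "half_space_open D" "f ` D \<subseteq> carrier (G_group j)" "smooth_on D f"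
    "\<And>x. x \<in> D \<Longrightarrow> inj (frechet_derivative f (at x within D))"
    "embedding_map (top_of_set D) ?T (to_Gbar j L \<circ> f)"
    using chart by (auto simp: chart_M_def Let_def)
  have pos: "fst (f x) > 0" if "x \<in> D" for x using D(2) that by auto
  have toM: "to_Gbar j L (f x) \<in> M_sub j L t1 t2 r" if "x \<in> D" for x
  proof -
    have "continuous_map (top_of_set D) ?T (to_Gbar j L \<circ> f)"
      using D(5) unfolding embedding_map_def
      using homeomorphic_imp_continuous_map continuous_map_in_subtopology by blast
    then have "to_Gbar j L \<circ> f \<in> D \<rightarrow> M_sub j L t1 t2 r"
      by (simp add: continuous_map_in_subtopology)
    from funcset_mem[OF this that] show ?thesis by simp
  qed
  have M: "t1 \<le> fst (f x) \<and> fst (f x) \<le> t2 \<and> norm (fst (snd (f x))) = r" if "x \<in> D" for x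
    using to_Gbar_in_M[OF L pos[OF that], of j "fst (snd (f x))" "snd (snd (f x))" t1 t2 r] toM[OF that]
    by simp
  show "cylinder_chart j c r D f"
    by (rule cylinder_chart.intro) (use j c r D pos M in auto)
  show "t1 \<le> fst (f x) \<and> fst (f x) \<le> t2" if "x \<in> D" using M[OF that] by blast
qed

text \<open>A chart of \<open>M(j,c,r)\<close> whose image covers the open hemisphere around \<open>e\<close>: the component of
  \<open>Y\<close> along \<open>e\<close> is the coordinate \<open>t\<close>, and the affine hyperplane through \<open>e\<close> orthogonal to \<open>e\<close> is
  projected from the origin to the sphere. The boundary \<open>t = t1\<close> or \<open>t = t2\<close> becomes a hyperplane,
  as a chart requires.\<close>

definition axis_chart :: "real \<Rightarrow> 'v::euclidean_space \<Rightarrow> 'v \<times> 'z::euclidean_space \<Rightarrow> real \<times> 'v \<times> 'z" where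
  "axis_chart r e = (\<lambda>(Y, Z). let N = e + (Y - (Y \<bullet> e) *\<^sub>R e) in
     (Y \<bullet> e, (r * (N \<bullet> N) powr (- 1 / 2)) *\<^sub>R N, Z))"

text \<open>The inverse of \<open>axis_chart\<close> on the points with \<open>\<parallel>X\<parallel> = r\<close> and \<open>X \<bullet> e > 0\<close>.\<close>

definition axis_coords :: "'v::euclidean_space \<Rightarrow> real \<times> 'v \<times> 'z::euclidean_space \<Rightarrow> 'v \<times> 'z" where
  "axis_coords e = (\<lambda>(t, X, Z). (t *\<^sub>R e + inverse (X \<bullet> e) *\<^sub>R X - e, Z))"

context
  fixes r :: real and e :: "'v::euclidean_space"
  assumes r: "r > 0" and e: "norm e = 1"
begin

lemma ee: "e \<bullet> e = 1" using e by (simp add: norm_eq_sqrt_inner)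

lemma axis_normal_pos: "0 < (e + (Y - (Y \<bullet> e) *\<^sub>R e)) \<bullet> (e + (Y - (Y \<bullet> e) *\<^sub>R e))"
proof -
  have "(e + (Y - (Y \<bullet> e) *\<^sub>R e)) \<bullet> e = 1" by (simp add: inner_add_left inner_diff_left ee)
  then have "e + (Y - (Y \<bullet> e) *\<^sub>R e) \<noteq> 0" by auto
  then show ?thesis by simp
qed

lemma axis_chart_props:
  "norm (fst (snd (axis_chart r e y))) = r" "fst (snd (axis_chart r e y)) \<bullet> e > 0"
  "axis_coords e (axis_chart r e y) = y"
proof -
  obtain Y Z where y: "y = (Y, Z)" by (cases y)
  define N where "N = e + (Y - (Y \<bullet> e) *\<^sub>R e)"
  have N: "0 < N \<bullet> N" unfolding N_def by (rule axis_normal_pos)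
  have Ne: "N \<bullet> e = 1" by (simp add: N_def inner_add_left inner_diff_left ee)
  have f: "axis_chart r e y = (Y \<bullet> e, (r * (N \<bullet> N) powr (- 1 / 2)) *\<^sub>R N, Z)"
    by (simp add: axis_chart_def y N_def Let_def)
  have p: "(N \<bullet> N) powr (- 1 / 2) = 1 / norm N"
    using N by (simp add: norm_eq_sqrt_inner powr_minus_divide powr_half_sqrt)
  have n0: "norm N > 0" using N by auto
  show "norm (fst (snd (axis_chart r e y))) = r" unfolding f p using r n0 by simp
  show "fst (snd (axis_chart r e y)) \<bullet> e > 0" unfolding f p using r n0 by (simp add: Ne)
  show "axis_coords e (axis_chart r e y) = y"
    unfolding f p axis_coords_def unfolding y using r n0 by (simp add: Ne) (simp add: N_def)
qed

lemma axis_chart_coords: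
  assumes "norm X = r" "X \<bullet> e > 0"
  shows "axis_chart r e (axis_coords e (t, X, Z)) = (t, X, Z)"
    "fst (axis_coords e (t, X, Z)) \<bullet> e = t" "snd (axis_coords e (t, X, Z)) = Z"
proof -
  define Y where "Y = t *\<^sub>R e + inverse (X \<bullet> e) *\<^sub>R X - e"
  have g: "axis_coords e (t, X, Z) = (Y, Z)" by (simp add: axis_coords_def Y_def)
  have Ye: "Y \<bullet> e = t" using assms(2) by (simp add: Y_def inner_add_left inner_diff_left ee)
  have N: "e + (Y - t *\<^sub>R e) = inverse (X \<bullet> e) *\<^sub>R X" by (simp add: Y_def)
  have "(inverse (X \<bullet> e) *\<^sub>R X) \<bullet> (inverse (X \<bullet> e) *\<^sub>R X) = (r * inverse (X \<bullet> e))\<^sup>2"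
    using assms(1) power2_norm_eq_inner[of X] by (simp add: power2_eq_square)
  then have p: "((inverse (X \<bullet> e) *\<^sub>R X) \<bullet> (inverse (X \<bullet> e) *\<^sub>R X)) powr (- 1 / 2) = (X \<bullet> e) / r"
    using assms r by (simp only:) (simp add: powr_minus_divide powr_half_sqrt real_sqrt_abs inverse_eq_divide)
  show "axis_chart r e (axis_coords e (t, X, Z)) = (t, X, Z)"
    unfolding g axis_chart_def split Let_def Ye N p using r assms(2) by simp
  show "fst (axis_coords e (t, X, Z)) \<bullet> e = t" "snd (axis_coords e (t, X, Z)) = Z"
    by (simp_all add: g Ye)
qed

lemma smooth_axis_chart: "smooth_on D (axis_chart r e :: 'v \<times> 'z::euclidean_space \<Rightarrow> _)"
proof -
  define N where "N p = e + (fst p - (fst p \<bullet> e) *\<^sub>R e)" for p :: "'v \<times> 'z"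
  have f: "axis_chart r e p = (fst p \<bullet> e, (r * (N p \<bullet> N p) powr (- 1 / 2)) *\<^sub>R N p, snd p)" for p :: "'v \<times> 'z"
    by (cases p) (simp add: axis_chart_def N_def Let_def)
  have "bounded_linear (\<lambda>Y. Y - (Y \<bullet> e) *\<^sub>R e)"
    by (intro bounded_linear_sub bounded_linear_ident bounded_linear_scaleR_const bounded_linear_inner_left)
  note lin = bounded_linear_compose[OF this bounded_linear_fst]
  have N: "smooth_on D N" unfolding N_def[abs_def]
    by (intro smooth_on_add smooth_on_const smooth_on_bounded_linear[OF lin] smooth_on_ident)
  have "smooth_on D (\<lambda>p. (N p \<bullet> N p) powr (- 1 / 2))"
    by (intro smooth_on_powr smooth_on_bilinear[OF bounded_bilinear_inner N N])
      (simp only: N_def axis_normal_pos)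
  then have "smooth_on D (\<lambda>p. (fst p \<bullet> e, (r * (N p \<bullet> N p) powr (- 1 / 2)) *\<^sub>R N p, snd p))"
    by (intro smooth_on_Pair smooth_on_bilinear[OF bounded_bilinear_scaleR] smooth_on_bilinear[OF
        bounded_bilinear_mult]
        smooth_on_const N smooth_on_bounded_linear[OF bounded_linear_snd] smooth_on_ident
        smooth_on_bounded_linear[OF bounded_linear_compose[OF bounded_linear_inner_left bounded_linear_fst]])
  then show ?thesis unfolding f[abs_def] .
qed

lemma continuous_axis_coords: "continuous_on {p. fst (snd p) \<bullet> e > 0} (axis_coords e :: real \<times> 'v \<times>
    'z::euclidean_space \<Rightarrow> _)"
  unfolding axis_coords_def case_prod_unfold by (auto intro!: continuous_intros)

lemma inj_axis_chart_derivative: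
  fixes x :: "'v \<times> 'z::euclidean_space"
  assumes D: "half_space_open D" "x \<in> D"
  shows "inj (frechet_derivative (axis_chart r e) (at x within D))"
proof -
  let ?f = "axis_chart r e :: 'v \<times> 'z \<Rightarrow> _"
  have f: "(?f has_derivative frechet_derivative ?f (at x within D)) (at x within D)"
    using smooth_on_differentiable[OF smooth_axis_chart D(2)] by (simp add: frechet_derivative_works)
  have "axis_coords e differentiable (at (?f x))"
    unfolding axis_coords_def case_prod_unfold
    using axis_chart_props(2)[of x]
    by (intro differentiable_Pair differentiable_add differentiable_diff differentiable_scaleR
        differentiable_inverse
        differentiable_inner differentiable_const bounded_linear_imp_differentiable bounded_linear_compose[OF
            bounded_linear_fst bounded_linear_snd]
        bounded_linear_compose[OF bounded_linear_snd bounded_linear_snd] bounded_linear_fst) auto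
  then obtain G where G: "(axis_coords e has_derivative G) (at (?f x))"
    by (auto simp: differentiable_def)
  have "((\<lambda>y. axis_coords e (?f y)) has_derivative (\<lambda>v. G (frechet_derivative ?f (at x within D) v))) (at x
      within D)"
    by (rule has_derivative_compose[OF f G])
  then have "((\<lambda>y. y) has_derivative (\<lambda>v. G (frechet_derivative ?f (at x within D) v))) (at x within D)"
    by (simp only: axis_chart_props(3))
  from half_space_open_derivative[OF D this] half_space_open_derivative[OF D has_derivative_ident]
  have "G (frechet_derivative ?f (at x within D) v) = v" for v by metis
  then show ?thesis by (metis injI)
qed

end

text \<open>Each end of \<open>{t1..t2}\<close> needs its own half-space, so one end is removed; it can be chosen
  away from \<open>t\<close>. In \<open>\<zz>\<close> the domain is a ball that meets every orbit of the lattice at most once.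
  The image of an open subset of the domain is the part of \<open>M(j,c,r)\<close> cut out by the image of an
  open set \<open>W\<close> of the group, and \<open>to_Gbar\<close> is open.\<close>

lemma axis_chart_is_chart:
  fixes j :: "'z::euclidean_space \<Rightarrow> 'v::euclidean_space \<Rightarrow>\<^sub>L 'v"
  assumes L: "full_rank_lattice L" and t1: "0 < t1" and t: "t1 \<le> t" "t \<le> t2" "t1 < t2"
    and r: "r > 0" and e: "norm e = 1"
  obtains D where "chart_M j L t1 t2 r D (axis_chart r e)" "(t *\<^sub>R e, 0) \<in> D"
proof -
  obtain \<delta> where \<delta>: "\<delta> > 0" "\<And>l. l \<in> L \<Longrightarrow> norm l < \<delta> \<Longrightarrow> l = 0"
    using lattice_discrete[OF L] by blast
  let ?f = "axis_chart r e :: 'v \<times> 'z \<Rightarrow> real \<times> 'v \<times> 'z"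
  let ?T = "subtopology (Gbar_top j L) (M_sub j L t1 t2 r)"
  let ?\<phi> = "to_Gbar j L \<circ> ?f"
  note props = axis_chart_props[OF r e] and coords = axis_chart_coords[OF r e]
  define J where "J = (if t < t2 then {..<t2} else {t1<..})"
  have J: "open J" "t \<in> J" using t by (auto simp: J_def)
  define D where "D = {x :: 'v \<times> 'z. t1 \<le> fst x \<bullet> e \<and> fst x \<bullet> e \<le> t2 \<and> fst x \<bullet> e \<in> J \<and> norm (snd x) < \<delta> / 2}"
  have fstf: "fst (?f x) = fst x \<bullet> e" "snd (snd (?f x)) = snd x" for x
    by (simp_all add: axis_chart_def case_prod_unfold Let_def)
  have half: "half_space_open D"
  proof (cases "t < t2")
    case True
    have "D = {x. (e, 0) \<bullet> x \<ge> t1} \<inter> {x. fst x \<bullet> e < t2 \<and> norm (snd x) < \<delta> / 2}"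
      using True by (auto simp: D_def J_def inner_commute)
    moreover have "open {x :: 'v \<times> 'z. fst x \<bullet> e < t2 \<and> norm (snd x) < \<delta> / 2}"
      by (intro open_Collect_conj open_Collect_less continuous_intros)
    ultimately have "openin (top_of_set {x. (e, 0) \<bullet> x \<ge> t1}) D" by (simp add: openin_open_Int)
    moreover have "(e, 0 :: 'z) \<noteq> 0" using e by (auto simp: zero_prod_def)
    ultimately show ?thesis unfolding half_space_open_def by blast
  next
    case False
    have "D = {x. (- e, 0) \<bullet> x \<ge> - t2} \<inter> {x. t1 < fst x \<bullet> e \<and> norm (snd x) < \<delta> / 2}"
      using False by (auto simp: D_def J_def inner_commute)
    moreover have "open {x :: 'v \<times> 'z. t1 < fst x \<bullet> e \<and> norm (snd x) < \<delta> / 2}"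
      by (intro open_Collect_conj open_Collect_less continuous_intros)
    ultimately have "openin (top_of_set {x. (- e, 0) \<bullet> x \<ge> - t2}) D" by (simp add: openin_open_Int)
    moreover have "(- e, 0 :: 'z) \<noteq> 0" using e by (auto simp: zero_prod_def)
    ultimately show ?thesis unfolding half_space_open_def by blast
  qed
  have pos: "fst (?f x) > 0" if "x \<in> D" for x using that t1 by (simp add: fstf D_def)
  have carrier: "?f ` D \<subseteq> carrier (G_group j)" using pos by auto
  have smooth: "smooth_on D ?f" by (rule smooth_axis_chart[OF r e])
  have toM: "?\<phi> x \<in> M_sub j L t1 t2 r" if "x \<in> D" for x
  proof -
    have "?f x = (fst (?f x), fst (snd (?f x)), snd (snd (?f x)))" by simp
    then show ?thesis
      using to_Gbar_in_M[OF L pos[OF that], of j "fst (snd (?f x))" "snd (snd (?f x))" t1 t2 r] props(1)[of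
          x] that
      by (simp add: D_def fstf)
  qed
  have cont: "continuous_map (top_of_set D) ?T ?\<phi>"
  proof -
    have "continuous_on D ?f"
      unfolding continuous_on_eq_continuous_within
      using smooth_on_differentiable[OF smooth] differentiable_imp_continuous_within by blast
    then have "continuous_map (top_of_set D) (top_of_set (carrier (G_group j))) ?f"
      using carrier by (auto simp: image_subset_iff_funcset)
    then have "continuous_map (top_of_set D) (Gbar_top j L) ?\<phi>"
      using quotient_imp_continuous_map[OF quotient_map_to_Gbar] by (rule continuous_map_compose)
    then show ?thesis using toM by (auto simp: continuous_map_in_subtopology simp del: comp_apply)
  qed
  have inj: "inj_on ?\<phi> D"
  proof (rule inj_onI)
    fix x y assume x: "x \<in> D" and y: "y \<in> D" and eq: "?\<phi> x = ?\<phi> y"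
    have "to_Gbar j L (fst (?f x), fst (snd (?f x)), snd (snd (?f x)))
        = to_Gbar j L (fst (?f y), fst (snd (?f y)), snd (snd (?f y)))" using eq by simp
    note q = to_Gbar_eqD[OF L this]
    then obtain l where l: "l \<in> L" "snd y = l + snd x" by (auto simp: fstf)
    have "norm l = norm (snd y - snd x)" using l(2) by simp
    also have "\<dots> \<le> norm (snd y) + norm (snd x)" by (rule norm_triangle_ineq4)
    also have "\<dots> < \<delta>" using x y by (simp add: D_def)
    finally have "l = 0" using \<delta>(2) l(1) by blast
    then have "snd (snd (?f y)) = snd (snd (?f x))" using l(2) by (simp add: fstf)
    then have "?f y = ?f x" using q(1,2) by (simp add: prod_eq_iff)
    then show "x = y" using props(3) by metis
  qed
  have open_map: "open_map (top_of_set D) ?T ?\<phi>"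
    unfolding open_map_def
  proof (intro allI impI)
    fix V assume "openin (top_of_set D) V"
    then obtain V0 where V0: "open V0" "V = D \<inter> V0" by (auto simp: openin_open)
    define P where "P = {p :: real \<times> 'v \<times> 'z. fst (snd p) \<bullet> e > 0}"
    define W where "W = {p. fst p > 0 \<and> fst p \<in> J \<and> norm (snd (snd p)) < \<delta> / 2} \<inter> (P \<inter> axis_coords e -` V0)"
    have "open P" unfolding P_def by (intro open_Collect_less continuous_intros)
    then have "open (P \<inter> axis_coords e -` V0)"
      using continuous_open_preimage[OF continuous_axis_coords[OF r e] _ V0(1)] by (simp add: P_def)
    moreover have "open {p :: real \<times> 'v \<times> 'z. fst p > 0 \<and> fst p \<in> J \<and> norm (snd (snd p)) < \<delta> / 2}"
    proof -
      have "open (fst -` J :: (real \<times> 'v \<times> 'z) set)" by (rule open_vimage_fst[OF J(1), folded vimage_fst])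
      then have "open {p :: real \<times> 'v \<times> 'z. fst p \<in> J}" by (simp add: vimage_def)
      then show ?thesis by (intro open_Collect_conj open_Collect_less continuous_intros)
    qed
    ultimately have "open W" unfolding W_def by (rule open_Int[rotated])
    then have W: "openin (Gbar_top j L) (to_Gbar j L ` W)"
      by (rule openin_to_Gbar_image[OF L]) (auto simp: W_def)
    have "?\<phi> ` V = to_Gbar j L ` W \<inter> M_sub j L t1 t2 r"
    proof (intro equalityI subsetI)
      fix C assume "C \<in> ?\<phi> ` V"
      then obtain x where x: "x \<in> V" "C = ?\<phi> x" by blast
      then have xD: "x \<in> D" "x \<in> V0" using V0 by auto
      have "?f x \<in> W"
        using xD pos[OF xD(1)] props(2)[of x] props(3)[of x] by (simp add: W_def P_def D_def fstf)
      then show "C \<in> to_Gbar j L ` W \<inter> M_sub j L t1 t2 r" using toM[OF xD(1)] x(2) by auto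
    next
      fix C assume C: "C \<in> to_Gbar j L ` W \<inter> M_sub j L t1 t2 r"
      then obtain p where p: "p \<in> W" "C = to_Gbar j L p" by blast
      obtain s X Z where pe: "p = (s, X, Z)" using prod_cases3 by blast
      have s: "s > 0" "s \<in> J" "norm Z < \<delta> / 2" "X \<bullet> e > 0" "axis_coords e p \<in> V0"
        using p(1) by (auto simp: W_def P_def pe)
      have M: "t1 \<le> s" "s \<le> t2" "norm X = r"
        using C to_Gbar_in_M[OF L s(1), of j X Z t1 t2 r] unfolding p(2) pe by blast+
      note c = coords[OF M(3) s(4), where t = s and Z = Z]
      have "axis_coords e p \<in> D" using c(2,3) s M by (simp add: D_def pe)
      then have "axis_coords e p \<in> V" using s(5) V0(2) by blast
      moreover have "?\<phi> (axis_coords e p) = C" using c(1) by (simp add: pe p(2))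
      ultimately show "C \<in> ?\<phi> ` V" by blast
    qed
    then show "openin ?T (?\<phi> ` V)" using W by (auto simp: openin_subtopology)
  qed
  have "chart_M j L t1 t2 r D ?f"
    unfolding chart_M_def Let_def
  proof (intro conjI ballI)
    show "embedding_map (top_of_set D) ?T ?\<phi>"
      using cont open_map inj by (simp add: injective_open_imp_embedding_map)
    show "openin ?T (?\<phi> ` D)" using open_map by (simp add: open_map_def)
  qed (use half carrier smooth inj_axis_chart_derivative[OF r e half] in auto)
  moreover have "(t *\<^sub>R e, 0) \<in> D"
    using t J \<delta>(1) e by (simp add: D_def norm_eq_sqrt_inner)
  ultimately show ?thesis by (rule that)
qed


section \<open>Negativity and the maximum of the curvature\<close>

definition orthonormal_curvatures :: "('z::euclidean_space \<Rightarrow> 'v::euclidean_space \<Rightarrow>\<^sub>L 'v) \<Rightarrow>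
    real \<Rightarrow> real \<Rightarrow> real \<Rightarrow> real \<Rightarrow> real set" where
  "orthonormal_curvatures j t1 t2 c r = (\<lambda>(t, n, a, b). curv_num j r c t n a b) ` orthonormal_pairs t1 t2"

lemma sectional_curvatures_M_subset:
  fixes j :: "'z::euclidean_space \<Rightarrow> 'v::euclidean_space \<Rightarrow>\<^sub>L 'v"
  assumes L: "full_rank_lattice L" and j: "linear j" "range j \<subseteq> so" and c: "c > 0" and r: "r > 0"
  shows "sectional_curvatures_M j L t1 t2 c r \<subseteq> orthonormal_curvatures j t1 t2 c r"
proof
  fix \<kappa> assume "\<kappa> \<in> sectional_curvatures_M j L t1 t2 c r"
  then obtain D f x u v where \<kappa>: "\<kappa> = sectional_curvature D (pullback_metric D f (G_metric j c)) x u v"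
    and chart: "chart_M j L t1 t2 r D f" and x: "x \<in> D" and uv: "u \<noteq> v" "independent {u, v}"
    unfolding sectional_curvatures_M_def by blast
  interpret cylinder_chart j c r D f by (rule chart_M_cylinder_chart(1)[OF L j c r chart])
  define a where "a = coframe x u"
  define b where "b = coframe x v"
  define n where "n = (1 / r) *\<^sub>R X x"
  note l = linear_coframe[OF x]
  have b0: "b \<bullet> b > 0"
  proof -
    have "v \<noteq> 0" using uv(2) dependent_zero by blast
    then have "b \<noteq> 0" using inj_coframe[OF x] linear_0[OF l] unfolding b_def by (metis injD)
    then show ?thesis by simp
  qed
  have det: "(a \<bullet> a) * (b \<bullet> b) - (a \<bullet> b)\<^sup>2 > 0"
  proof (rule ccontr)
    assume "\<not> ?thesis"
    then have d0: "(a \<bullet> a) * (b \<bullet> b) - (a \<bullet> b)\<^sup>2 = 0"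
      using Cauchy_Schwarz_ineq[of a b] by linarith
    \<comment> \<open>This is the case of equality in the Cauchy-Schwarz inequality.\<close>
    let ?w = "(b \<bullet> b) *\<^sub>R a - (a \<bullet> b) *\<^sub>R b"
    have "?w \<bullet> ?w = (b \<bullet> b) * ((a \<bullet> a) * (b \<bullet> b) - (a \<bullet> b)\<^sup>2)"
      by (simp add: inner_diff_left inner_diff_right inner_commute power2_eq_square algebra_simps)
    then have "coframe x ((b \<bullet> b) *\<^sub>R u) = coframe x ((a \<bullet> b) *\<^sub>R v)"
      using d0 by (simp add: linear_scale[OF l] a_def b_def)
    then have "(b \<bullet> b) *\<^sub>R u = (a \<bullet> b) *\<^sub>R v" using inj_coframe[OF x] by (rule injD[rotated])
    from arg_cong[OF this, of "\<lambda>z. (1 / (b \<bullet> b)) *\<^sub>R z"]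
    have "u = ((a \<bullet> b) / (b \<bullet> b)) *\<^sub>R v"
      using b0 by simp
    then have "u \<in> span {v}" by (auto simp: span_singleton)
    then show False using uv by (simp add: independent_insert)
  qed
  have normal: "n \<bullet> fst (snd (coframe x w)) = 0" for w
  proof -
    have "normal x \<bullet> coframe x w = 0" using range_coframe[OF x] by blast
    then show ?thesis by (cases "coframe x w") (simp add: normal_def n_def)
  qed
  have n: "norm n = 1" using radius[OF x] r by (simp add: n_def X_def)
  obtain p q l where pq: "(p *\<^sub>R a) \<bullet> (p *\<^sub>R a) = 1"
    "(q *\<^sub>R (b + l *\<^sub>R a)) \<bullet> (q *\<^sub>R (b + l *\<^sub>R a)) = 1" "(p *\<^sub>R a) \<bullet> (q *\<^sub>R (b + l *\<^sub>R a)) = 0"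
    "\<And>r c t n. curv_num j r c t n a b / ((a \<bullet> a) * (b \<bullet> b) - (a \<bullet> b)\<^sup>2)
       = curv_num j r c t n (p *\<^sub>R a) (q *\<^sub>R (b + l *\<^sub>R a))"
    using curv_num_normalize[OF j det] by blast
  have "(fst (f x), n, p *\<^sub>R a, q *\<^sub>R (b + l *\<^sub>R a)) \<in> orthonormal_pairs t1 t2"
    using chart_M_cylinder_chart(2)[OF L j c r chart x] n pq(1-3) normal[of u] normal[of v]
    unfolding orthonormal_pairs_def by (simp add: a_def b_def inner_add_right del: inner_scaleR_left)
  moreover have "\<kappa> = curv_num j r c (fst (f x)) n (p *\<^sub>R a) (q *\<^sub>R (b + l *\<^sub>R a))"
    unfolding \<kappa> sectional_curvature_chart[OF x] pq(4)[symmetric] by (simp add: a_def b_def n_def)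
  ultimately show "\<kappa> \<in> orthonormal_curvatures j t1 t2 c r"
    unfolding orthonormal_curvatures_def by (force intro: rev_image_eqI)
qed

text \<open>The chart around \<open>e = n\<close> contains a point with the given \<open>t\<close> and \<open>n\<close>, and its tangent space
  there is the full orthogonal complement of the normal.\<close>

lemma sectional_curvatures_M_superset:
  fixes j :: "'z::euclidean_space \<Rightarrow> 'v::euclidean_space \<Rightarrow>\<^sub>L 'v"
  assumes L: "full_rank_lattice L" and j: "linear j" "range j \<subseteq> so" and c: "c > 0" and r: "r > 0"
    and t12: "0 < t1" "t1 < t2"
  shows "orthonormal_curvatures j t1 t2 c r \<subseteq> sectional_curvatures_M j L t1 t2 c r"
proof
  fix \<kappa> assume "\<kappa> \<in> orthonormal_curvatures j t1 t2 c r"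
  then obtain t n a b where \<kappa>: "\<kappa> = curv_num j r c t n a b" and K: "(t, n, a, b) \<in> orthonormal_pairs t1 t2"
    unfolding orthonormal_curvatures_def by auto
  then have t: "t1 \<le> t" "t \<le> t2" and n: "norm n = 1" and ab: "a \<bullet> a = 1" "b \<bullet> b = 1" "a \<bullet> b = 0"
    and nab: "n \<bullet> fst (snd a) = 0" "n \<bullet> fst (snd b) = 0"
    by (auto simp: orthonormal_pairs_def)
  define f where "f = (axis_chart r n :: 'v \<times> 'z \<Rightarrow> _)"
  obtain D where chart: "chart_M j L t1 t2 r D f" and D: "(t *\<^sub>R n, 0) \<in> D"
    unfolding f_def using axis_chart_is_chart[OF L t12(1) t t12(2) r n] by blast
  define x where "x = (t *\<^sub>R n, 0 :: 'z)"
  have x: "x \<in> D" using D by (simp add: x_def)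
  interpret cylinder_chart j c r D f by (rule chart_M_cylinder_chart(1)[OF L j c r chart])
  have nn: "n \<bullet> n = 1" using n by (simp add: norm_eq_sqrt_inner)
  have fx: "f x = (t, r *\<^sub>R n, 0)"
    by (simp add: f_def x_def axis_chart_def Let_def nn)
  have normal: "normal x = (0, n, 0)" using r by (simp add: normal_def X_def fx)
  have "a \<in> range (coframe x)" "b \<in> range (coframe x)"
    using nab unfolding range_coframe[OF x] normal by (simp_all add: inner_prod_def)
  then obtain u v where u: "coframe x u = a" and v: "coframe x v = b" by blast
  note l = linear_coframe[OF x]
  have "u \<noteq> v" using u v ab by auto
  moreover have "independent {u, v}"
  proof -
    have "v \<noteq> 0" using v ab linear_0[OF l] by auto
    moreover have "u \<notin> span {v}"
    proof
      assume "u \<in> span {v}"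
      then obtain k where "u = k *\<^sub>R v" by (auto simp: span_singleton)
      then have "a = k *\<^sub>R b" using u v by (simp add: linear_scale[OF l])
      then show False using ab by auto
    qed
    ultimately show ?thesis by (simp add: independent_insert)
  qed
  moreover have "\<kappa> = sectional_curvature D (pullback_metric D f (G_metric j c)) x u v"
    unfolding sectional_curvature_chart[OF x] u v using r by (simp add: ab \<kappa> X_def fx)
  ultimately show "\<kappa> \<in> sectional_curvatures_M j L t1 t2 c r"
    unfolding sectional_curvatures_M_def using chart x by blast
qed

theorem theorem3p4:
  fixes j :: "'z::euclidean_space \<Rightarrow> 'v::euclidean_space \<Rightarrow>\<^sub>L 'v"
    and L :: "'z set" and t1 t2 r :: real
  assumes "full_rank_lattice L"
    and "0 < t1" and "t1 < t2"
    and "linear j" and "range j \<subseteq> so" and "j \<noteq> (\<lambda>Z. 0)"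
    and "r > 0"
  shows "(\<exists>l>0. \<forall>c>l. \<forall>\<kappa>\<in>sectional_curvatures_M j L t1 t2 c r. \<kappa> < 0) \<and>
    (\<exists>Kmax :: real \<Rightarrow> real.
       (\<forall>c>0. Kmax c \<in> sectional_curvatures_M j L t1 t2 c r \<and>
              (\<forall>\<kappa>\<in>sectional_curvatures_M j L t1 t2 c r. \<kappa> \<le> Kmax c)) \<and>
       filterlim Kmax at_bot at_top)"
proof -
  let ?S = "\<lambda>c. sectional_curvatures_M j L t1 t2 c r"
  have S: "?S c = orthonormal_curvatures j t1 t2 c r" if "c > 0" for c
    using sectional_curvatures_M_subset sectional_curvatures_M_superset assms that by blast
  have "\<exists>m\<in>?S c. \<forall>\<kappa>\<in>?S c. \<kappa> \<le> m" if "c > 0" for c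
  proof -
    have "continuous_on (orthonormal_pairs t1 t2) (\<lambda>(t, n, a, b). curv_num j r c t n a b)"
      using continuous_on_add[OF continuous_on_curv_terms(1)[OF assms(4), of _ c]
          continuous_on_curv_terms(2)[OF assms(4), of _ r]]
      by (simp add: curv_num_def case_prod_unfold add_diff_eq)
    from continuous_attains_sup[OF compact_orthonormal_pairs orthonormal_pairs_nonempty this] assms(3)
    show ?thesis unfolding S[OF that] orthonormal_curvatures_def by auto
  qed
  then obtain Kmax where Kmax: "\<And>c. c > 0 \<Longrightarrow> Kmax c \<in> ?S c"
    "\<And>c \<kappa>. c > 0 \<Longrightarrow> \<kappa> \<in> ?S c \<Longrightarrow> \<kappa> \<le> Kmax c" by metis
  obtain C1 C2 where C: "\<And>c t n a b. c > 0 \<Longrightarrow> (t, n, a, b) \<in> orthonormal_pairs t1 t2 \<Longrightarrow>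
    curv_num j r c t n a b \<le> - c\<^sup>2 / 4 + C1 * c + C2"
    using curv_num_bound[OF assms(4)] by blast
  have bound: "Kmax c \<le> - c\<^sup>2 / 4 + C1 * c + C2" if "c > 0" for c
    using Kmax(1)[OF that] C[OF that] unfolding S[OF that] orthonormal_curvatures_def by auto
  have "filterlim (\<lambda>c. - c\<^sup>2 / 4 + C1 * c + C2) at_bot at_top"
    by real_asymp
  moreover have "\<forall>\<^sub>F c in at_top. Kmax c \<le> - c\<^sup>2 / 4 + C1 * c + C2"
    by (rule eventually_mono[OF eventually_gt_at_top[of 0]]) (rule bound)
  ultimately have lim: "filterlim Kmax at_bot at_top"
    by (rule filterlim_at_bot_mono)
  then have "\<forall>\<^sub>F c in at_top. Kmax c < 0" by (simp add: filterlim_at_bot_dense)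
  then obtain l where l: "\<And>c. c \<ge> l \<Longrightarrow> Kmax c < 0" by (auto simp: eventually_at_top_linorder)
  have "\<forall>c>max l 1. \<forall>\<kappa>\<in>?S c. \<kappa> < 0"
  proof (intro allI impI ballI)
    fix c \<kappa> assume "c > max l 1" "\<kappa> \<in> ?S c"
    then show "\<kappa> < 0" using Kmax(2)[of c \<kappa>] l[of c] by fastforce
  qed
  then have "\<exists>l>0. \<forall>c>l. \<forall>\<kappa>\<in>?S c. \<kappa> < 0" by (intro exI[of _ "max l 1"]) auto
  then show ?thesis using Kmax lim by blast
qed

end
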